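(* Let $(X,d)$ be a (nonempty) compact metric space, $\alpha:X\to X$ a continuous map that is a non-contracting local homeomorphism on $X_\alpha$ (i.e. the restriction $\alpha:X_\alpha\to X_\alpha$ is a non-contracting local homeomorphism), and $A:C(X)\to C(X)$ an $X_\alpha$-compatible transfer operator for $(X,\alpha)$ whose cocycle $\rho$ is strictly positive on $X_\alpha$. Then for each strictly positive continuous extension of $\rho$ onto $X$ (again denoted $\rho$) and each $\psi\in C(X,\mathbb R)$ we have $$\lambda(\psi)=P(\alpha,\psi+\ln\rho).$$
   Context: A transfer operator for $(X,\alpha)$ is a positive linear operator $A:C(X)\to C(X)$ with $A((f\circ\alpha)g)=f\,Ag$ for all $f,g\in C(X)$. For $\psi\in C(X,\mathbb R)$ (real continuous functions), $A_\psi f:=A(e^\psi f)$ and $\lambda(\psi):=\lim_{n\to\infty}\frac1n\ln\|A_\psi^n\|$. $M_\alpha(X)$ is the set of Borel $\alpha$-invariant probability measures on $X$. A point $x\in X$ is essential if every neighborhood $V$ of $x$ satisfies $\mu(V)>0$ for some $\mu\in M_\alpha(X)$; $X_\alpha$ is the (closed) set of essential points, and $\alpha(X_\alpha)=X_\alpha$. For $x\in X_\alpha$ put $\tilde\alpha^{-1}(x):=\alpha^{-1}(x)\cap X_\alpha$. A local homeomorphism is a map such that every point has an open neighborhood mapped homeomorphically onto an open set; on $X_\alpha$ this makes all the sets $\tilde\alpha^{-1}(x)$ finite with uniformly bounded cardinality. A map $\alpha$ of a metric space into itself is non-contracting if there is $r>0$ such that $d(x,y)\le r$ implies $d(\alpha(x),\alpha(y))\ge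 d(x,y)$. Compatibility and cocycle: for $x\in X$ let $\nu_x$ be the regular Borel measure (possibly $0$) with $\int f\,d\nu_x=[Af](x)$ for $f\in C(X)$; its support lies in $\alpha^{-1}(x)$. $A$ is $X_\alpha$-compatible if for every $f\in C(X_\alpha)$ the function $x\mapsto\int_{X_\alpha}f\,d\nu_x$ is continuous on $X_\alpha$; then $[A_{X_\alpha}f](x):=\int_{X_\alpha}f\,d\nu_x$ defines a transfer operator on $C(X_\alpha)$. It has the form $[A_{X_\alpha}f](x)=\sum_{y\in\tilde\alpha^{-1}(x)}\rho(y)f(y)$, where $\rho(y)=\nu_{\alpha(y)}(\{y\})\ge0$, $y\in X_\alpha$; $\rho$ is called the cocycle. (When $\alpha$ is a local homeomorphism on $X_\alpha$, $\rho$ is continuous on $X_\alpha$.) Topological pressure (for positive $a\in C(X)$): with $d_n(x,y):=\max_{0\le i\le n-1}d(\alpha^i(x),\alpha^i(y))$, call $E\subset X$ $(n,\varepsilon)$-spanning if for every $x\in X$ there is $y\in E$ with $d_n(x,y)<\varepsilon$, and put $$P(\alpha,\ln a):=\ln\lim_{\varepsilon\to0}\limsup_{n\to\infty}\inf\Bigl\{\Bigl(\sum_{y\in E}\prod_{i=0}^{n-1}a(\alpha^i(y))\Bigr)^{1/n}: E\text{ is }(n,\varepsilon)\text{-spanning}\Bigr\}.$$ *)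

theory Defs
  imports "HOL-Probability.Probability"
begin

text \<open>
  The space \<open>X\<close> is a type of class \<open>metric_space\<close> whose universe is compact. The complex algebra
  \<open>C(X)\<close> is then the type \<^typ>\<open>'a::metric_space \<Rightarrow>\<^sub>C complex\<close> with its supremum norm, because every
  continuous function on a compact space is bounded.
\<close>

definition bcontfun_mult ::
    "('a::topological_space \<Rightarrow>\<^sub>C complex) \<Rightarrow> ('a \<Rightarrow>\<^sub>C complex) \<Rightarrow> ('a \<Rightarrow>\<^sub>C complex)" where
  "bcontfun_mult f g = Bcontfun (\<lambda>x. f x * g x)"

lemma apply_bcontfun_mult: "apply_bcontfun (bcontfun_mult f g) x = f x * g x"
proof -
  obtain B C where "\<And>x. norm (f x) \<le> B" "\<And>x. norm (g x) \<le> C"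
    using bounded_apply_bcontfun[of f] bounded_apply_bcontfun[of g] by (auto simp: bounded_iff)
  moreover from this have "0 \<le> B"
    by (meson norm_ge_zero order_trans)
  ultimately have "\<And>x. norm (f x * g x) \<le> B * C"
    by (auto simp: norm_mult intro!: mult_mono)
  then have "(\<lambda>x. f x * g x) \<in> bcontfun"
    by (auto simp: bcontfun_def bounded_iff intro!: continuous_intros)
  then show ?thesis
    by (simp add: bcontfun_mult_def Bcontfun_inverse)
qed

definition bcontfun_exp ::
    "('a::topological_space \<Rightarrow>\<^sub>C real) \<Rightarrow> ('a \<Rightarrow>\<^sub>C complex)" where
  "bcontfun_exp \<psi> = Bcontfun (\<lambda>x. complex_of_real (exp (\<psi> x)))"

lemma apply_bcontfun_exp: "apply_bcontfun (bcontfun_exp \<psi>) x = complex_of_real (exp (\<psi> x))"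
proof -
  obtain B where "\<And>x. \<bar>\<psi> x\<bar> \<le> B"
    using bounded_apply_bcontfun[of \<psi>] by (auto simp: bounded_iff)
  then have "\<And>x. norm (complex_of_real (exp (\<psi> x))) \<le> exp B"
    by (simp add: abs_le_iff)
  then have "(\<lambda>x. complex_of_real (exp (\<psi> x))) \<in> bcontfun"
    by (auto simp: bcontfun_def bounded_iff intro!: continuous_intros)
  then show ?thesis
    by (simp add: bcontfun_exp_def Bcontfun_inverse)
qed

text \<open>The term \<open>Bcontfun (f \<circ> \<alpha>)\<close> is meaningful only for continuous \<open>\<alpha>\<close>:\<close>

lemma apply_bcontfun_comp:
  fixes f :: "'b::topological_space \<Rightarrow>\<^sub>C 'c::metric_space"
  assumes "continuous_on UNIV \<alpha>"
  shows "apply_bcontfun (Bcontfun (f \<circ> \<alpha>)) x = f (\<alpha> x)"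
proof -
  have "f \<circ> \<alpha> \<in> bcontfun"
    using continuous_on_compose[OF assms continuous_on_apply_bcontfun]
      bounded_subset[OF bounded_apply_bcontfun[of f], of "range (f \<circ> \<alpha>)"]
    by (auto simp: bcontfun_def image_subset_iff)
  then show ?thesis
    by (simp add: Bcontfun_inverse)
qed

definition transfer_operator ::
    "('a::topological_space \<Rightarrow> 'a) \<Rightarrow> (('a \<Rightarrow>\<^sub>C complex) \<Rightarrow> ('a \<Rightarrow>\<^sub>C complex)) \<Rightarrow> bool" where
  "transfer_operator \<alpha> A \<longleftrightarrow>
     (\<forall>f g. A (f + g) = A f + A g) \<and>
     (\<forall>c f. A (bcontfun_mult (const_bcontfun c) f) = bcontfun_mult (const_bcontfun c) (A f)) \<and>
     (\<forall>f. (\<forall>x. apply_bcontfun f x \<in> \<real>\<^sub>\<ge>\<^sub>0) \<longrightarrow>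
           (\<forall>x. apply_bcontfun (A f) x \<in> \<real>\<^sub>\<ge>\<^sub>0)) \<and>
     (\<forall>f g. A (bcontfun_mult (Bcontfun (apply_bcontfun f \<circ> \<alpha>)) g) = bcontfun_mult f (A g))"

definition weighted_operator ::
    "(('a::topological_space \<Rightarrow>\<^sub>C complex) \<Rightarrow> ('a \<Rightarrow>\<^sub>C complex)) \<Rightarrow> ('a \<Rightarrow>\<^sub>C real)
      \<Rightarrow> ('a \<Rightarrow>\<^sub>C complex) \<Rightarrow> ('a \<Rightarrow>\<^sub>C complex)" where
  "weighted_operator A \<psi> f = A (bcontfun_mult (bcontfun_exp \<psi>) f)"

text \<open>The extended logarithm, with \<open>ln 0 = -\<infinity>\<close> (whereas \<open>ln 0 = 0\<close> on the reals):\<close>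

definition ereal_ln :: "ereal \<Rightarrow> ereal" where
  "ereal_ln x = (if x \<le> 0 then -\<infinity> else if x = \<infinity> then \<infinity> else ereal (ln (real_of_ereal x)))"

definition spectral_exponent ::
    "(('a::topological_space \<Rightarrow>\<^sub>C complex) \<Rightarrow> ('a \<Rightarrow>\<^sub>C complex)) \<Rightarrow> ('a \<Rightarrow>\<^sub>C real) \<Rightarrow> ereal" where
  "spectral_exponent A \<psi> =
     lim (\<lambda>n. ereal (1 / real n) * ereal_ln (ereal (onorm (weighted_operator A \<psi> ^^ n))))"

definition invariant_measures :: "('a::topological_space \<Rightarrow> 'a) \<Rightarrow> 'a measure set" where
  "invariant_measures \<alpha> = {\<mu>. sets \<mu> = sets borel \<and> prob_space \<mu> \<and> distr \<mu> borel \<alpha> = \<mu>}"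

definition essential_set :: "('a::topological_space \<Rightarrow> 'a) \<Rightarrow> 'a set" where
  "essential_set \<alpha> = {x. \<forall>V. open V \<and> x \<in> V \<longrightarrow> (\<exists>\<mu>\<in>invariant_measures \<alpha>. measure \<mu> V > 0)}"

definition local_homeomorphism_on :: "'a::topological_space set \<Rightarrow> ('a \<Rightarrow> 'a) \<Rightarrow> bool" where
  "local_homeomorphism_on S f \<longleftrightarrow>
     (\<forall>x\<in>S. \<exists>U V g. openin (top_of_set S) U \<and> x \<in> U \<and> openin (top_of_set S) V \<and>
        homeomorphism U V f g)"

definition non_contracting_on :: "'a::metric_space set \<Rightarrow> ('a \<Rightarrow> 'a) \<Rightarrow> bool" where
  "non_contracting_on S f \<longleftrightarrow>
     (\<exists>r>0. \<forall>x\<in>S. \<forall>y\<in>S. dist x y \<le> r \<longrightarrow> dist (f x) (f y) \<ge> dist x y)"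

text \<open>
  The measure \<open>\<nu>\<^sub>x\<close> representing the functional \<open>f \<mapsto> [Af](x)\<close>. Finiteness expresses that constants
  are integrable; a finite Borel measure on a compact metric space is regular, and it is
  determined by its integrals of continuous functions, so that \<open>THE\<close> is justified.
\<close>

definition fibre_measure ::
    "(('a::metric_space \<Rightarrow>\<^sub>C complex) \<Rightarrow> ('a \<Rightarrow>\<^sub>C complex)) \<Rightarrow> 'a \<Rightarrow> 'a measure" where
  "fibre_measure A x =
     (THE \<nu>. sets \<nu> = sets borel \<and> finite_measure \<nu> \<and>
        (\<forall>f. (LINT y|\<nu>. apply_bcontfun f y) = apply_bcontfun (A f) x))"

definition compatible ::
    "'a::metric_space set \<Rightarrow> (('a \<Rightarrow>\<^sub>C complex) \<Rightarrow> ('a \<Rightarrow>\<^sub>C complex)) \<Rightarrow> bool" where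
  "compatible S A \<longleftrightarrow>
     (\<forall>f :: 'a \<Rightarrow> complex. continuous_on S f \<longrightarrow>
        continuous_on S (\<lambda>x. LINT y:S|fibre_measure A x. f y))"

definition cocycle ::
    "('a::metric_space \<Rightarrow> 'a) \<Rightarrow> (('a \<Rightarrow>\<^sub>C complex) \<Rightarrow> ('a \<Rightarrow>\<^sub>C complex)) \<Rightarrow> 'a \<Rightarrow> real" where
  "cocycle \<alpha> A y = measure (fibre_measure A (\<alpha> y)) {y}"

text \<open>At \<open>n = 0\<close> the maximum is over the empty set, hence unspecified; only large \<open>n\<close> matter below.\<close>

definition dist_orbit :: "('a::metric_space \<Rightarrow> 'a) \<Rightarrow> nat \<Rightarrow> 'a \<Rightarrow> 'a \<Rightarrow> real" where
  "dist_orbit \<alpha> n x y = (MAX i\<in>{..<n}. dist ((\<alpha> ^^ i) x) ((\<alpha> ^^ i) y))"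

definition spanning :: "('a::metric_space \<Rightarrow> 'a) \<Rightarrow> nat \<Rightarrow> real \<Rightarrow> 'a set \<Rightarrow> bool" where
  "spanning \<alpha> n \<epsilon> E \<longleftrightarrow> (\<forall>x. \<exists>y\<in>E. dist_orbit \<alpha> n x y < \<epsilon>)"

text \<open>
  Topological pressure \<open>P(\<alpha>, \<phi>)\<close>, with \<open>a = exp \<circ> \<phi>\<close>. Only finite spanning sets are admitted: for
  continuous \<open>\<phi>\<close> on a compact space the sum over an infinite set diverges to \<open>\<infinity>\<close> and does not
  affect the infimum, whereas \<^const>\<open>sum\<close> would return \<open>0\<close>.
\<close>

definition pressure :: "('a::metric_space \<Rightarrow> 'a) \<Rightarrow> ('a \<Rightarrow> real) \<Rightarrow> ereal" where
  "pressure \<alpha> \<phi> =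
     ereal_ln (Lim (at_right 0) (\<lambda>\<epsilon>. limsup (\<lambda>n.
       INF E\<in>{E. finite E \<and> spanning \<alpha> n \<epsilon> E}.
         ereal (root n (\<Sum>y\<in>E. \<Prod>i<n. exp (\<phi> ((\<alpha> ^^ i) y)))))))"

end

theory Submission
  imports Defs
begin

text \<open>
  Let \<open>Y\<close> be the essential set, \<open>\<phi> = \<psi> + ln \<rho>\<close> and \<open>Z\<^sub>n\<close> the maximum over \<open>x\<close> of the sum of
  \<open>exp (\<phi> y + \<phi> (\<alpha> y) + \<dots>)\<close> over the \<open>y \<in> Y\<close> with \<open>\<alpha>\<^sup>n y = x\<close>. Both sides equal \<open>lim (ln Z\<^sub>n) / n\<close>.

  Let \<open>h\<close> be the distance to \<open>Y\<close>. By a Krylov-Bogoliubov argument the Birkhoff averages of \<open>h\<close> tend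
  to \<open>0\<close> uniformly, so replacing \<open>\<psi>\<close> by \<open>\<psi> - k h\<close> with \<open>k\<close> fixed changes neither side. As \<open>k\<close> grows,
  the \<open>m\<close>-th iterate of the penalised operator applied to \<open>1\<close> decreases pointwise to the fibre sum
  (and to \<open>0\<close> off \<open>Y\<close>), hence by a Dini argument it is eventually below any \<open>c > Z\<^sub>m\<close> on all of
  \<open>X\<close>; iterating blocks of length \<open>m\<close> bounds the operator side by \<open>(ln c) / m\<close>. For the pressure,
  orbits are cut into blocks of length \<open>m\<close>: blocks starting near \<open>Y\<close> are shadowed by \<open>m\<close>-fold
  preimages of a finite net of \<open>Y\<close>, because inverse branches on \<open>Y\<close> do not expand, and the penalty
  makes the other blocks negligible.
  Conversely the fibres \<open>\<alpha>\<^sup>-\<^sup>n x \<inter> Y\<close> are separated in the orbit metric, which gives the lower bound.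
\<close>

section \<open>Riesz representation on compact metric spaces\<close>

text \<open>Off the essential set nothing is known about \<alpha>, and the fibre measures may even
  be diffuse there; on the whole space fibre sums are in general discontinuous. Every estimate off
  the set is therefore bought with the penalty. What makes this work is the order of choices: first
  the block length \<open>m\<close> and the target \<open>c\<close>, then \<open>k\<close>, and last
  a \<delta> with \<open>k * \<delta>\<close> small. For large \<open>n\<close> the Birkhoff sums of
  \<open>h\<close> are at most \<open>n * \<delta>\<close>, so removing the penalty costs only
  \<open>exp (n * k * \<delta>)\<close>, while \<open>k\<close> does not depend on \<open>n\<close>.
  For the pressure, a net is placed at the final time of a block and pulled back; its size is then
  independent of \<open>m\<close>, and its contribution \<open>ln M / m\<close> to the rate dies
  out. Riesz representation is required twice: the fibre measure is a definite description, whose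
  existence and uniqueness must be shown, and the invariant measure is at first only a
  functional.\<close>

definition daniell_outer :: "(('a::topological_space \<Rightarrow> real) \<Rightarrow> real) \<Rightarrow> 'a set \<Rightarrow> ennreal" where
  "daniell_outer \<Lambda> E =
     (INF f\<in>{f::nat \<Rightarrow> 'a \<Rightarrow> real. (\<forall>i. continuous_on UNIV (f i) \<and> (\<forall>x. 0 \<le> f i x)) \<and>
              (\<forall>x\<in>E. 1 \<le> (\<Sum>i. ennreal (f i x)))}. \<Sum>i. ennreal (\<Lambda> (f i)))"

lemma daniell_outer_le:
  assumes "\<And>i. continuous_on UNIV (f i)" "\<And>i x. 0 \<le> f i x"
    and "\<And>x. x \<in> E \<Longrightarrow> 1 \<le> (\<Sum>i. ennreal (f i x))"
  shows "daniell_outer \<Lambda> E \<le> (\<Sum>i. ennreal (\<Lambda> (f i)))"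
  unfolding daniell_outer_def using assms by (intro INF_lower) auto

lemma integrable_continuous_compact:
  fixes f :: "'a::metric_space \<Rightarrow> 'b::{banach, second_countable_topology}"
  assumes "compact (UNIV :: 'a set)" "sets M = sets borel" "finite_measure M" "continuous_on UNIV f"
  shows "integrable M f"
proof -
  interpret finite_measure M by fact
  obtain B where "\<And>x. norm (f x) \<le> B"
    using compact_imp_bounded[OF compact_continuous_image[OF assms(4,1)]] by (auto simp: bounded_iff)
  moreover have "f \<in> borel_measurable M"
    unfolding measurable_cong_sets[OF assms(2) refl] using assms(4) by (rule borel_measurable_continuous_onI)
  ultimately show ?thesis by (intro integrable_const_bound[of f B]) auto
qed

section \<open>Daniell's outer measure of a positive functional\<close>

locale positive_functional =
  fixes \<Lambda> :: "('a::metric_space \<Rightarrow> real) \<Rightarrow> real"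
  assumes compact_UNIV: "compact (UNIV :: 'a set)"
    and add: "\<And>f g. continuous_on UNIV f \<Longrightarrow> continuous_on UNIV g \<Longrightarrow> \<Lambda> (\<lambda>x. f x + g x) = \<Lambda> f + \<Lambda> g"
    and scale: "\<And>c f. continuous_on UNIV f \<Longrightarrow> \<Lambda> (\<lambda>x. c * f x) = c * \<Lambda> f"
    and pos: "\<And>f. continuous_on UNIV f \<Longrightarrow> (\<And>x. 0 \<le> f x) \<Longrightarrow> 0 \<le> \<Lambda> f"
begin

lemma zero: "\<Lambda> (\<lambda>x. 0) = 0"
  using scale[of "\<lambda>x. 0" 0] by simp

lemma diff: "continuous_on UNIV f \<Longrightarrow> continuous_on UNIV g \<Longrightarrow> \<Lambda> (\<lambda>x. f x - g x) = \<Lambda> f - \<Lambda> g"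
  using add[of f "\<lambda>x. (-1) * g x"] scale[of g "-1"] by (simp add: continuous_on_minus)

lemma mono: "continuous_on UNIV f \<Longrightarrow> continuous_on UNIV g \<Longrightarrow> (\<And>x. f x \<le> g x) \<Longrightarrow> \<Lambda> f \<le> \<Lambda> g"
  using pos[of "\<lambda>x. g x - f x"] diff[of g f] by (simp add: continuous_on_diff)

lemma sum: "finite I \<Longrightarrow> (\<And>i. i \<in> I \<Longrightarrow> continuous_on UNIV (f i)) \<Longrightarrow>
    \<Lambda> (\<lambda>x. \<Sum>i\<in>I. f i x) = (\<Sum>i\<in>I. \<Lambda> (f i))"
  by (induction I rule: finite_induct) (simp_all add: zero add continuous_on_sum)

abbreviation "\<mu> \<equiv> daniell_outer \<Lambda>"

lemma outer_le_single:
  assumes f: "continuous_on UNIV f" "\<And>x. 0 \<le> f x" and E: "\<And>x. x \<in> E \<Longrightarrow> 1 \<le> f x"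
  shows "\<mu> E \<le> ennreal (\<Lambda> f)"
proof -
  let ?f = "\<lambda>i::nat. if i = 0 then f else (\<lambda>x. 0)"
  have s: "(\<Sum>i. ennreal (?f i x)) = ennreal (f x)" for x
    using suminf_finite[of "{0}" "\<lambda>i. ennreal (?f i x)"] by simp
  have "\<mu> E \<le> (\<Sum>i. ennreal (\<Lambda> (?f i)))"
    using f E by (intro daniell_outer_le) (auto simp: s)
  also have "\<dots> = ennreal (\<Lambda> f)"
    using suminf_finite[of "{0}" "\<lambda>i. ennreal (\<Lambda> (?f i))"] by (simp add: zero)
  finally show ?thesis .
qed

text \<open>Only countable subadditivity needs work: the cover of \<open>E n\<close> is chosen
  within \<open>e * (1/2) ^ Suc n\<close> of its infimum, and the double family of covering
  functions is listed as one sequence by \<open>prod_decode\<close>.\<close>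

lemma outer_space: "outer_measure_space (Pow UNIV) \<mu>"
  unfolding outer_measure_space_def
proof (intro conjI)
  have "\<mu> {} \<le> ennreal (\<Lambda> (\<lambda>x. 0))" by (rule outer_le_single) auto
  then show "positive (Pow UNIV) \<mu>" by (simp add: positive_def zero)
  show "increasing (Pow UNIV) \<mu>"
    unfolding increasing_def daniell_outer_def by (auto intro!: INF_superset_mono)
  show "countably_subadditive (Pow UNIV) \<mu>"
    unfolding countably_subadditive_def
  proof (intro allI impI)
    fix E :: "nat \<Rightarrow> 'a set"
    show "\<mu> (\<Union>i. E i) \<le> (\<Sum>i. \<mu> (E i))"
    proof (rule ennreal_le_epsilon)
      fix e :: real assume e: "0 < e" and fin: "(\<Sum>i. \<mu> (E i)) < top"
      have lt: "\<mu> (E n) < \<mu> (E n) + e * (1/2)^Suc n" for n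
        using e fin by (auto simp add: less_top dest!: ennreal_suminf_lessD)
      have "\<exists>f::nat \<Rightarrow> 'a \<Rightarrow> real. ((\<forall>i. continuous_on UNIV (f i) \<and> (\<forall>x. 0 \<le> f i x)) \<and>
              (\<forall>x\<in>E n. 1 \<le> (\<Sum>i. ennreal (f i x)))) \<and>
              (\<Sum>i. ennreal (\<Lambda> (f i))) \<le> \<mu> (E n) + e * (1/2)^Suc n" for n
      proof -
        define c where "c = \<mu> (E n) + ennreal (e * (1/2)^Suc n)"
        have "\<mu> (E n) < c" using lt[of n] by (simp add: c_def)
        then obtain f :: "nat \<Rightarrow> 'a \<Rightarrow> real"
          where f: "f \<in> {f. (\<forall>i. continuous_on UNIV (f i) \<and> (\<forall>x. 0 \<le> f i x)) \<and>
              (\<forall>x\<in>E n. 1 \<le> (\<Sum>i. ennreal (f i x)))}" and lt: "(\<Sum>i. ennreal (\<Lambda> (f i))) < c"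
          unfolding daniell_outer_def INF_less_iff by (elim bexE)
        then show ?thesis
          using f less_imp_le[OF lt] unfolding c_def mem_Collect_eq by (intro exI[of _ f] conjI) blast+
      qed
      then obtain F :: "nat \<Rightarrow> nat \<Rightarrow> 'a \<Rightarrow> real" where
        Fc: "\<And>n i. continuous_on UNIV (F n i)" and F0: "\<And>n i x. 0 \<le> F n i x"
        and F1: "\<And>n x. x \<in> E n \<Longrightarrow> 1 \<le> (\<Sum>i. ennreal (F n i x))"
        and Fs: "\<And>n. (\<Sum>i. ennreal (\<Lambda> (F n i))) \<le> \<mu> (E n) + e * (1/2)^Suc n"
        by metis
      define g where "g = (\<lambda>k. case prod_decode k of (n, i) \<Rightarrow> F n i)"
      have g: "g k = F (fst (prod_decode k)) (snd (prod_decode k))" for k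
        by (simp add: g_def split_beta)
      have "\<mu> (\<Union>i. E i) \<le> (\<Sum>k. ennreal (\<Lambda> (g k)))"
      proof (rule daniell_outer_le)
        fix x assume "x \<in> (\<Union>i. E i)"
        then obtain n where "x \<in> E n" by auto
        then have "1 \<le> (\<Sum>i. ennreal (F n i x))" by (rule F1)
        also have "\<dots> = (\<Sum>m\<in>{n}. \<Sum>i. ennreal (F m i x))" by simp
        also have "\<dots> \<le> (\<Sum>m. \<Sum>i. ennreal (F m i x))"
          by (rule sum_le_suminf) auto
        also have "\<dots> = (\<Sum>k. ennreal (g k x))"
          using suminf_ennreal_2dimen[of "\<lambda>m. \<Sum>i. ennreal (F m i x)" "\<lambda>(m,i). ennreal (F m i x)"]
          by (simp add: comp_def g split_beta)
        finally show "1 \<le> (\<Sum>k. ennreal (g k x))" .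
      qed (auto simp: g Fc F0)
      also have "\<dots> = (\<Sum>n. \<Sum>i. ennreal (\<Lambda> (F n i)))"
        using suminf_ennreal_2dimen[of "\<lambda>m. \<Sum>i. ennreal (\<Lambda> (F m i))" "\<lambda>(m,i). ennreal (\<Lambda> (F m i))"]
        by (simp add: comp_def g split_beta)
      also have "\<dots> \<le> (\<Sum>n. \<mu> (E n) + e * (1/2) ^ Suc n)"
        by (intro suminf_le Fs) auto
      also have "\<dots> = (\<Sum>n. \<mu> (E n)) + (\<Sum>n. ennreal e * ennreal ((1/2) ^ Suc n))"
        using e by (subst suminf_add[symmetric])
                       (auto simp del: ennreal_suminf_cmult simp add: ennreal_mult[symmetric])
      also have "\<dots> = (\<Sum>n. \<mu> (E n)) + e"
        unfolding ennreal_suminf_cmult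
        by (subst suminf_ennreal_eq[OF zero_le_power power_half_series]) auto
      finally show "\<mu> (\<Union>i. E i) \<le> (\<Sum>n. \<mu> (E n)) + e" .
    qed
  qed
qed

text \<open>The continuous cut-offs \<open>g j\<close> increase to the indicator of \<open>U\<close>, so a cover \<open>f i\<close> of \<open>E\<close> splits
  into the cover \<open>f i * (g (j + 1) - g j)\<close> of \<open>E \<inter> U\<close> and, for each \<open>j\<close>, the cover
  \<open>f i * (1 - g j)\<close> of \<open>E - U\<close>.\<close>

lemma outer_split_open:
  assumes "open U"
  shows "\<mu> (E \<inter> U) + \<mu> (E - U) \<le> \<mu> E"
\<comment> \<open>Here \<open>- U\<close> is empty and \<open>infdist\<close> to the empty set is
  \<open>0\<close>, so the cut-offs below would all vanish.\<close>
proof (cases "U = UNIV")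
  case True
  then show ?thesis using outer_space by (simp add: outer_measure_space_def positive_def)
next
  case False
  define g where "g j x = min 1 (real j * infdist x (-U))" for j x
  have gc: "continuous_on UNIV (g j)" for j
    unfolding g_def by (intro continuous_intros)
  have g0: "0 \<le> g j x" and g1: "g j x \<le> 1" and gS: "g j x \<le> g (Suc j) x" for j x
    unfolding g_def by (auto simp: infdist_nonneg intro!: min.coboundedI2 min.mono mult_right_mono)
  have gU: "g j x = 0" if "x \<notin> U" for j x
    using that by (simp add: g_def)
  have glim: "(\<lambda>j. g j x) \<longlonglongrightarrow> 1" if "x \<in> U" for x
  proof -
    have "0 < infdist x (-U)"
      using that assms False by (intro infdist_pos_not_in_closed) auto
    then obtain N where N: "1 < real N * infdist x (-U)"
      using reals_Archimedean3 by blast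
    have "\<forall>j\<ge>N. g j x = 1"
    proof (intro allI impI)
      fix j assume "N \<le> j"
      then have "real N * infdist x (-U) \<le> real j * infdist x (-U)"
        by (intro mult_right_mono) (auto simp: infdist_nonneg)
      then show "g j x = 1" using N by (simp add: g_def)
    qed
    then show ?thesis
      by (intro tendsto_eventually) (auto simp: eventually_sequentially)
  qed
  have g00: "g 0 x = 0" for x by (simp add: g_def)
  show ?thesis
    unfolding daniell_outer_def[of \<Lambda> E]
  proof (rule INF_greatest, clarsimp)
    fix f :: "nat \<Rightarrow> 'a \<Rightarrow> real"
    assume f: "\<forall>i. continuous_on UNIV (f i) \<and> (\<forall>x. 0 \<le> f i x)"
      and fE: "\<forall>x\<in>E. 1 \<le> (\<Sum>i. ennreal (f i x))"
    have fc[continuous_intros]: "continuous_on UNIV (f i)" and f0: "0 \<le> f i x" for i x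
      using f by auto
    note gc[continuous_intros]
    define L where "L i j = \<Lambda> (\<lambda>x. f i x * g j x)" for i j
    have L0: "0 \<le> L i j" and LS: "L i j \<le> L i (Suc j)" and Lf: "L i j \<le> \<Lambda> (f i)" for i j
      unfolding L_def using f0 g0 g1 gS
      by (auto intro!: pos mono continuous_intros mult_left_mono mult_left_le)
    define l where "l i = (SUP j. ennreal (L i j))" for i
    have incs: "incseq (\<lambda>j. ennreal (L i j))" for i
      using LS by (auto intro!: incseq_SucI ennreal_leI)
    have tel: "(\<Sum>j. ennreal (u (Suc j) - u j)) = (SUP j. ennreal (u j))"
      if u: "u 0 = 0" "\<And>j. u j \<le> u (Suc j)" for u :: "nat \<Rightarrow> real"
    proof -
      have nn: "0 \<le> u j" for j by (induction j) (use u in \<open>auto intro: order_trans\<close>)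
      have "(\<Sum>j<n. ennreal (u (Suc j) - u j)) = ennreal (u n)" for n
        using u sum_lessThan_telescope[of u n] by (simp add: sum_ennreal)
      then show ?thesis by (simp add: suminf_eq_SUP)
    qed
    have EU: "\<mu> (E \<inter> U) \<le> (\<Sum>i. l i)"
    proof -
      define F where "F k x = (case prod_decode k of (i,j) \<Rightarrow> f i x * (g (Suc j) x - g j x))" for k x
      have F: "F k = (\<lambda>x. f (fst (prod_decode k)) x *
          (g (Suc (snd (prod_decode k))) x - g (snd (prod_decode k)) x))" for k
        by (simp add: F_def split_beta fun_eq_iff)
      have "\<mu> (E \<inter> U) \<le> (\<Sum>k. ennreal (\<Lambda> (F k)))"
      proof (rule daniell_outer_le)
        fix x assume x: "x \<in> E \<inter> U"
        have s1: "(\<Sum>j. ennreal (f i x * (g (Suc j) x - g j x))) = ennreal (f i x)" for i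
        proof -
          have "(\<Sum>j. ennreal (f i x * g (Suc j) x - f i x * g j x)) = (SUP j. ennreal (f i x * g j x))"
            using f0[of i x] gS[of _ x] by (intro tel) (auto simp: g00 intro!: mult_left_mono)
          also have "\<dots> = ennreal (f i x)"
          proof (rule LIMSEQ_unique)
            show "(\<lambda>j. ennreal (f i x * g j x)) \<longlonglongrightarrow> (SUP j. ennreal (f i x * g j x))"
              using gS f0 by (intro LIMSEQ_SUP incseq_SucI ennreal_leI mult_left_mono)
            have "(\<lambda>j. f i x * g j x) \<longlonglongrightarrow> f i x * 1"
              using x by (intro tendsto_intros glim) auto
            then show "(\<lambda>j. ennreal (f i x * g j x)) \<longlonglongrightarrow> ennreal (f i x)"
              by (intro tendsto_ennrealI) simp
          qed
          finally show ?thesis by (simp add: right_diff_distrib)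
        qed
        have "1 \<le> (\<Sum>i. \<Sum>j. ennreal (f i x * (g (Suc j) x - g j x)))"
          using fE x by (simp add: s1)
        also have "\<dots> = (\<Sum>k. ennreal (F k x))"
          using suminf_ennreal_2dimen[of "\<lambda>i. \<Sum>j. ennreal (f i x * (g (Suc j) x - g j x))"
              "\<lambda>(i,j). ennreal (f i x * (g (Suc j) x - g j x))"]
          by (simp add: comp_def F split_beta)
        finally show "1 \<le> (\<Sum>k. ennreal (F k x))" .
      qed (use f0 gS in \<open>auto simp: F intro!: continuous_intros mult_nonneg_nonneg\<close>)
      also have "\<dots> = (\<Sum>i. \<Sum>j. ennreal (\<Lambda> (\<lambda>x. f i x * (g (Suc j) x - g j x))))"
        using suminf_ennreal_2dimen[of "\<lambda>i. \<Sum>j. ennreal (\<Lambda> (\<lambda>x. f i x * (g (Suc j) x - g j x)))"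
              "\<lambda>(i,j). ennreal (\<Lambda> (\<lambda>x. f i x * (g (Suc j) x - g j x)))"]
        by (simp add: comp_def F split_beta)
      also have "\<dots> = (\<Sum>i. \<Sum>j. ennreal (L i (Suc j) - L i j))"
        unfolding L_def right_diff_distrib by (subst diff) (auto intro!: continuous_intros)
      also have "\<dots> = (\<Sum>i. l i)"
        using LS unfolding l_def by (subst tel) (auto simp: L_def g00 zero)
      finally show ?thesis .
    qed
    have D: "\<mu> (E - U) + (\<Sum>i. ennreal (L i j)) \<le> (\<Sum>i. ennreal (\<Lambda> (f i)))" for j
    proof -
      have "\<mu> (E - U) \<le> (\<Sum>i. ennreal (\<Lambda> (\<lambda>x. f i x * (1 - g j x))))"
        using f0 g1 fE by (intro daniell_outer_le) (auto simp: gU intro!: continuous_intros mult_nonneg_nonneg)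
      also have "\<dots> = (\<Sum>i. ennreal (\<Lambda> (f i) - L i j))"
        unfolding L_def right_diff_distrib mult_1_right
        by (subst diff) (auto intro!: continuous_intros)
      finally have "\<mu> (E - U) + (\<Sum>i. ennreal (L i j)) \<le>
          (\<Sum>i. ennreal (\<Lambda> (f i) - L i j)) + (\<Sum>i. ennreal (L i j))"
        by (rule add_right_mono)
      also have "\<dots> = (\<Sum>i. ennreal (\<Lambda> (f i) - L i j) + ennreal (L i j))"
        by (intro suminf_add) auto
      also have "\<dots> = (\<Sum>i. ennreal (\<Lambda> (f i)))"
        using Lf L0 by (subst ennreal_plus[symmetric]) auto
      finally show ?thesis .
    qed
    \<comment> \<open>Monotone convergence in \<open>j\<close> turns the family of estimates
      \<open>D\<close> into a single one that contains the full bound for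
      \<open>E \<inter> U\<close>.\<close>
    have "(\<Sum>i. l i) = (SUP j. \<Sum>i. ennreal (L i j))"
      unfolding l_def by (rule ennreal_suminf_SUP_eq[OF incs])
    then have "\<mu> (E - U) + (\<Sum>i. l i) = (SUP j. \<mu> (E - U) + (\<Sum>i. ennreal (L i j)))"
      by (simp add: ennreal_SUP_add_right)
    also have "\<dots> \<le> (\<Sum>i. ennreal (\<Lambda> (f i)))"
      by (rule SUP_least) (rule D)
    finally show "\<mu> (E \<inter> U) + \<mu> (E - U) \<le> (\<Sum>i. ennreal (\<Lambda> (f i)))"
      using EU by (metis (no_types, lifting) add.commute add_left_mono order_trans)
  qed
qed

section \<open>The Riesz measure and its integral\<close>

definition riesz_measure :: "'a measure" where
  "riesz_measure = measure_of UNIV (sets borel) \<mu>"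

lemma sets_riesz_measure [simp]: "sets riesz_measure = sets borel"
  and space_riesz_measure [simp]: "space riesz_measure = UNIV"
  unfolding riesz_measure_def
  using sets.sets_measure_of_eq[of borel] sets.space_measure_of_eq[of borel] by auto

text \<open>Caratheodory's construction: by \<open>outer_split_open\<close> the open sets split
  every set additively, so the sigma-algebra of measurable sets contains all Borel sets.\<close>

lemma emeasure_riesz_measure:
  assumes "E \<in> sets borel"
  shows "emeasure riesz_measure E = \<mu> E"
proof -
  interpret P: sigma_algebra UNIV "Pow UNIV :: 'a set set" by (rule sigma_algebra_Pow)
  let ?L = "lambda_system UNIV (Pow UNIV) \<mu>"
  have L: "measure_space UNIV ?L \<mu>" by (rule P.caratheodory_lemma[OF outer_space])
  then interpret L: sigma_algebra UNIV ?L by (simp add: measure_space_def)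
  have "U \<in> ?L" if "open U" for U
  proof -
    have "\<mu> (E \<inter> U) + \<mu> (E - U) = \<mu> E" for E
    proof (rule antisym[rotated])
      show "\<mu> E \<le> \<mu> (E \<inter> U) + \<mu> (E - U)"
        using P.countably_subadditive_subadditive[of \<mu>] outer_space
        by (simp add: outer_measure_space_def subadditive_def)
          (metis Diff_disjoint Int_Diff_Un Int_Diff_disjoint)
    qed (rule outer_split_open[OF that])
    then show ?thesis unfolding P.lambda_system_eq by simp
  qed
  then have "sets borel \<subseteq> ?L"
    unfolding borel_def using L.sigma_sets_subset[of "{S. open S}"] by (auto simp: sets_measure_of_conv)
  then have "measure_space UNIV (sets borel) \<mu>"
    using measure_down[OF L, of "sets borel"] sets.sigma_algebra_axioms[of borel] by simp
  then show ?thesis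
    unfolding riesz_measure_def using assms
    by (intro emeasure_measure_of_sigma) (auto simp: measure_space_def)
qed

text \<open>For the lower bound let a sequence cover the whole space and let \<open>r < 1\<close>.
  The partial sums exceed \<open>r\<close> on open sets that exhaust the space, so by compactness
  one partial sum exceeds \<open>r\<close> everywhere, and positivity gives
  \<open>r * \<Lambda> 1\<close> as a lower bound. Then \<open>r\<close> tends to
  \<open>1\<close>.\<close>

lemma outer_UNIV: "\<mu> UNIV = ennreal (\<Lambda> (\<lambda>x. 1))"
proof (rule antisym)
  show "\<mu> UNIV \<le> ennreal (\<Lambda> (\<lambda>x. 1))" by (rule outer_le_single) auto
  show "ennreal (\<Lambda> (\<lambda>x. 1)) \<le> \<mu> UNIV"
    unfolding daniell_outer_def
  proof (rule INF_greatest, clarsimp)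
    fix f :: "nat \<Rightarrow> 'a \<Rightarrow> real"
    assume f: "\<forall>i. continuous_on UNIV (f i) \<and> (\<forall>x. 0 \<le> f i x)"
      and f1: "\<forall>x. 1 \<le> (\<Sum>i. ennreal (f i x))"
    let ?s = "\<lambda>n x. \<Sum>i<n. f i x"
    have sc: "continuous_on UNIV (?s n)" for n using f by (intro continuous_on_sum) auto
    have smono: "?s m x \<le> ?s n x" if "m \<le> n" for m n x
      using f that by (intro sum_mono2) auto
    have "ennreal (r * \<Lambda> (\<lambda>x. 1)) \<le> (\<Sum>i. ennreal (\<Lambda> (f i)))" if r: "0 < r" "r < 1" for r
    proof -
      have op: "open {x. r < ?s n x}" for n
        by (rule open_Collect_less[OF continuous_on_const sc])
      have cov: "UNIV \<subseteq> (\<Union>n. {x. r < ?s n x})"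
      proof
        fix x
        have "ennreal r < (\<Sum>i. ennreal (f i x))"
          using f1 r ennreal_less_iff[of r 1] by (metis ennreal_1 less_imp_le less_le_trans)
        then obtain n where "ennreal r < (\<Sum>i<n. ennreal (f i x))"
          unfolding suminf_eq_SUP less_SUP_iff by auto
        then have "r < ?s n x"
          using f r by (simp add: sum_ennreal ennreal_less_iff)
        then show "x \<in> (\<Union>n. {x. r < ?s n x})" by auto
      qed
      obtain D where D: "finite D" "UNIV \<subseteq> (\<Union>n\<in>D. {x. r < ?s n x})"
        by (rule compactE_image[OF compact_UNIV, of UNIV "\<lambda>n. {x. r < ?s n x}"]) (use op cov in auto)
      define n where "n = Max (insert 0 D)"
      have "r * 1 \<le> ?s n x" for x
      proof -
        obtain m where m: "m \<in> D" "r < ?s m x" using D(2) by auto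
        then have "m \<le> n" using D(1) by (simp add: n_def)
        then show ?thesis using smono[of m n x] m(2) by linarith
      qed
      then have "\<Lambda> (\<lambda>x. r * 1) \<le> \<Lambda> (?s n)"
        by (intro mono) (auto simp: sc)
      also have "\<dots> = (\<Sum>i<n. \<Lambda> (f i))" using f by (intro sum) auto
      finally have "r * \<Lambda> (\<lambda>x. 1) \<le> (\<Sum>i<n. \<Lambda> (f i))"
        using scale[of "\<lambda>x. 1" r] by simp
      then have "ennreal (r * \<Lambda> (\<lambda>x. 1)) \<le> ennreal (\<Sum>i<n. \<Lambda> (f i))" by (rule ennreal_leI)
      also have "\<dots> = (\<Sum>i<n. ennreal (\<Lambda> (f i)))" using f by (subst sum_ennreal) (auto intro: pos)
      also have "\<dots> \<le> (\<Sum>i. ennreal (\<Lambda> (f i)))" by (rule sum_le_suminf) auto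
      finally show ?thesis .
    qed
    then have "\<forall>\<^sub>F r in at_left 1. ennreal (r * \<Lambda> (\<lambda>x. 1)) \<le> (\<Sum>i. ennreal (\<Lambda> (f i)))"
      by (intro eventually_at_leftI[of 0]) auto
    moreover have "((\<lambda>r. ennreal (r * \<Lambda> (\<lambda>x. 1))) \<longlongrightarrow> ennreal (1 * \<Lambda> (\<lambda>x. 1))) (at_left 1)"
      by (intro tendsto_ennrealI tendsto_intros)
    ultimately show "ennreal (\<Lambda> (\<lambda>x. 1)) \<le> (\<Sum>i. ennreal (\<Lambda> (f i)))"
      by (intro tendsto_upperbound[where F="at_left 1"]) auto
  qed
qed

sublocale R: finite_measure riesz_measure
  by (rule finite_measureI) (simp add: emeasure_riesz_measure outer_UNIV)

lemma measure_riesz_UNIV: "measure riesz_measure UNIV = \<Lambda> (\<lambda>x. 1)"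
  using emeasure_riesz_measure[of UNIV] pos[of "\<lambda>x. 1"] by (simp add: outer_UNIV measure_def)

lemma bounded_continuous: "continuous_on UNIV f \<Longrightarrow> \<exists>B\<ge>0. \<forall>x. \<bar>f x\<bar> \<le> B" for f :: "'a \<Rightarrow> real"
  using compact_continuous_image[of UNIV f] compact_UNIV
  by (metis bounded_pos compact_imp_bounded less_imp_le rangeI real_norm_def)

lemma integrable_riesz: "continuous_on UNIV f \<Longrightarrow> integrable riesz_measure f" for f :: "'a \<Rightarrow> real"
  by (rule integrable_continuous_compact[OF compact_UNIV sets_riesz_measure R.finite_measure_axioms])

text \<open>Cut \<open>f\<close> into horizontal slices of height \<open>1 / N\<close>.\<close>

lemma integral_riesz_le:
  assumes f: "continuous_on UNIV f" and f0: "\<And>x. 0 \<le> f x"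
  shows "integral\<^sup>L riesz_measure f \<le> \<Lambda> f"
proof -
  obtain B where B: "0 \<le> B" "\<And>x. \<bar>f x\<bar> \<le> B" using bounded_continuous[OF f] by auto
  have "integral\<^sup>L riesz_measure f \<le> \<Lambda> f + \<Lambda> (\<lambda>x. 1) * (1 / real N)" if N: "N > 0" for N :: nat
  proof -
    obtain K :: nat where K: "B * real N \<le> real K" using real_arch_simple by blast
    define s where "s k x = min (1/real N) (max 0 (f x - real k / real N))" for k x
    define S where "S k = {x. real (Suc k) / real N \<le> f x}" for k
    have sc: "continuous_on UNIV (s k)" for k unfolding s_def by (intro continuous_intros f)
    have s0: "0 \<le> s k x" for k x by (simp add: s_def)
    have ssum: "(\<Sum>k<m. s k x) = min (f x) (real m / real N)" for m x
    proof (induction m)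
      case (Suc m)
      have "0 < 1 / real N" using N by simp
      then have "s m x = min (f x) (real m / real N + 1 / real N) - min (f x) (real m / real N)"
        unfolding s_def by linarith
      then show ?case using Suc by (simp add: add_divide_distrib add.commute)
    qed (simp add: f0 min_absorb2)
    have sfull: "(\<Sum>k<K. s k x) = f x" for x
    proof -
      have "f x * real N \<le> real K"
        using B(2)[of x] K N by (smt (verit) mult_right_mono of_nat_0_le_iff)
      then show ?thesis using N by (simp add: ssum field_simps)
    qed
    have Sb: "S k \<in> sets borel" for k
      unfolding S_def using f by (intro borel_closed closed_Collect_le continuous_intros)
    \<comment> \<open>On \<open>S k\<close> the slice \<open>s k\<close> has its full height, so the
      single function \<open>N * s k\<close> is an admissible cover of \<open>S k\<close>.\<close>
    have mS: "measure riesz_measure (S k) \<le> real N * \<Lambda> (s k)" for k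
    proof -
      have "emeasure riesz_measure (S k) \<le> ennreal (\<Lambda> (\<lambda>x. real N * s k x))"
        unfolding emeasure_riesz_measure[OF Sb] using N s0 sc
        by (intro outer_le_single) (auto intro!: continuous_intros simp: S_def s_def min_def field_simps)
      then show ?thesis
        using pos[OF sc s0, of k] N
        by (simp add: scale[OF sc] R.emeasure_eq_measure)
    qed
    \<comment> \<open>At every point at most one slice is neither empty nor full; it accounts for
      the term \<open>1 / N\<close>.\<close>
    have fle: "f x \<le> 1 / real N + (\<Sum>k<K. (1/real N) * indicator (S k) x)" for x
    proof -
      have "(\<Sum>k<m. s k x) \<le> 1 / real N + (\<Sum>k<m. (1/real N) * indicator (S k) x)" for m
      proof (induction m)
        case (Suc m)
        show ?case
        proof (cases "x \<in> S m")
          case True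
          have "s m x \<le> 1 / real N" by (simp add: s_def)
          then show ?thesis using True Suc by simp
        next
          case False
          then have "f x < real (Suc m) / real N" by (simp add: S_def)
          show ?thesis
          proof (cases "f x \<le> real m / real N")
            case True
            then have "s m x = 0" by (simp add: s_def)
            then show ?thesis using False Suc by simp
          next
            case gt: False
            have "x \<in> S k" if "k < m" for k
            proof -
              have "real (Suc k) / real N \<le> real m / real N"
                using that N by (intro divide_right_mono) auto
              then show ?thesis using gt by (simp add: S_def)
            qed
            then have "(\<Sum>k<m. (1/real N) * indicator (S k) x) = real m / real N" by simp
            then show ?thesis
              unfolding ssum using \<open>f x < real (Suc m) / real N\<close> False by (simp add: add_divide_distrib)
          qed
        qed
      qed (simp)
      then show ?thesis using sfull[of x] by metis
    qed
    have "integral\<^sup>L riesz_measure f \<le> integral\<^sup>L riesz_measure (\<lambda>x. 1 / real N + (\<Sum>k<K. (1/real N) * indicator (S k) x))"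
      using fle Sb by (intro integral_mono[OF integrable_riesz[OF f]] Bochner_Integration.integrable_add
        Bochner_Integration.integrable_sum integrable_mult_right)
        (auto simp: R.emeasure_eq_measure)
    also have "\<dots> = measure riesz_measure UNIV / real N + (\<Sum>k<K. (1/real N) * measure riesz_measure (S k))"
      using Sb by (subst Bochner_Integration.integral_add)
        (auto simp: R.emeasure_eq_measure intro!: Bochner_Integration.integrable_sum)
    also have "\<dots> \<le> measure riesz_measure UNIV / real N + (\<Sum>k<K. \<Lambda> (s k))"
      using mS N by (intro add_left_mono sum_mono) (simp add: field_simps)
    also have "(\<Sum>k<K. \<Lambda> (s k)) = \<Lambda> f"
      using sum[of "{..<K}" s] sc by (simp add: sfull)
    finally show ?thesis by (simp add: measure_riesz_UNIV)
  qed
  then have "\<forall>\<^sub>F N in sequentially. integral\<^sup>L riesz_measure f \<le> \<Lambda> f + \<Lambda> (\<lambda>x. 1) * (1 / real N)"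
    by (intro eventually_sequentiallyI[of 1]) auto
  moreover have "(\<lambda>N. \<Lambda> f + \<Lambda> (\<lambda>x. 1) * (1 / real N)) \<longlonglongrightarrow> \<Lambda> f + \<Lambda> (\<lambda>x. 1) * 0"
    by (intro tendsto_intros lim_1_over_n)
  ultimately show ?thesis
    by (intro tendsto_lowerbound[where F=sequentially]) auto
qed

text \<open>The one-sided estimate is applied to \<open>B + f\<close> and \<open>B - f\<close>.
  Since the total mass equals \<open>\<Lambda> 1\<close> exactly, the constants cancel and two
  opposite inequalities for \<open>f\<close> remain.\<close>

theorem integral_riesz:
  assumes f: "continuous_on UNIV f"
  shows "integral\<^sup>L riesz_measure f = \<Lambda> f"
proof -
  obtain B where B: "0 \<le> B" "\<And>x. \<bar>f x\<bar> \<le> B" using bounded_continuous[OF f] by auto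
  have B': "0 \<le> B + f x" "0 \<le> B - f x" for x using B(2)[of x] by auto
  have c: "continuous_on UNIV (\<lambda>x. B)" by simp
  have LB: "\<Lambda> (\<lambda>x. B) = B * measure riesz_measure UNIV"
    using scale[of "\<lambda>x. 1" B] by (simp add: measure_riesz_UNIV)
  have "integral\<^sup>L riesz_measure (\<lambda>x. B + f x) \<le> \<Lambda> (\<lambda>x. B + f x)"
    using B' f by (intro integral_riesz_le continuous_intros)
  moreover have "integral\<^sup>L riesz_measure (\<lambda>x. B - f x) \<le> \<Lambda> (\<lambda>x. B - f x)"
    using B' f by (intro integral_riesz_le continuous_intros)
  ultimately show ?thesis
    using integrable_riesz[OF f] by (simp add: add[OF c f] diff[OF c f] LB)
qed

end

text \<open>The indicator of a nonempty closed set is the bounded limit of the functions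
  \<open>max 0 (1 - k * infdist x F)\<close>, so the measures agree on closed sets, which form an
  intersection-stable generator.\<close>

lemma finite_borel_measure_eqI:
  fixes M N :: "'a::metric_space measure"
  assumes sets: "sets M = sets borel" "sets N = sets borel"
    and fin: "finite_measure M" "finite_measure N"
    and eq: "\<And>f::'a \<Rightarrow> real. continuous_on UNIV f \<Longrightarrow> (\<And>x. 0 \<le> f x) \<Longrightarrow> (\<And>x. f x \<le> 1) \<Longrightarrow>
        integral\<^sup>L M f = integral\<^sup>L N f"
  shows "M = N"
proof -
  have lim: "(\<lambda>k. integral\<^sup>L P (\<lambda>x. max 0 (1 - real k * infdist x F))) \<longlonglongrightarrow> measure P F"
    if P: "sets P = sets borel" "finite_measure P" and F: "closed F" "F \<noteq> {}" for P and F :: "'a set"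
  proof -
    interpret P: finite_measure P by fact
    have spcP: "space P = UNIV" using sets_eq_imp_space_eq[OF P(1)] by simp
    have FP: "F \<in> sets P" using P F by simp
    have "(\<lambda>k. integral\<^sup>L P (\<lambda>x. max 0 (1 - real k * infdist x F))) \<longlonglongrightarrow> integral\<^sup>L P (indicator F)"
    proof (rule integral_dominated_convergence[where w="\<lambda>x. 1"])
      show "AE x in P. (\<lambda>k. max 0 (1 - real k * infdist x F)) \<longlonglongrightarrow> indicator F x"
      proof (rule AE_I2)
        fix x
        show "(\<lambda>k. max 0 (1 - real k * infdist x F)) \<longlonglongrightarrow> indicator F x"
        proof (cases "x \<in> F")
          case False
          then have p: "0 < infdist x F" using F by (intro infdist_pos_not_in_closed) auto
          then obtain N where N: "1 < real N * infdist x F" using reals_Archimedean3 by blast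
          have "max 0 (1 - real k * infdist x F) = 0" if "N \<le> k" for k
          proof -
            have "real N * infdist x F \<le> real k * infdist x F"
              using that p by (intro mult_right_mono) auto
            then show ?thesis using N by simp
          qed
          then show ?thesis using False
            by (intro tendsto_eventually) (auto simp: eventually_sequentially)
        qed simp
      qed
      show "(\<lambda>x. max 0 (1 - real k * infdist x F)) \<in> borel_measurable P" for k
        unfolding measurable_cong_sets[OF P(1) refl]
        by (intro borel_measurable_continuous_onI continuous_intros)
      show "AE x in P. norm (max 0 (1 - real k * infdist x F)) \<le> 1" for k
        by (intro AE_I2) (auto simp: infdist_nonneg)
    qed (use FP in auto)
    also have "integral\<^sup>L P (indicator F) = measure P F" using FP by (simp add: P.emeasure_eq_measure spcP)
    finally show ?thesis .
  qed
  have closed_eq: "emeasure M F = emeasure N F" if "closed F" for F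
  proof (cases "F = {}")
    case False
    have "integral\<^sup>L M (\<lambda>x. max 0 (1 - real k * infdist x F)) = integral\<^sup>L N (\<lambda>x. max 0 (1 - real k * infdist x F))" for k
      by (intro eq continuous_intros) (auto simp: infdist_nonneg)
    then have "measure M F = measure N F"
      using lim[OF sets(1) fin(1) that False] lim[OF sets(2) fin(2) that False] LIMSEQ_unique by auto
    then show ?thesis using fin by (simp add: finite_measure.emeasure_eq_measure)
  qed simp
  show ?thesis
  proof (rule measure_eqI_generator_eq[where E="{F. closed F}" and \<Omega>=UNIV and A="\<lambda>i. UNIV"])
    show "Int_stable {F::'a set. closed F}" by (auto simp: Int_stable_def)
    show "sets M = sigma_sets UNIV {F. closed F}" "sets N = sigma_sets UNIV {F. closed F}"
      unfolding sets borel_eq_closed by simp_all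
    show "emeasure M UNIV \<noteq> \<infinity>" using fin(1) by (simp add: finite_measure.emeasure_eq_measure)
  qed (auto simp: closed_eq)
qed

section \<open>Invariant measures and the essential set\<close>

lemma continuous_imp_bcontfun:
  fixes f :: "'a::topological_space \<Rightarrow> 'b::metric_space"
  assumes "compact (UNIV :: 'a set)" "continuous_on UNIV f"
  shows "f \<in> bcontfun"
  using compact_imp_bounded[OF compact_continuous_image[OF assms(2,1)]] assms(2) by (simp add: bcontfun_def)

lemma continuous_on_funpow:
  fixes \<alpha> :: "'a::topological_space \<Rightarrow> 'a"
  assumes "continuous_on UNIV \<alpha>"
  shows "continuous_on UNIV (\<alpha> ^^ n)"
proof (induction n)
  case (Suc n)
  show ?case
    unfolding funpow.simps by (rule continuous_on_compose[OF Suc continuous_on_subset[OF assms]]) simp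
qed simp

definition birkhoff_sum :: "('a \<Rightarrow> 'a) \<Rightarrow> ('a \<Rightarrow> real) \<Rightarrow> nat \<Rightarrow> 'a \<Rightarrow> real" where
  "birkhoff_sum \<alpha> f n x = (\<Sum>i<n. f ((\<alpha> ^^ i) x))"

lemma continuous_on_birkhoff_sum:
  fixes \<alpha> :: "'a::topological_space \<Rightarrow> 'a"
  assumes "continuous_on UNIV \<alpha>" "continuous_on UNIV f"
  shows "continuous_on UNIV (birkhoff_sum \<alpha> f n)"
  unfolding birkhoff_sum_def
  by (intro continuous_on_sum continuous_on_compose2[OF assms(2) continuous_on_funpow[OF assms(1)]]) auto

lemma abs_birkhoff_sum_le:
  assumes "\<And>x. \<bar>f x\<bar> \<le> B"
  shows "\<bar>birkhoff_sum \<alpha> f n x\<bar> \<le> n * B"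
proof -
  have "\<bar>birkhoff_sum \<alpha> f n x\<bar> \<le> (\<Sum>i<n. \<bar>f ((\<alpha> ^^ i) x)\<bar>)"
    unfolding birkhoff_sum_def by (rule sum_abs)
  also have "\<dots> \<le> (\<Sum>i<n. B)" by (intro sum_mono assms)
  finally show ?thesis by simp
qed

lemma birkhoff_sum_add: "birkhoff_sum \<alpha> f (m + n) x = birkhoff_sum \<alpha> f m x + birkhoff_sum \<alpha> f n ((\<alpha> ^^ m) x)"
  unfolding birkhoff_sum_def
  by (induction n) (simp_all add: funpow_add add.commute[of m] add.assoc)

lemma birkhoff_sum_Suc: "birkhoff_sum \<alpha> f (Suc n) x = f x + birkhoff_sum \<alpha> f n (\<alpha> x)"
  using birkhoff_sum_add[of \<alpha> f 1 n x] by (simp add: birkhoff_sum_def)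

text \<open>Only two boundary terms survive the telescoping. Divided by \<open>n\<close> they
  vanish, which makes limits of empirical averages invariant.\<close>

lemma birkhoff_sum_comp: "birkhoff_sum \<alpha> (f \<circ> \<alpha>) n x = birkhoff_sum \<alpha> f n x + f ((\<alpha> ^^ n) x) - f x"
  unfolding birkhoff_sum_def by (induction n) simp_all

text \<open>The invariant measure is obtained from a cluster point of the empirical functionals in the
  product of the intervals \<open>[-\<parallel>u\<parallel>, \<parallel>u\<parallel>]\<close>, which is compact by Tychonoff's theorem.\<close>

theorem krylov_bogoliubov:
  fixes \<alpha> :: "'a::metric_space \<Rightarrow> 'a" and h :: "'a \<Rightarrow> real"
  assumes compact: "compact (UNIV :: 'a set)" and \<alpha>: "continuous_on UNIV \<alpha>" and h: "continuous_on UNIV h"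
    and freq: "\<exists>\<^sub>F n in sequentially. \<exists>x. real n * \<delta> \<le> birkhoff_sum \<alpha> h n x"
  shows "\<exists>\<mu>\<in>invariant_measures \<alpha>. \<delta> \<le> integral\<^sup>L \<mu> h"
proof -
  define P where "P n \<longleftrightarrow> (\<exists>x. real n * \<delta> \<le> birkhoff_sum \<alpha> h n x)" for n
  define X where "X n = (SOME x. real n * \<delta> \<le> birkhoff_sum \<alpha> h n x)" for n
  have X: "real n * \<delta> \<le> birkhoff_sum \<alpha> h n (X n)" if "P n" for n
    using that unfolding P_def X_def by (rule someI_ex)
  define avg where "avg n u = birkhoff_sum \<alpha> (apply_bcontfun u) n (X n) / real n" for n and u :: "'a \<Rightarrow>\<^sub>C real"
  \<comment> \<open>Restricting to the good indices keeps the lower bound \<delta> at every cluster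
    point; \<open>freq\<close> makes the filter proper.\<close>
  define F where "F = inf sequentially (principal {n. P n \<and> 0 < n})"
  have F: "F \<noteq> bot"
  proof
    assume "F = bot"
    then have "eventually (\<lambda>n. False) F" by simp
    then have "\<forall>\<^sub>F n in sequentially. \<not> (P n \<and> 0 < n)"
      unfolding F_def eventually_inf_principal by (auto elim: eventually_mono)
    then have "\<forall>\<^sub>F n in sequentially. \<not> P n"
      using eventually_gt_at_top[of 0] by eventually_elim auto
    then show False using freq by (simp add: frequently_def P_def)
  qed
  have Fseq: "eventually Q F" if "eventually Q sequentially" for Q
    using that unfolding F_def by (auto simp: eventually_inf_principal elim: eventually_mono)
  have FP: "\<forall>\<^sub>F n in F. P n \<and> 0 < n" unfolding F_def eventually_inf_principal by simp
  have avg_bound: "\<bar>avg n u\<bar> \<le> norm u" for n u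
    using abs_birkhoff_sum_le[of "apply_bcontfun u" "norm u" \<alpha> n "X n"] norm_bounded[of u]
    by (cases "n = 0") (auto simp: avg_def abs_divide field_simps)
  define K where "K = (\<Pi>\<^sub>E u\<in>(UNIV::('a \<Rightarrow>\<^sub>C real) set). {- norm u .. norm u})"
  have "compactin (product_topology (\<lambda>_. euclidean) UNIV) K"
    unfolding K_def by (subst compactin_PiE) auto
  then have "compact K" by (simp add: euclidean_product_topology)
  moreover have "filtermap avg F \<noteq> bot" using F by (simp add: filtermap_bot_iff)
  moreover have "eventually (\<lambda>L. L \<in> K) (filtermap avg F)"
    unfolding eventually_filtermap K_def using avg_bound by (auto intro!: always_eventually simp: abs_le_iff minus_le_iff)
  ultimately obtain L where L: "inf (nhds L) (filtermap avg F) \<noteq> bot"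
    unfolding compact_filter by blast
  \<comment> \<open>A cluster point lies in every closed set that eventually contains the averages.
    Hence each property of \<open>L\<close> below is phrased as a closed condition on
    functionals.\<close>
  have lim: "L \<in> S" if "closed S" "\<forall>\<^sub>F n in F. avg n \<in> S" for S
  proof (rule ccontr)
    assume "L \<notin> S"
    then have "eventually (\<lambda>x. x \<in> -S) (nhds L)"
      using that(1) by (intro eventually_nhds_in_open) auto
    moreover have "eventually (\<lambda>x. x \<in> S) (filtermap avg F)"
      using that(2) by (simp add: eventually_filtermap)
    ultimately have "eventually (\<lambda>x. False) (inf (nhds L) (filtermap avg F))"
      unfolding eventually_inf by (intro exI[of _ "\<lambda>x. x \<in> - S"] exI[of _ "\<lambda>x. x \<in> S"]) auto
    then show False using L by (simp add: eventually_False)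
  qed
  have [continuous_intros]: "continuous_on UNIV (\<lambda>L. L u)" for u :: "'a \<Rightarrow>\<^sub>C real"
    by (rule continuous_on_product_coordinates)
  have Ladd: "L (u + v) = L u + L v" for u v
  proof -
    have "L \<in> {L. L (u + v) = L u + L v}"
      by (rule lim) (auto intro!: closed_Collect_eq continuous_intros always_eventually
          simp: avg_def birkhoff_sum_def sum.distrib add_divide_distrib)
    then show ?thesis by simp
  qed
  have Lscale: "L (c *\<^sub>R u) = c * L u" for c u
  proof -
    have "L \<in> {L. L (c *\<^sub>R u) = c * L u}"
      by (rule lim) (auto intro!: closed_Collect_eq continuous_intros always_eventually
          simp: avg_def birkhoff_sum_def sum_distrib_left)
    then show ?thesis by simp
  qed
  have Lpos: "0 \<le> L u" if "\<And>x. 0 \<le> apply_bcontfun u x" for u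
  proof -
    have "L \<in> {L. 0 \<le> L u}"
      by (rule lim) (use that in \<open>auto intro!: closed_Collect_le continuous_intros always_eventually
          sum_nonneg divide_nonneg_nonneg simp: avg_def birkhoff_sum_def\<close>)
    then show ?thesis by simp
  qed
  note inv = Bcontfun_inverse[OF continuous_imp_bcontfun[OF compact]]
  define \<Lambda> where "\<Lambda> f = L (Bcontfun f)" for f
  interpret R: positive_functional \<Lambda>
  proof
    fix f g :: "'a \<Rightarrow> real" assume f: "continuous_on UNIV f" and g: "continuous_on UNIV g"
    have "Bcontfun (\<lambda>x. f x + g x) = Bcontfun f + Bcontfun g"
      using f g by (intro bcontfun_eqI) (simp add: inv continuous_on_add)
    then show "\<Lambda> (\<lambda>x. f x + g x) = \<Lambda> f + \<Lambda> g" by (simp add: \<Lambda>_def Ladd)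
  next
    fix f :: "'a \<Rightarrow> real" and c assume f: "continuous_on UNIV f"
    have "Bcontfun (\<lambda>x. c * f x) = c *\<^sub>R Bcontfun f"
      using f by (intro bcontfun_eqI) (simp add: inv continuous_on_mult)
    then show "\<Lambda> (\<lambda>x. c * f x) = c * \<Lambda> f" by (simp add: \<Lambda>_def Lscale)
  next
    fix f :: "'a \<Rightarrow> real" assume "continuous_on UNIV f" "\<And>x. 0 \<le> f x"
    then show "0 \<le> \<Lambda> f" unfolding \<Lambda>_def by (intro Lpos) (simp add: inv)
  qed (rule compact)
  let ?\<mu> = "R.riesz_measure"
  \<comment> \<open>This uses that \<open>0 < n\<close> holds along \<open>F\<close>: at
    \<open>n = 0\<close> the average is \<open>0 / 0 = 0\<close>.\<close>
  have "L \<in> {L. L (Bcontfun (\<lambda>x. 1)) = 1}"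
    by (rule lim) (auto intro!: closed_Collect_eq continuous_intros eventually_mono[OF FP]
        simp: avg_def birkhoff_sum_def inv)
  then have "measure ?\<mu> (space ?\<mu>) = 1" by (simp add: R.measure_riesz_UNIV \<Lambda>_def)
  then have prob: "prob_space ?\<mu>"
    by (intro prob_spaceI) (simp add: R.R.emeasure_eq_measure)
  have shift: "\<Lambda> (f \<circ> \<alpha>) = \<Lambda> f" if f: "continuous_on UNIV f" for f
  proof -
    obtain B where B: "\<And>x. \<bar>f x\<bar> \<le> B" using R.bounded_continuous[OF f] by auto
    have fa: "continuous_on UNIV (f \<circ> \<alpha>)"
      by (rule continuous_on_compose[OF \<alpha> continuous_on_subset[OF f]]) simp
    \<comment> \<open>Exact invariance fails for each finite \<open>n\<close>; a defect of at most
      \<open>e\<close> holds eventually and is a closed condition, so it passes to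
      \<open>L\<close>.\<close>
    have "\<bar>\<Lambda> (f \<circ> \<alpha>) - \<Lambda> f\<bar> \<le> e" if e: "0 < e" for e
    proof -
      have "\<forall>\<^sub>F n in sequentially. 2 * B / e < real n"
        by (rule filterlim_real_sequentially[unfolded filterlim_at_top_dense, rule_format])
      then have "\<forall>\<^sub>F n in F. 2 * B / e < real n \<and> 0 < n"
        using FP Fseq eventually_conj by force
      then have "\<forall>\<^sub>F n in F. avg n \<in> {L. \<bar>L (Bcontfun (f \<circ> \<alpha>)) - L (Bcontfun f)\<bar> \<le> e}"
      proof eventually_elim
        case (elim n)
        have "\<bar>f ((\<alpha> ^^ n) (X n)) - f (X n)\<bar> \<le> 2 * B"
          using B[of "(\<alpha> ^^ n) (X n)"] B[of "X n"] by linarith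
        also have "\<dots> \<le> e * n" using elim e by (simp add: field_simps)
        finally have "\<bar>f ((\<alpha> ^^ n) (X n)) - f (X n)\<bar> / n \<le> e" using elim by (simp add: field_simps)
        then show ?case
          by (simp add: avg_def inv[OF f] inv[OF fa] birkhoff_sum_comp flip: diff_divide_distrib)
      qed
      then have "L \<in> {L. \<bar>L (Bcontfun (f \<circ> \<alpha>)) - L (Bcontfun f)\<bar> \<le> e}"
        by (rule lim[rotated]) (intro closed_Collect_le continuous_intros)
      then show ?thesis by (simp add: \<Lambda>_def)
    qed
    then show ?thesis by (metis abs_le_zero_iff dense_le_bounded eq_iff_diff_eq_0 field_le_epsilon add_0)
  qed
  have ma: "\<alpha> \<in> measurable ?\<mu> borel"
    unfolding measurable_cong_sets[OF R.sets_riesz_measure refl] using \<alpha> by (rule borel_measurable_continuous_onI)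
  have "distr ?\<mu> borel \<alpha> = ?\<mu>"
  proof (rule finite_borel_measure_eqI)
    show "finite_measure (distr ?\<mu> borel \<alpha>)"
      using ma by (rule R.R.finite_measure_distr)
    show "integral\<^sup>L (distr ?\<mu> borel \<alpha>) f = integral\<^sup>L ?\<mu> f" if f: "continuous_on UNIV f" for f :: "'a \<Rightarrow> real"
    proof -
      have fa: "continuous_on UNIV (f \<circ> \<alpha>)"
        by (rule continuous_on_compose[OF \<alpha> continuous_on_subset[OF f]]) simp
      have "integral\<^sup>L (distr ?\<mu> borel \<alpha>) f = integral\<^sup>L ?\<mu> (f \<circ> \<alpha>)"
        using f by (subst integral_distr[OF ma]) (auto simp: comp_def intro: borel_measurable_continuous_onI)
      then show ?thesis using R.integral_riesz[OF f] R.integral_riesz[OF fa] shift[OF f] by simp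
    qed
  qed (auto intro: R.R.finite_measure_axioms)
  moreover have "\<delta> \<le> integral\<^sup>L ?\<mu> h"
  proof -
    have "L \<in> {L. \<delta> \<le> L (Bcontfun h)}"
      by (rule lim) (auto intro!: closed_Collect_le continuous_intros eventually_mono[OF FP]
        simp: avg_def inv[OF h] field_simps dest: X)
    then show ?thesis by (simp add: R.integral_riesz h \<Lambda>_def)
  qed
  ultimately show ?thesis using prob by (intro bexI[of _ ?\<mu>]) (simp_all add: invariant_measures_def)
qed

section \<open>Invariant measures live on the essential set\<close>

lemma closed_essential_set: "closed (essential_set \<alpha>)"
proof -
  have "\<exists>V. open V \<and> x \<in> V \<and> V \<subseteq> - essential_set \<alpha>" if x: "x \<in> - essential_set \<alpha>" for x
  proof -
    obtain V where V: "open V" "x \<in> V" "\<not> (\<exists>\<mu>\<in>invariant_measures \<alpha>. 0 < measure \<mu> V)"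
      using x unfolding essential_set_def by auto
    have "y \<notin> essential_set \<alpha>" if "y \<in> V" for y
      using V that unfolding essential_set_def by auto
    then show ?thesis using V by auto
  qed
  then show ?thesis unfolding closed_def by (subst open_subopen) simp
qed

lemma essential_set_invariant:
  assumes \<alpha>: "continuous_on UNIV \<alpha>" and x: "x \<in> essential_set \<alpha>"
  shows "\<alpha> x \<in> essential_set \<alpha>"
  unfolding essential_set_def
proof (intro CollectI allI impI)
  fix V assume V: "open V \<and> \<alpha> x \<in> V"
  then have "open (\<alpha> -` V)" "x \<in> \<alpha> -` V" using \<alpha> open_vimage by auto
  then obtain \<mu> where \<mu>: "\<mu> \<in> invariant_measures \<alpha>" "0 < measure \<mu> (\<alpha> -` V)"
    using x unfolding essential_set_def by blast
  have sets: "sets \<mu> = sets borel" and d: "distr \<mu> borel \<alpha> = \<mu>" using \<mu> by (auto simp: invariant_measures_def)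
  have "measure \<mu> V = measure (distr \<mu> borel \<alpha>) V" by (simp add: d)
  also have "\<dots> = measure \<mu> (\<alpha> -` V \<inter> space \<mu>)"
    using V \<alpha> by (intro measure_distr)
      (auto simp: measurable_cong_sets[OF sets refl] intro: borel_measurable_continuous_onI)
  also have "space \<mu> = UNIV" using sets_eq_imp_space_eq[OF sets] by simp
  finally show "\<exists>\<mu>\<in>invariant_measures \<alpha>. 0 < measure \<mu> V" using \<mu> by (intro bexI[of _ \<mu>]) simp_all
qed

lemma funpow_essential_set:
  assumes "continuous_on UNIV \<alpha>" and "x \<in> essential_set \<alpha>"
  shows "(\<alpha> ^^ n) x \<in> essential_set \<alpha>"
  using assms by (induction n) (auto intro: essential_set_invariant)

text \<open>Each point of \<open>K\<close> has a neighbourhood that is null for every invariant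
  measure, and finitely many of these cover \<open>K\<close>.\<close>

lemma invariant_measure_compact_null:
  fixes \<alpha> :: "'a::t2_space \<Rightarrow> 'a"
  assumes \<mu>: "\<mu> \<in> invariant_measures \<alpha>" and K: "compact K" "K \<inter> essential_set \<alpha> = {}"
  shows "K \<in> null_sets \<mu>"
proof -
  have sets: "sets \<mu> = sets borel" and prob: "prob_space \<mu>" using \<mu> by (auto simp: invariant_measures_def)
  interpret prob_space \<mu> by fact
  define \<V> where "\<V> = {V. open V \<and> measure \<mu> V = 0}"
  have "K \<subseteq> \<Union>\<V>"
  proof
    fix x assume "x \<in> K"
    then have "x \<notin> essential_set \<alpha>" using K by auto
    then obtain V where "open V" "x \<in> V" "\<not> measure \<mu> V > 0"
      using \<mu> unfolding essential_set_def by blast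
    then show "x \<in> \<Union>\<V>" unfolding \<V>_def using measure_nonneg[of \<mu> V] by force
  qed
  then obtain D where D: "D \<subseteq> \<V>" "finite D" "K \<subseteq> \<Union>D"
    by (rule compactE[OF K(1), of \<V>]) (auto simp: \<V>_def)
  have "V \<in> null_sets \<mu>" if "V \<in> D" for V
    using that D(1) by (auto simp: \<V>_def null_sets_def sets emeasure_eq_measure)
  then have "\<Union>D \<in> null_sets \<mu>"
    using null_sets_UN'[OF countable_finite[OF D(2)], of "\<lambda>V. V"] by simp
  then show ?thesis
    by (rule null_sets_subset) (use D(3) borel_compact[OF K(1)] in \<open>simp_all add: sets\<close>)
qed

text \<open>If the essential set were empty, the compact whole space would be null. The complement
  of the set is exhausted by the compact sets where the distance is at least
  \<open>1 / Suc k\<close>, all of them null, so the distance vanishes almost everywhere.\<close>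

lemma integral_infdist_essential_set:
  assumes c: "compact (UNIV :: 'a::metric_space set)" and \<mu>: "\<mu> \<in> invariant_measures (\<alpha> :: 'a \<Rightarrow> 'a)"
  shows "essential_set \<alpha> \<noteq> {}" and "(\<integral>x. infdist x (essential_set \<alpha>) \<partial>\<mu>) = 0"
proof -
  let ?Y = "essential_set \<alpha>"
  have sets: "sets \<mu> = sets borel" and prob: "prob_space \<mu>" using \<mu> by (auto simp: invariant_measures_def)
  interpret prob_space \<mu> by fact
  show "?Y \<noteq> {}"
    using invariant_measure_compact_null[OF \<mu> c] prob_space
      sets_eq_imp_space_eq[OF sets] by (auto simp: null_sets_def emeasure_eq_measure)
  let ?K = "\<lambda>k::nat. {x. 1 / real (Suc k) \<le> infdist x ?Y}"
  have "?K k \<in> null_sets \<mu>" for k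
  proof (rule invariant_measure_compact_null[OF \<mu>])
    have "closed (?K k)" by (intro closed_Collect_le continuous_intros)
    then show "compact (?K k)" using c by (metis compact_Int_closed inf_top_left)
  qed auto
  then have "(\<Union>k. ?K k) \<in> null_sets \<mu>" by (rule null_sets_UN)
  then have "AE x in \<mu>. x \<notin> (\<Union>k. ?K k)" by (rule AE_not_in)
  then have "AE x in \<mu>. infdist x ?Y = 0"
  proof (rule AE_mp, intro AE_I2 impI)
    fix x assume x: "x \<notin> (\<Union>k. ?K k)"
    show "infdist x ?Y = 0"
    proof (rule ccontr)
      assume "infdist x ?Y \<noteq> 0"
      then have "0 < infdist x ?Y" using infdist_nonneg[of x ?Y] by linarith
      then obtain k where "1 / real (Suc k) < infdist x ?Y" using nat_approx_posE by metis
      then show False using x by (auto intro: less_imp_le)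
    qed
  qed
  then show "(\<integral>x. infdist x ?Y \<partial>\<mu>) = 0" by (rule integral_eq_zero_AE)
qed

theorem essential_set_nonempty:
  fixes \<alpha> :: "'a::metric_space \<Rightarrow> 'a"
  assumes "compact (UNIV :: 'a set)" and "continuous_on UNIV \<alpha>"
  shows "essential_set \<alpha> \<noteq> {}"
proof -
  have "\<exists>\<^sub>F n in sequentially. \<exists>x. real n * 1 \<le> birkhoff_sum \<alpha> (\<lambda>x. 1) n x"
    by (intro eventually_frequently always_eventually) (auto simp: birkhoff_sum_def)
  from krylov_bogoliubov[OF assms continuous_on_const this] show ?thesis
    using integral_infdist_essential_set[OF assms(1)] by blast
qed

text \<open>Uniformity in \<open>x\<close> comes from the negation: starting points that fail for
  infinitely many \<open>n\<close> are exactly the input of \<open>krylov_bogoliubov\<close>,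
  whatever their dependence on \<open>n\<close>.\<close>

theorem orbits_near_essential_set:
  fixes \<alpha> :: "'a::metric_space \<Rightarrow> 'a"
  assumes "compact (UNIV :: 'a set)" and "continuous_on UNIV \<alpha>" and "\<delta> > 0"
  shows "\<forall>\<^sub>F n in sequentially. \<forall>x. birkhoff_sum \<alpha> (\<lambda>x. infdist x (essential_set \<alpha>)) n x \<le> real n * \<delta>"
proof (rule ccontr)
  assume "\<not> ?thesis"
  then have "\<exists>\<^sub>F n in sequentially. \<exists>x. real n * \<delta> \<le> birkhoff_sum \<alpha> (\<lambda>x. infdist x (essential_set \<alpha>)) n x"
    unfolding not_eventually by (rule frequently_elim1) (auto simp: not_le intro: less_imp_le)
  from krylov_bogoliubov[OF assms(1,2) _ this] show False
    using integral_infdist_essential_set(2)[OF assms(1)] assms(3)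
    by (fastforce intro: continuous_intros)
qed

section \<open>Fibre measures and weighted operators\<close>

definition lift_bcontfun :: "('a::topological_space \<Rightarrow> real) \<Rightarrow> ('a \<Rightarrow>\<^sub>C complex)" where
  "lift_bcontfun f = Bcontfun (\<lambda>y. complex_of_real (f y))"

locale transfer =
  fixes \<alpha> :: "'a::metric_space \<Rightarrow> 'a" and A :: "('a \<Rightarrow>\<^sub>C complex) \<Rightarrow> ('a \<Rightarrow>\<^sub>C complex)"
  assumes compact_space: "compact (UNIV :: 'a set)"
    and continuous_map: "continuous_on UNIV \<alpha>"
    and transfer: "transfer_operator \<alpha> A"
begin

lemma A_add: "A (f + g) = A f + A g"
  and A_scale: "A (bcontfun_mult (const_bcontfun c) f) = bcontfun_mult (const_bcontfun c) (A f)"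
  and A_nonneg: "(\<And>x. apply_bcontfun f x \<in> \<real>\<^sub>\<ge>\<^sub>0) \<Longrightarrow> apply_bcontfun (A f) x \<in> \<real>\<^sub>\<ge>\<^sub>0"
  and A_transfer: "A (bcontfun_mult (Bcontfun (apply_bcontfun f \<circ> \<alpha>)) g) = bcontfun_mult f (A g)"
  using transfer unfolding transfer_operator_def by auto

lemma apply_lift [simp]:
  fixes f :: "'a \<Rightarrow> real"
  shows "continuous_on UNIV f \<Longrightarrow> apply_bcontfun (lift_bcontfun f) = (\<lambda>y. complex_of_real (f y))"
proof -
  assume "continuous_on UNIV f"
  then have "(\<lambda>y. complex_of_real (f y)) \<in> bcontfun"
    by (intro continuous_imp_bcontfun compact_space continuous_intros)
  then show ?thesis by (simp add: lift_bcontfun_def Bcontfun_inverse)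
qed

text \<open>Positivity forces reality, because \<open>f\<close> is the difference of the nonnegative
  functions \<open>f + B\<close> and \<open>B\<close>.\<close>

lemma A_lift_real:
  assumes f: "continuous_on UNIV f"
  shows "A (lift_bcontfun f) x = complex_of_real (Re (A (lift_bcontfun f) x))"
proof -
  have "bounded (range f)" using compact_imp_bounded[OF compact_continuous_image[OF f compact_space]] .
  then obtain B where B: "\<And>x. \<bar>f x\<bar> \<le> B" by (auto simp: bounded_iff)
  have c: "continuous_on UNIV (\<lambda>y. f y + B)" "continuous_on UNIV (\<lambda>y::'a. B)"
    using f by (auto intro: continuous_intros)
  have "lift_bcontfun (\<lambda>y. f y + B) = lift_bcontfun f + lift_bcontfun (\<lambda>y. B)"
    using f c by (intro bcontfun_eqI) simp
  then have "A (lift_bcontfun f) x = A (lift_bcontfun (\<lambda>y. f y + B)) x - A (lift_bcontfun (\<lambda>y. B)) x"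
    by (simp add: A_add)
  moreover have "A (lift_bcontfun (\<lambda>y. f y + B)) x \<in> \<real>\<^sub>\<ge>\<^sub>0"
  proof (rule A_nonneg)
    show "lift_bcontfun (\<lambda>y. f y + B) y \<in> \<real>\<^sub>\<ge>\<^sub>0" for y
      using B[of y] c(1) by (simp add: abs_le_iff flip: of_real_add)
  qed
  moreover have "A (lift_bcontfun (\<lambda>y. B)) x \<in> \<real>\<^sub>\<ge>\<^sub>0"
    using B[of x] c(2) by (intro A_nonneg) simp
  ultimately have "A (lift_bcontfun f) x \<in> \<real>"
    by (simp add: nonneg_Reals_subset_Reals[THEN subsetD])
  then show ?thesis by (metis of_real_Re)
qed

lemma fibre_functional: "positive_functional (\<lambda>f. Re (A (lift_bcontfun f) x))"
proof
  fix f g :: "'a \<Rightarrow> real" assume "continuous_on UNIV f" "continuous_on UNIV g"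
  then have "lift_bcontfun (\<lambda>y. f y + g y) = lift_bcontfun f + lift_bcontfun g"
    by (intro bcontfun_eqI) (simp add: continuous_on_add)
  then show "Re (A (lift_bcontfun (\<lambda>y. f y + g y)) x) = Re (A (lift_bcontfun f) x) + Re (A (lift_bcontfun g) x)"
    by (simp add: A_add)
next
  fix f :: "'a \<Rightarrow> real" and c assume "continuous_on UNIV f"
  then have "lift_bcontfun (\<lambda>y. c * f y) = bcontfun_mult (const_bcontfun (complex_of_real c)) (lift_bcontfun f)"
    by (intro bcontfun_eqI) (simp add: continuous_on_mult apply_bcontfun_mult)
  then show "Re (A (lift_bcontfun (\<lambda>y. c * f y)) x) = c * Re (A (lift_bcontfun f) x)"
    by (simp add: A_scale apply_bcontfun_mult)
next
  fix f :: "'a \<Rightarrow> real" assume "continuous_on UNIV f" "\<And>y. 0 \<le> f y"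
  then have "A (lift_bcontfun f) x \<in> \<real>\<^sub>\<ge>\<^sub>0" by (intro A_nonneg) simp
  then show "0 \<le> Re (A (lift_bcontfun f) x)" by (simp add: complex_nonneg_Reals_iff)
qed (rule compact_space)

abbreviation "\<nu> x \<equiv> fibre_measure A x"

text \<open>This discharges the definite description. The Riesz measure of the real functional
  represents \<open>A\<close> on real and imaginary parts separately, hence on all complex functions
  by linearity; uniqueness needs real test functions only.\<close>

lemma fibre_measure:
  "sets (\<nu> x) = sets borel \<and> finite_measure (\<nu> x) \<and> (\<forall>f. (LINT y|\<nu> x. apply_bcontfun f y) = A f x)"
  unfolding fibre_measure_def
proof (rule theI')
  interpret R: positive_functional "\<lambda>f. Re (A (lift_bcontfun f) x)" by (rule fibre_functional)
  let ?P = "\<lambda>\<nu>. sets \<nu> = sets borel \<and> finite_measure \<nu> \<and> (\<forall>f. (LINT y|\<nu>. apply_bcontfun f y) = A f x)"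
  have "(LINT y|R.riesz_measure. apply_bcontfun f y) = A f x" for f
  proof -
    have c: "continuous_on UNIV (\<lambda>y. Re (f y))" "continuous_on UNIV (\<lambda>y. Im (f y))"
      by (auto intro: continuous_intros)
    have "f = lift_bcontfun (\<lambda>y. Re (f y)) + bcontfun_mult (const_bcontfun \<i>) (lift_bcontfun (\<lambda>y. Im (f y)))"
      using c by (intro bcontfun_eqI) (simp add: apply_bcontfun_mult complex_eq)
    then have "A f x = A (lift_bcontfun (\<lambda>y. Re (f y))) x + \<i> * A (lift_bcontfun (\<lambda>y. Im (f y))) x"
      by (metis A_add A_scale apply_bcontfun_mult const_bcontfun.rep_eq plus_bcontfun.rep_eq)
    also have "\<dots> = of_real (LINT y|R.riesz_measure. Re (f y)) + \<i> * of_real (LINT y|R.riesz_measure. Im (f y))"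
      using A_lift_real[OF c(1)] A_lift_real[OF c(2)] R.integral_riesz[OF c(1)] R.integral_riesz[OF c(2)]
      by simp
    also have "\<dots> = (LINT y|R.riesz_measure. f y)"
    proof -
      have "integrable R.riesz_measure (apply_bcontfun f)"
        by (rule integrable_continuous_compact[OF compact_space _ R.R.finite_measure_axioms]) auto
      then show ?thesis by (simp add: complex_eq_iff)
    qed
    finally show ?thesis by simp
  qed
  then have ex: "?P R.riesz_measure" using R.R.finite_measure_axioms by simp
  have uniq: "M = N" if M: "?P M" and N: "?P N" for M N
  proof (rule finite_borel_measure_eqI)
    fix f :: "'a \<Rightarrow> real" assume f: "continuous_on UNIV f"
    have "(LINT y|M. lift_bcontfun f y) = (LINT y|N. lift_bcontfun f y)" using M N by simp
    then have "(LINT y|M. complex_of_real (f y)) = (LINT y|N. complex_of_real (f y))" using f by simp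
    then show "integral\<^sup>L M f = integral\<^sup>L N f" by simp
  qed (use M N in auto)
  show "\<exists>!\<nu>. ?P \<nu>" using ex uniq by blast
qed

lemma sets_fibre [simp]: "sets (\<nu> x) = sets borel"
  and finite_fibre: "finite_measure (\<nu> x)"
  and integral_fibre: "(LINT y|\<nu> x. apply_bcontfun f y) = A f x"
  using fibre_measure[of x] by auto

lemma space_fibre [simp]: "space (\<nu> x) = UNIV"
  using sets_eq_imp_space_eq[OF sets_fibre] by simp

lemma integrable_fibre:
  fixes f :: "'a \<Rightarrow> 'b::{banach, second_countable_topology}"
  shows "continuous_on UNIV f \<Longrightarrow> integrable (\<nu> x) f"
  by (rule integrable_continuous_compact[OF compact_space sets_fibre finite_fibre])

lemma fibre_lift:
  assumes "continuous_on UNIV f"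
  shows "complex_of_real (LINT y|\<nu> x. f y) = A (lift_bcontfun f) x"
  unfolding integral_fibre[symmetric] using assms by simp

text \<open>The transfer identity for the test function \<open>\<lambda>z. dist z x\<close> shows
  that the integral of \<open>dist (\<alpha> y) x\<close> equals
  \<open>dist x x * A 1 x = 0\<close>.\<close>

lemma fibre_support: "AE y in \<nu> x. \<alpha> y = x"
proof -
  let ?d = "\<lambda>z. dist z x"
  have dc: "continuous_on UNIV ?d" by (intro continuous_intros)
  have dac: "continuous_on UNIV (\<lambda>y. dist (\<alpha> y) x)" using continuous_map by (intro continuous_intros)
  have "lift_bcontfun (\<lambda>y. dist (\<alpha> y) x) = bcontfun_mult (Bcontfun (apply_bcontfun (lift_bcontfun ?d) \<circ> \<alpha>)) (const_bcontfun 1)"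
  proof (rule bcontfun_eqI)
    fix y
    have "Bcontfun (apply_bcontfun (lift_bcontfun ?d) \<circ> \<alpha>) y = complex_of_real (dist (\<alpha> y) x)"
      unfolding apply_bcontfun_comp[OF continuous_map] using dc by simp
    then show "lift_bcontfun (\<lambda>y. dist (\<alpha> y) x) y =
        bcontfun_mult (Bcontfun (apply_bcontfun (lift_bcontfun ?d) \<circ> \<alpha>)) (const_bcontfun 1) y"
      using dac by (simp only: apply_bcontfun_mult apply_lift const_bcontfun.rep_eq mult_1_right)
  qed
  then have "A (lift_bcontfun (\<lambda>y. dist (\<alpha> y) x)) = bcontfun_mult (lift_bcontfun ?d) (A (const_bcontfun 1))"
    by (simp only: A_transfer)
  then have "A (lift_bcontfun (\<lambda>y. dist (\<alpha> y) x)) x = 0"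
    using dc by (simp add: apply_bcontfun_mult)
  then have "(LINT y|\<nu> x. dist (\<alpha> y) x) = 0"
    using fibre_lift[OF dac, of x] by (metis of_real_eq_0_iff)
  then have "AE y in \<nu> x. dist (\<alpha> y) x = 0"
    using integral_nonneg_eq_0_iff_AE[OF integrable_fibre[OF dac]] by simp
  then show ?thesis by simp
qed

text \<open>The weighted operator on real functions. As an integral against a measure it is visibly
  monotone in both the weight and the argument, and the weight can be an arbitrary function rather
  than an element of a function space.\<close>

definition fibre_op :: "('a \<Rightarrow> real) \<Rightarrow> ('a \<Rightarrow> real) \<Rightarrow> 'a \<Rightarrow> real" where
  "fibre_op w u x = (LINT y|\<nu> x. exp (w y) * u y)"

text \<open>Continuity in \<open>x\<close> cannot be read off the family of measures; it comes from
  identifying the integral with a value of \<open>A\<close>.\<close>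

lemma continuous_fibre_op:
  assumes "continuous_on UNIV w" "continuous_on UNIV u"
  shows "continuous_on UNIV (fibre_op w u)"
proof -
  have c: "continuous_on UNIV (\<lambda>y. exp (w y) * u y)" using assms by (intro continuous_intros)
  have "fibre_op w u x = Re (A (lift_bcontfun (\<lambda>y. exp (w y) * u y)) x)" for x
    using fibre_lift[OF c, of x] unfolding fibre_op_def by (metis Re_complex_of_real)
  then show ?thesis by (auto intro!: continuous_intros)
qed

lemma fibre_op_mono:
  assumes "continuous_on UNIV w" "continuous_on UNIV u" "continuous_on UNIV w'" "continuous_on UNIV u'"
    and "\<And>y. exp (w y) * u y \<le> exp (w' y) * u' y"
  shows "fibre_op w u x \<le> fibre_op w' u' x"
  unfolding fibre_op_def
  using assms by (intro integral_mono integrable_fibre continuous_intros) auto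

lemma fibre_op_scale: "fibre_op w (\<lambda>y. c * u y) x = c * fibre_op w u x"
  unfolding fibre_op_def by (simp add: mult.left_commute)

lemma fibre_op_nonneg: "(\<And>y. 0 \<le> u y) \<Longrightarrow> 0 \<le> fibre_op w u x"
  unfolding fibre_op_def by (intro integral_nonneg_AE) auto

lemma continuous_fibre_op_pow:
  "continuous_on UNIV w \<Longrightarrow> continuous_on UNIV u \<Longrightarrow> continuous_on UNIV ((fibre_op w ^^ n) u)"
  by (induction n) (auto intro: continuous_fibre_op)

lemma fibre_op_pow_nonneg: "(\<And>y. 0 \<le> u y) \<Longrightarrow> 0 \<le> (fibre_op w ^^ n) u x"
  by (induction n arbitrary: x) (auto intro: fibre_op_nonneg)

lemma fibre_op_pow_scale: "(fibre_op w ^^ n) (\<lambda>y. c * u y) = (\<lambda>x. c * (fibre_op w ^^ n) u x)"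
proof (induction n)
  case (Suc n)
  show ?case unfolding funpow.simps comp_def Suc by (rule ext) (rule fibre_op_scale)
qed simp

lemma fibre_op_pow_mono:
  assumes "continuous_on UNIV w" "continuous_on UNIV u" "continuous_on UNIV u'" and "\<And>y. u y \<le> u' y"
  shows "(fibre_op w ^^ n) u x \<le> (fibre_op w ^^ n) u' x"
  using assms
  by (induction n arbitrary: x) (auto intro!: fibre_op_mono continuous_fibre_op_pow mult_left_mono)

lemma fibre_op_pow_antimono_weight:
  assumes "continuous_on UNIV w" "continuous_on UNIV w'" "continuous_on UNIV u"
    and "\<And>y. w y \<le> w' y" "\<And>y. 0 \<le> u y"
  shows "(fibre_op w ^^ n) u x \<le> (fibre_op w' ^^ n) u x"
  using assms
  by (induction n arbitrary: x)
    (auto intro!: fibre_op_mono continuous_fibre_op_pow mult_mono fibre_op_pow_nonneg)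

lemma fibre_op_cong_fibre:
  assumes "continuous_on UNIV w" "continuous_on UNIV u" "continuous_on UNIV w'" "continuous_on UNIV u'"
    and "\<And>y. \<alpha> y = x \<Longrightarrow> exp (w y) * u y = exp (w' y) * u' y"
  shows "fibre_op w u x = fibre_op w' u' x"
  unfolding fibre_op_def
proof (rule integral_cong_AE)
  show "AE y in \<nu> x. exp (w y) * u y = exp (w' y) * u' y"
    using fibre_support by (rule AE_mp) (auto intro: assms(5))
qed (use assms in \<open>auto intro!: borel_measurable_integrable integrable_fibre continuous_intros\<close>)

text \<open>Changing the weight by \<open>g\<close> amounts to a Birkhoff factor on the argument.
  With \<open>g = k * h\<close> this is how the penalty is removed.\<close>

lemma fibre_op_pow_weight:
  assumes w: "continuous_on UNIV w" and g: "continuous_on UNIV g" and u: "continuous_on UNIV u"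
  shows "(fibre_op (\<lambda>y. w y + g y) ^^ n) u = (fibre_op w ^^ n) (\<lambda>y. exp (birkhoff_sum \<alpha> g n y) * u y)"
  using u
proof (induction n arbitrary: u)
  case (Suc n)
  let ?W = "fibre_op (\<lambda>y. w y + g y)"
  have wg: "continuous_on UNIV (\<lambda>y. w y + g y)" using w g by (intro continuous_intros)
  have bc: "continuous_on UNIV (birkhoff_sum \<alpha> g n)" for n
    by (rule continuous_on_birkhoff_sum[OF continuous_map g])
  have bac: "continuous_on UNIV (\<lambda>y. birkhoff_sum \<alpha> g n (\<alpha> y))"
    by (rule continuous_on_compose2[OF bc continuous_map]) auto
  \<comment> \<open>Over \<open>x\<close> one has \<open>\<alpha> y = x\<close>, so the factor at
    \<open>x\<close> goes under the operator as a factor at \<open>\<alpha> y\<close>, where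
    \<open>birkhoff_sum_Suc\<close> merges it with the new term \<open>g y\<close>.\<close>
  have "exp (birkhoff_sum \<alpha> g n x) * ?W u x = fibre_op w (\<lambda>y. exp (birkhoff_sum \<alpha> g (Suc n) y) * u y) x" for x
  proof -
    have "exp (birkhoff_sum \<alpha> g n x) * ?W u x = ?W (\<lambda>y. exp (birkhoff_sum \<alpha> g n x) * u y) x"
      by (simp add: fibre_op_scale)
    also have "\<dots> = fibre_op w (\<lambda>y. exp (birkhoff_sum \<alpha> g (Suc n) y) * u y) x"
      using w wg g bac Suc.prems
      by (intro fibre_op_cong_fibre continuous_intros) (auto simp: birkhoff_sum_Suc exp_add intro!: continuous_intros)
    finally show ?thesis .
  qed
  then show ?case
    using Suc.IH[OF continuous_fibre_op[OF wg Suc.prems]] by (simp add: funpow_Suc_right del: funpow.simps)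
qed (simp add: birkhoff_sum_def)

lemma fibre_op_pow_bound:
  assumes w: "continuous_on UNIV w"
  shows "\<exists>K\<ge>1. \<forall>n x. (fibre_op w ^^ n) (\<lambda>_. 1) x \<le> K ^ n"
proof -
  have "bounded (range (fibre_op w (\<lambda>_. 1)))"
    using w by (intro compact_imp_bounded compact_continuous_image continuous_fibre_op compact_space) auto
  then obtain K0 where K0: "\<And>x. \<bar>fibre_op w (\<lambda>_. 1) x\<bar> \<le> K0" by (auto simp: bounded_iff)
  define K where "K = max 1 K0"
  have K: "1 \<le> K" "\<And>x. fibre_op w (\<lambda>_. 1) x \<le> K" using K0 by (auto simp: K_def abs_le_iff intro: max.coboundedI2)
  have "(fibre_op w ^^ n) (\<lambda>_. 1) x \<le> K ^ n" for n x
  proof (induction n arbitrary: x)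
    case (Suc n)
    have "(fibre_op w ^^ Suc n) (\<lambda>_. 1) x \<le> fibre_op w (\<lambda>y. K ^ n * 1) x"
      unfolding funpow.simps comp_def
      using Suc w by (intro fibre_op_mono continuous_fibre_op_pow) auto
    also have "\<dots> \<le> K ^ n * K"
      unfolding fibre_op_scale using K by (intro mult_left_mono) auto
    finally show ?case by (simp add: mult.commute)
  qed simp
  then show ?thesis using K(1) by auto
qed

lemma fibre_op_pow_block:
  assumes w: "continuous_on UNIV w" and c: "\<And>x. (fibre_op w ^^ m) (\<lambda>_. 1) x \<le> c"
  shows "(fibre_op w ^^ (q * m)) (\<lambda>_. 1) x \<le> c ^ q"
proof (induction q arbitrary: x)
  case (Suc q)
  have c0: "0 \<le> c" using c[of x] fibre_op_pow_nonneg[of "\<lambda>_. 1" m w x] by simp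
  have "(fibre_op w ^^ (Suc q * m)) (\<lambda>_. 1) x = (fibre_op w ^^ m) ((fibre_op w ^^ (q * m)) (\<lambda>_. 1)) x"
    by (simp add: funpow_add)
  also have "\<dots> \<le> (fibre_op w ^^ m) (\<lambda>y. c ^ q * 1) x"
    using Suc w by (intro fibre_op_pow_mono continuous_fibre_op_pow) auto
  also have "\<dots> \<le> c ^ q * c"
    unfolding fibre_op_pow_scale using c c0 by (intro mult_left_mono) auto
  finally show ?case by (simp add: mult.commute)
qed simp

section \<open>Operator norms through iterates of the constant 1\<close>

context
  fixes \<psi> :: "'a \<Rightarrow>\<^sub>C real"
begin

abbreviation "W \<equiv> weighted_operator A \<psi>"

lemma weighted_operator_apply: "W f x = (LINT y|\<nu> x. complex_of_real (exp (\<psi> y)) * f y)"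
proof -
  have "apply_bcontfun (bcontfun_mult (bcontfun_exp \<psi>) f) = (\<lambda>y. complex_of_real (exp (\<psi> y)) * f y)"
    by (simp add: fun_eq_iff apply_bcontfun_mult apply_bcontfun_exp)
  then show ?thesis
    using integral_fibre[of x "bcontfun_mult (bcontfun_exp \<psi>) f"] by (simp add: weighted_operator_def)
qed

lemma norm_weighted_operator: "norm (W f x) \<le> fibre_op \<psi> (\<lambda>y. norm (f y)) x"
  unfolding weighted_operator_apply fibre_op_def
  using integral_norm_bound[of "\<nu> x" "\<lambda>y. complex_of_real (exp (\<psi> y)) * f y"]
  by (simp add: norm_mult)

lemma norm_weighted_operator_pow: "norm ((W ^^ n) f x) \<le> (fibre_op \<psi> ^^ n) (\<lambda>y. norm (f y)) x"
proof (induction n arbitrary: x)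
  case (Suc n)
  have "norm ((W ^^ Suc n) f x) \<le> fibre_op \<psi> (\<lambda>y. norm ((W ^^ n) f y)) x"
    by (simp add: norm_weighted_operator)
  also have "\<dots> \<le> fibre_op \<psi> ((fibre_op \<psi> ^^ n) (\<lambda>y. norm (f y))) x"
    using Suc by (intro fibre_op_mono continuous_fibre_op_pow mult_left_mono continuous_intros) auto
  finally show ?case by simp
qed simp

lemma weighted_operator_pow_one: "(W ^^ n) (const_bcontfun 1) x = complex_of_real ((fibre_op \<psi> ^^ n) (\<lambda>_. 1) x)"
proof (induction n arbitrary: x)
  case (Suc n)
  then show ?case
    by (simp add: weighted_operator_apply fibre_op_def flip: of_real_mult)
qed simp

lemma norm_weighted_operator_pow_le:
  assumes "\<And>x. (fibre_op \<psi> ^^ n) (\<lambda>_. 1) x \<le> C"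
  shows "norm ((W ^^ n) f) \<le> C * norm f"
proof (rule norm_bound)
  fix x
  have "norm ((W ^^ n) f x) \<le> (fibre_op \<psi> ^^ n) (\<lambda>y. norm (f y)) x"
    by (rule norm_weighted_operator_pow)
  also have "\<dots> \<le> (fibre_op \<psi> ^^ n) (\<lambda>y. norm f * 1) x"
    using norm_bounded by (intro fibre_op_pow_mono continuous_intros) auto
  also have "\<dots> \<le> norm f * C"
    unfolding fibre_op_pow_scale using assms by (intro mult_left_mono) auto
  finally show "norm ((W ^^ n) f x) \<le> C * norm f" by (simp add: mult.commute)
qed

text \<open>Needed because \<open>onorm\<close> is a supremum of quotients and dominates them only
  when they are bounded.\<close>

lemma bounded_linear_weighted_operator_pow: "bounded_linear (W ^^ n)"
proof -
  have Wadd: "W (f + g) = W f + W g" for f g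
  proof -
    have "bcontfun_mult (bcontfun_exp \<psi>) (f + g) = bcontfun_mult (bcontfun_exp \<psi>) f + bcontfun_mult (bcontfun_exp \<psi>) g"
      by (intro bcontfun_eqI) (simp add: apply_bcontfun_mult algebra_simps)
    then show ?thesis by (simp add: weighted_operator_def A_add)
  qed
  have Wsc: "W (c *\<^sub>R f) = c *\<^sub>R W f" for c f
  proof -
    have "bcontfun_mult (bcontfun_exp \<psi>) (c *\<^sub>R f)
        = bcontfun_mult (const_bcontfun (complex_of_real c)) (bcontfun_mult (bcontfun_exp \<psi>) f)"
      by (intro bcontfun_eqI) (simp add: apply_bcontfun_mult scaleR_conv_of_real)
    then show ?thesis
      by (intro bcontfun_eqI) (simp add: weighted_operator_def A_scale apply_bcontfun_mult scaleR_conv_of_real)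
  qed
  have "(W ^^ n) (f + g) = (W ^^ n) f + (W ^^ n) g" "(W ^^ n) (c *\<^sub>R f) = c *\<^sub>R (W ^^ n) f" for f g c
    by (induction n) (simp_all add: Wadd Wsc)
  moreover obtain K where "\<And>x. (fibre_op \<psi> ^^ n) (\<lambda>_. 1) x \<le> K ^ n"
    using fibre_op_pow_bound[of \<psi>] by auto
  then have "norm ((W ^^ n) f) \<le> norm f * K ^ n" for f
    using norm_weighted_operator_pow_le[of n "K ^ n" f] by (simp add: mult.commute)
  ultimately show ?thesis by (intro bounded_linear_intro)
qed

lemma onorm_weighted_operator_le:
  assumes "\<And>x. (fibre_op \<psi> ^^ n) (\<lambda>_. 1) x \<le> C"
  shows "onorm (W ^^ n) \<le> C"
proof (rule onorm_bound)
  show "0 \<le> C" using order_trans[OF fibre_op_pow_nonneg assms] by simp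
qed (rule norm_weighted_operator_pow_le[OF assms])

text \<open>The constant \<open>1\<close> is the extremal test function of a positive operator;
  together with the upper bound this identifies the norm.\<close>

lemma onorm_weighted_operator_ge: "(fibre_op \<psi> ^^ n) (\<lambda>_. 1) x \<le> onorm (W ^^ n)"
proof -
  have "(fibre_op \<psi> ^^ n) (\<lambda>_. 1) x = norm ((W ^^ n) (const_bcontfun 1) x)"
    using fibre_op_pow_nonneg[of "\<lambda>_. 1" n \<psi> x] by (simp add: weighted_operator_pow_one)
  also have "\<dots> \<le> norm ((W ^^ n) (const_bcontfun 1))" by (rule norm_bounded)
  also have "\<dots> \<le> onorm (W ^^ n) * norm (const_bcontfun 1 :: 'a \<Rightarrow>\<^sub>C complex)"
    by (rule onorm[OF bounded_linear_weighted_operator_pow])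
  also have "\<dots> \<le> onorm (W ^^ n) * 1"
    by (intro mult_left_mono norm_bound onorm_pos_le bounded_linear_weighted_operator_pow) auto
  finally show ?thesis by simp
qed

end

end

section \<open>Fibre sums over the essential set\<close>

text \<open>The ball of \<open>dist_orbit\<close>, written without \<open>MAX\<close> so that
  \<open>n = 0\<close> gives the whole space instead of an unspecified set.\<close>

definition bowen_ball :: "('a::metric_space \<Rightarrow> 'a) \<Rightarrow> nat \<Rightarrow> real \<Rightarrow> 'a \<Rightarrow> 'a set" where
  "bowen_ball \<alpha> n \<epsilon> y = {z. \<forall>i<n. dist ((\<alpha> ^^ i) z) ((\<alpha> ^^ i) y) < \<epsilon>}"

lemma open_bowen_ball:
  assumes "continuous_on UNIV \<alpha>"
  shows "open (bowen_ball \<alpha> n \<epsilon> y)"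
proof -
  have "bowen_ball \<alpha> n \<epsilon> y = (\<Inter>i\<in>{..<n}. {z. dist ((\<alpha> ^^ i) z) ((\<alpha> ^^ i) y) < \<epsilon>})"
    unfolding bowen_ball_def by auto
  moreover have "open {z. dist ((\<alpha> ^^ i) z) ((\<alpha> ^^ i) y) < \<epsilon>}" for i
    by (intro open_Collect_less continuous_intros continuous_on_funpow assms)
  ultimately show ?thesis by (simp add: open_INT)
qed

lemma finite_bowen_net:
  fixes \<alpha> :: "'a::metric_space \<Rightarrow> 'a"
  assumes "compact (UNIV :: 'a set)" "continuous_on UNIV \<alpha>" "0 < \<epsilon>"
  obtains G where "finite G" "UNIV = (\<Union>y\<in>G. bowen_ball \<alpha> n \<epsilon> y)"
proof -
  have "y \<in> bowen_ball \<alpha> n \<epsilon> y" for y using assms(3) by (simp add: bowen_ball_def)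
  then obtain G where "finite G" "UNIV \<subseteq> (\<Union>y\<in>G. bowen_ball \<alpha> n \<epsilon> y)"
    using compactE_image[OF assms(1), of UNIV "bowen_ball \<alpha> n \<epsilon>"] open_bowen_ball[OF assms(2)]
    by (metis UNIV_I UN_I subsetI)
  then show thesis using that by blast
qed

text \<open>A one-sided Dini theorem: the open sets \<open>{x. p k x < c}\<close> increase with
  \<open>k\<close> and cover the compact space. The limit \<open>f\<close> may be discontinuous, as
  fibre sums in general are.\<close>

lemma dini_upper:
  fixes p :: "nat \<Rightarrow> 'a::topological_space \<Rightarrow> real"
  assumes compact: "compact (UNIV :: 'a set)" and cont: "\<And>k. continuous_on UNIV (p k)"
    and anti: "\<And>k l x. k \<le> l \<Longrightarrow> p l x \<le> p k x"
    and lim: "\<And>x. (\<lambda>k. p k x) \<longlonglongrightarrow> f x" and f: "\<And>x. f x < c"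
  shows "\<exists>k. \<forall>x. p k x < c"
proof -
  have "open {x. p k x < c}" for k by (intro open_Collect_less cont continuous_on_const)
  moreover have "UNIV \<subseteq> (\<Union>k. {x. p k x < c})"
  proof
    fix x
    have "\<forall>\<^sub>F k in sequentially. p k x < c" by (rule order_tendstoD(2)[OF lim f])
    then show "x \<in> (\<Union>k. {x. p k x < c})" by (auto simp: eventually_sequentially)
  qed
  ultimately obtain D where D: "finite D" "UNIV \<subseteq> (\<Union>k\<in>D. {x. p k x < c})"
    using compactE_image[OF compact, of UNIV "\<lambda>k. {x. p k x < c}"] by auto
  have "p (Max (insert 0 D)) x < c" for x
  proof -
    obtain k where "k \<in> D" "p k x < c" using D(2) by auto
    then show ?thesis using D(1) anti[of k "Max (insert 0 D)" x] by (simp add: le_less_trans)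
  qed
  then show ?thesis by blast
qed

locale cocycle_system = transfer +
  fixes \<rho> \<psi> :: "'a \<Rightarrow> real"
  assumes non_contracting: "non_contracting_on (essential_set \<alpha>) \<alpha>"
    and continuous_\<rho>: "continuous_on UNIV \<rho>"
    and \<rho>_pos: "\<And>x. 0 < \<rho> x"
    and \<rho>_cocycle: "\<And>y. y \<in> essential_set \<alpha> \<Longrightarrow> \<rho> y = cocycle \<alpha> A y"
    and continuous_\<psi>: "continuous_on UNIV \<psi>"
begin

abbreviation "Y \<equiv> essential_set \<alpha>"
abbreviation "h x \<equiv> infdist x Y"
abbreviation "\<phi> x \<equiv> \<psi> x + ln (\<rho> x)"
abbreviation "S n \<equiv> birkhoff_sum \<alpha> \<phi> n"

definition fibre :: "nat \<Rightarrow> 'a \<Rightarrow> 'a set" where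
  "fibre n x = {y \<in> Y. (\<alpha> ^^ n) y = x}"

text \<open>On \<open>Y\<close> this is the \<open>n\<close>-th iterate, applied to
  \<open>1\<close>, of the transfer operator restricted to \<open>Y\<close> with total weight
  \<open>exp \<psi> * \<rho> = exp \<phi>\<close>.\<close>

definition fibre_sum :: "nat \<Rightarrow> 'a \<Rightarrow> real" where
  "fibre_sum n x = (\<Sum>y\<in>fibre n x. exp (S n y))"

lemma continuous_\<phi>: "continuous_on UNIV \<phi>"
  using \<rho>_pos by (intro continuous_intros continuous_\<psi> continuous_\<rho>) (auto simp: less_imp_neq[symmetric])

lemma Y_nonempty: "Y \<noteq> {}"
  by (rule essential_set_nonempty[OF compact_space continuous_map])

lemma funpow_Y: "y \<in> Y \<Longrightarrow> (\<alpha> ^^ n) y \<in> Y"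
  by (rule funpow_essential_set[OF continuous_map])

lemma h_zero_iff: "h x = 0 \<longleftrightarrow> x \<in> Y"
  using in_closed_iff_infdist_zero[OF closed_essential_set Y_nonempty] by auto

lemma continuous_h: "continuous_on UNIV h"
  by (intro continuous_intros)

lemma bounded_fun:
  fixes f :: "'a \<Rightarrow> real"
  assumes "continuous_on UNIV f"
  obtains B where "0 \<le> B" "\<And>x. \<bar>f x\<bar> \<le> B"
  using compact_imp_bounded[OF compact_continuous_image[OF assms compact_space]]
  by (metis bounded_pos less_imp_le rangeI real_norm_def)

text \<open>The one-step inequality is chained along the orbits, which stay in \<open>Y\<close>. In
  particular two orbits that are \<open>r\<close>-close before time \<open>n\<close> and meet at
  time \<open>n\<close> start at the same point.\<close>

lemma expanding_radius:
  obtains r where "0 < r" "\<And>n y z. y \<in> Y \<Longrightarrow> z \<in> Y \<Longrightarrow>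
    (\<And>i. i < n \<Longrightarrow> dist ((\<alpha> ^^ i) y) ((\<alpha> ^^ i) z) \<le> r) \<Longrightarrow> dist y z \<le> dist ((\<alpha> ^^ n) y) ((\<alpha> ^^ n) z)"
proof -
  obtain r where r: "0 < r" "\<And>y z. y \<in> Y \<Longrightarrow> z \<in> Y \<Longrightarrow> dist y z \<le> r \<Longrightarrow> dist y z \<le> dist (\<alpha> y) (\<alpha> z)"
    using non_contracting unfolding non_contracting_on_def by blast
  have "dist y z \<le> dist ((\<alpha> ^^ n) y) ((\<alpha> ^^ n) z)"
    if "y \<in> Y" "z \<in> Y" "\<And>i. i < n \<Longrightarrow> dist ((\<alpha> ^^ i) y) ((\<alpha> ^^ i) z) \<le> r" for n y z
    using that(3)
  proof (induction n)
    case (Suc n)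
    then have "dist y z \<le> dist ((\<alpha> ^^ n) y) ((\<alpha> ^^ n) z)" by simp
    also have "\<dots> \<le> dist ((\<alpha> ^^ Suc n) y) ((\<alpha> ^^ Suc n) z)"
      using r(2)[OF funpow_Y[OF that(1), of n] funpow_Y[OF that(2), of n]] Suc.prems[of n] by simp
    finally show ?case .
  qed simp
  with r(1) show thesis by (rule that)
qed

text \<open>Two points of the fibre with a common centre stay within
  \<open>2 * \<epsilon> \<le> r\<close> before time \<open>n\<close> and both arrive at
  \<open>x\<close>, so they coincide. The injection gives finiteness of fibres and the lower bound
  for the pressure.\<close>

lemma fibre_separated:
  obtains r where "0 < r" "\<And>n x \<epsilon> E. 2 * \<epsilon> \<le> r \<Longrightarrow> UNIV = (\<Union>y\<in>E. bowen_ball \<alpha> n \<epsilon> y) \<Longrightarrow>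
    \<exists>e. inj_on e (fibre n x) \<and> (\<forall>y\<in>fibre n x. e y \<in> E \<and> y \<in> bowen_ball \<alpha> n \<epsilon> (e y))"
proof -
  obtain r where r: "0 < r" "\<And>n y z. y \<in> Y \<Longrightarrow> z \<in> Y \<Longrightarrow>
    (\<And>i. i < n \<Longrightarrow> dist ((\<alpha> ^^ i) y) ((\<alpha> ^^ i) z) \<le> r) \<Longrightarrow> dist y z \<le> dist ((\<alpha> ^^ n) y) ((\<alpha> ^^ n) z)"
    using expanding_radius by blast
  have "\<exists>e. inj_on e (fibre n x) \<and> (\<forall>y\<in>fibre n x. e y \<in> E \<and> y \<in> bowen_ball \<alpha> n \<epsilon> (e y))"
    if \<epsilon>: "2 * \<epsilon> \<le> r" and E: "UNIV = (\<Union>y\<in>E. bowen_ball \<alpha> n \<epsilon> y)" for n x \<epsilon> E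
  proof -
    have "\<forall>y. \<exists>z. z \<in> E \<and> y \<in> bowen_ball \<alpha> n \<epsilon> z" using E by blast
    then obtain e where e: "\<And>y. e y \<in> E" "\<And>y. y \<in> bowen_ball \<alpha> n \<epsilon> (e y)" by metis
    have "inj_on e (fibre n x)"
    proof (rule inj_onI)
      fix y z assume y: "y \<in> fibre n x" and z: "z \<in> fibre n x" and eq: "e y = e z"
      have "dist ((\<alpha> ^^ i) y) ((\<alpha> ^^ i) z) \<le> r" if "i < n" for i
      proof -
        have "dist ((\<alpha> ^^ i) y) ((\<alpha> ^^ i) (e y)) < \<epsilon>" "dist ((\<alpha> ^^ i) z) ((\<alpha> ^^ i) (e y)) < \<epsilon>"
          using e(2)[of y] e(2)[of z] that unfolding eq by (auto simp: bowen_ball_def)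
        then show ?thesis
          using \<epsilon> dist_triangle2[of "(\<alpha> ^^ i) y" "(\<alpha> ^^ i) z" "(\<alpha> ^^ i) (e y)"] by linarith
      qed
      then have "dist y z \<le> dist ((\<alpha> ^^ n) y) ((\<alpha> ^^ n) z)"
        using y z by (intro r(2)) (auto simp: fibre_def)
      then show "y = z" using y z by (simp add: fibre_def)
    qed
    then show ?thesis using e by blast
  qed
  with r(1) show thesis by (rule that)
qed

lemma finite_fibre_set [simp]: "finite (fibre n x)"
proof -
  obtain r where r: "0 < r" "\<And>n x \<epsilon> E. 2 * \<epsilon> \<le> r \<Longrightarrow> UNIV = (\<Union>y\<in>E. bowen_ball \<alpha> n \<epsilon> y) \<Longrightarrow>
    \<exists>e. inj_on e (fibre n x) \<and> (\<forall>y\<in>fibre n x. e y \<in> E \<and> y \<in> bowen_ball \<alpha> n \<epsilon> (e y))"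
    using fibre_separated by blast
  obtain G where G: "finite G" "UNIV = (\<Union>y\<in>G. bowen_ball \<alpha> n (r / 2) y)"
    using finite_bowen_net[OF compact_space continuous_map, of "r / 2" n] r(1) by auto
  then show ?thesis using r(2)[where \<epsilon>="r / 2" and E=G and n=n and x=x] inj_on_finite[of _ "fibre n x" G] by auto
qed

lemma fibre_sum_Suc: "fibre_sum (Suc n) x = (\<Sum>z\<in>fibre 1 x. exp (\<phi> z) * fibre_sum n z)"
proof -
  have S: "S (Suc n) y = S n y + \<phi> ((\<alpha> ^^ n) y)" for y by (simp add: birkhoff_sum_def)
  have "fibre_sum (Suc n) x = (\<Sum>z\<in>fibre 1 x. \<Sum>y | y \<in> fibre (Suc n) x \<and> (\<alpha> ^^ n) y = z. exp (S (Suc n) y))"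
    unfolding fibre_sum_def
    by (rule sum.group[OF finite_fibre_set finite_fibre_set, symmetric]) (auto simp: fibre_def funpow_Y)
  also have "\<dots> = (\<Sum>z\<in>fibre 1 x. \<Sum>y\<in>fibre n z. exp (\<phi> z) * exp (S n y))"
  proof (intro sum.cong refl)
    fix z assume z: "z \<in> fibre 1 x"
    show "{y \<in> fibre (Suc n) x. (\<alpha> ^^ n) y = z} = fibre n z" using z by (auto simp: fibre_def)
    show "exp (S (Suc n) y) = exp (\<phi> z) * exp (S n y)" if "y \<in> fibre n z" for y
      using that by (simp add: S exp_add fibre_def mult_ac)
  qed
  finally show ?thesis by (simp add: fibre_sum_def sum_distrib_left)
qed

text \<open>The penalty \<open>- k * h\<close> removes in the limit every preimage outside \<open>Y\<close>; by invariance of \<open>Y\<close>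
  the limit is \<open>0\<close> at points outside \<open>Y\<close>.\<close>

lemma fibre_op_limit:
  assumes u: "\<And>k. continuous_on UNIV (u k)" and B: "\<And>k y. \<bar>u k y\<bar> \<le> B"
    and l: "\<And>y. y \<in> Y \<Longrightarrow> (\<lambda>k. u k y) \<longlonglongrightarrow> l y"
  shows "(\<lambda>k. fibre_op (\<lambda>y. \<psi> y - real k * h y) (u k) x) \<longlonglongrightarrow> (\<Sum>y\<in>fibre 1 x. exp (\<phi> y) * l y)"
proof -
  interpret N: finite_measure "\<nu> x" by (rule finite_fibre)
  let ?F = "\<lambda>z. \<Sum>y\<in>fibre 1 x. indicator {y} z * (exp (\<psi> y) * l y)"
  have B0: "0 \<le> B" using B[of 0 x] by linarith
  have "(\<lambda>k. \<integral>z. exp (\<psi> z - real k * h z) * u k z \<partial>\<nu> x) \<longlonglongrightarrow> (\<integral>z. ?F z \<partial>\<nu> x)"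
  proof (rule integral_dominated_convergence[where w="\<lambda>z. exp (\<psi> z) * B"])
    show "AE z in \<nu> x. (\<lambda>k. exp (\<psi> z - real k * h z) * u k z) \<longlonglongrightarrow> ?F z"
      using fibre_support
    proof (rule AE_mp, intro AE_I2 impI)
      fix z assume z: "\<alpha> z = x"
      show "(\<lambda>k. exp (\<psi> z - real k * h z) * u k z) \<longlonglongrightarrow> ?F z"
      proof (cases "z \<in> Y")
        case True
        then have "z \<in> fibre 1 x" using z by (simp add: fibre_def)
        then have "?F z = exp (\<psi> z) * l z"
          by (subst sum.remove[of _ z]) (auto simp: sum.neutral)
        then show ?thesis using True l[OF True] by (auto intro!: tendsto_intros)
      next
        case False
        then have "z \<notin> fibre 1 x" by (simp add: fibre_def)
        then have F0: "?F z = 0" by (intro sum.neutral) (auto simp: indicator_def)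
        have "0 < h z" using False h_zero_iff[of z] infdist_nonneg[of z Y] by linarith
        then have "(\<lambda>k. exp (\<psi> z) * (exp (- h z)) ^ k * B) \<longlonglongrightarrow> exp (\<psi> z) * 0 * B"
          by (intro tendsto_intros LIMSEQ_power_zero) simp
        also have "(\<lambda>k. exp (\<psi> z) * (exp (- h z)) ^ k * B) = (\<lambda>k. exp (\<psi> z - real k * h z) * B)"
          by (simp add: exp_diff exp_minus power_inverse exp_of_nat_mult divide_inverse)
        finally have "(\<lambda>k. exp (\<psi> z - real k * h z) * B) \<longlonglongrightarrow> 0" by simp
        then show ?thesis unfolding F0
          by (rule Lim_null_comparison[rotated])
            (auto simp: abs_mult intro!: always_eventually mult_left_mono B)
      qed
    qed
    show "AE z in \<nu> x. norm (exp (\<psi> z - real k * h z) * u k z) \<le> exp (\<psi> z) * B" for k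
      using B B0 by (intro AE_I2) (auto simp: abs_mult infdist_nonneg intro!: mult_mono)
    show "?F \<in> borel_measurable (\<nu> x)"
      by (intro borel_measurable_sum borel_measurable_times borel_measurable_indicator borel_measurable_const) simp
  qed (auto intro!: borel_measurable_integrable integrable_fibre continuous_intros continuous_\<psi> u)
  \<comment> \<open>Only the atoms at points of the fibre remain. Their masses are the values of
    \<rho>, which turn the weight \<open>exp \<psi>\<close> into \<open>exp \<phi>\<close>.\<close>
  moreover have "(\<integral>z. ?F z \<partial>\<nu> x) = (\<Sum>y\<in>fibre 1 x. exp (\<phi> y) * l y)"
  proof -
    have "(\<integral>z. ?F z \<partial>\<nu> x) = (\<Sum>y\<in>fibre 1 x. measure (\<nu> x) {y} * (exp (\<psi> y) * l y))"
      by (subst Bochner_Integration.integral_sum) (auto simp: N.emeasure_eq_measure)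
    also have "\<dots> = (\<Sum>y\<in>fibre 1 x. exp (\<phi> y) * l y)"
    proof (rule sum.cong[OF refl])
      fix y assume "y \<in> fibre 1 x"
      then have "measure (\<nu> x) {y} = \<rho> y" by (auto simp: fibre_def \<rho>_cocycle cocycle_def)
      then show "measure (\<nu> x) {y} * (exp (\<psi> y) * l y) = exp (\<phi> y) * l y"
        using \<rho>_pos[of y] by (simp add: exp_add mult_ac)
    qed
    finally show ?thesis .
  qed
  ultimately show ?thesis unfolding fibre_op_def by simp
qed

abbreviation "penalised k y \<equiv> \<psi> y - real k * h y"

lemma continuous_penalised: "continuous_on UNIV (penalised k)"
  by (intro continuous_intros continuous_\<psi>)

lemma fibre_op_pow_le: "(fibre_op (penalised k) ^^ n) (\<lambda>_. 1) x \<le> (fibre_op \<psi> ^^ n) (\<lambda>_. 1) x"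
  by (intro fibre_op_pow_antimono_weight continuous_penalised continuous_\<psi>) (auto simp: infdist_nonneg)

text \<open>At \<open>n = 0\<close> the iterate is \<open>1\<close> while the fibre sum is
  \<open>0\<close> off \<open>Y\<close>, hence the disjunction. The induction survives it because
  \<open>fibre_op_limit\<close> needs limits on \<open>Y\<close> only. Domination is uniform in
  \<open>k\<close>, as the penalty only decreases the iterates.\<close>

lemma fibre_op_pow_limit_Y:
  "x \<in> Y \<or> 0 < n \<Longrightarrow> (\<lambda>k. (fibre_op (penalised k) ^^ n) (\<lambda>_. 1) x) \<longlonglongrightarrow> fibre_sum n x"
proof (induction n arbitrary: x)
  case 0
  then have "fibre 0 x = {x}" by (auto simp: fibre_def)
  then show ?case by (simp add: fibre_sum_def birkhoff_sum_def)
next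
  case (Suc n)
  obtain K where K: "\<And>n x. (fibre_op \<psi> ^^ n) (\<lambda>_. 1) x \<le> K ^ n"
    using fibre_op_pow_bound[OF continuous_\<psi>] by blast
  show ?case
    unfolding fibre_sum_Suc funpow.simps comp_def
  proof (rule fibre_op_limit)
    show "\<bar>(fibre_op (penalised k) ^^ n) (\<lambda>_. 1) y\<bar> \<le> K ^ n" for k y
      using fibre_op_pow_nonneg[of "\<lambda>_. 1" n "penalised k" y] fibre_op_pow_le[of n k y] K[of n y] by simp
  qed (use Suc.IH in \<open>simp_all add: continuous_fibre_op_pow[OF continuous_penalised]\<close>)
qed

lemma fibre_sum_le: "0 < n \<Longrightarrow> fibre_sum n x \<le> (fibre_op \<psi> ^^ n) (\<lambda>_. 1) x"
  using fibre_op_pow_le by (intro LIMSEQ_le_const2[OF fibre_op_pow_limit_Y]) auto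

section \<open>Maximal fibre sums and the upper bound for the operator\<close>

definition max_fibre_sum :: "nat \<Rightarrow> real" where
  "max_fibre_sum n = (SUP x. fibre_sum n x)"

lemma fibre_sum_le_max: "0 < n \<Longrightarrow> fibre_sum n x \<le> max_fibre_sum n"
proof -
  assume n: "0 < n"
  obtain K where "\<And>x. (fibre_op \<psi> ^^ n) (\<lambda>_. 1) x \<le> K ^ n"
    using fibre_op_pow_bound[OF continuous_\<psi>] by blast
  then have "bdd_above (range (fibre_sum n))"
    using fibre_sum_le[OF n] by (intro bdd_aboveI2[where M="K ^ n"]) (meson order_trans)
  then show ?thesis unfolding max_fibre_sum_def by (rule cSUP_upper[OF UNIV_I])
qed

lemma max_fibre_sum_le: "(\<And>x. fibre_sum n x \<le> c) \<Longrightarrow> max_fibre_sum n \<le> c"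
  unfolding max_fibre_sum_def by (rule cSUP_least) auto

text \<open>A single point of \<open>Y\<close> contributes at least this much to the fibre in which
  its orbit ends. The bound makes the logarithms meaningful and the growth rate finite.\<close>

lemma max_fibre_sum_lower:
  obtains B where "\<And>n. 0 < n \<Longrightarrow> exp (- (real n * B)) \<le> max_fibre_sum n"
proof -
  obtain B where B: "\<And>x. \<bar>\<phi> x\<bar> \<le> B" using bounded_fun[OF continuous_\<phi>] by blast
  obtain y where y: "y \<in> Y" using Y_nonempty by auto
  have "exp (- (real n * B)) \<le> max_fibre_sum n" if n: "0 < n" for n
  proof -
    have "- (real n * B) \<le> S n y" using abs_birkhoff_sum_le[of \<phi> B \<alpha> n y] B by (simp add: abs_le_iff)
    then have "exp (- (real n * B)) \<le> exp (S n y)" by simp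
    also have "\<dots> = (\<Sum>z\<in>{y}. exp (S n z))" by simp
    also have "\<dots> \<le> fibre_sum n ((\<alpha> ^^ n) y)"
      unfolding fibre_sum_def using y by (intro sum_mono2 finite_fibre_set) (auto simp: fibre_def)
    also have "\<dots> \<le> max_fibre_sum n" by (rule fibre_sum_le_max[OF n])
    finally show ?thesis .
  qed
  then show thesis using that by blast
qed

lemma max_fibre_sum_pos: "0 < n \<Longrightarrow> 0 < max_fibre_sum n"
  using max_fibre_sum_lower by (metis exp_gt_zero less_le_trans)

text \<open>The point is that \<open>k\<close> and \<open>C\<close> are fixed before \<delta>, so
  the exponent \<open>k * \<delta>\<close> can be made as small as desired afterwards.\<close>

lemma fibre_op_pow_upper:
  assumes m: "0 < m" and c: "max_fibre_sum m < c"
  obtains k :: nat and C where "0 < C" "\<And>\<delta>. 0 < \<delta> \<Longrightarrow>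
    \<forall>\<^sub>F n in sequentially. \<forall>x. (fibre_op \<psi> ^^ n) (\<lambda>_. 1) x \<le> exp (real n * (real k * \<delta>)) * (C * c ^ (n div m))"
proof -
  have c0: "0 < c" using max_fibre_sum_pos[OF m] c by simp
  have "\<exists>k. \<forall>x. (fibre_op (penalised k) ^^ m) (\<lambda>_. 1) x < c"
  proof (rule dini_upper[OF compact_space])
    show "(\<lambda>k. (fibre_op (penalised k) ^^ m) (\<lambda>_. 1) x) \<longlonglongrightarrow> fibre_sum m x" for x
      using m by (intro fibre_op_pow_limit_Y) simp
    show "fibre_sum m x < c" for x using fibre_sum_le_max[OF m] c by (rule le_less_trans)
  qed (auto intro!: continuous_fibre_op_pow continuous_penalised fibre_op_pow_antimono_weight
      simp: infdist_nonneg mult_right_mono)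
  then obtain k where k: "\<And>x. (fibre_op (penalised k) ^^ m) (\<lambda>_. 1) x \<le> c" using less_imp_le by blast
  obtain K where K: "1 \<le> K" "\<And>n x. (fibre_op (penalised k) ^^ n) (\<lambda>_. 1) x \<le> K ^ n"
    using fibre_op_pow_bound[OF continuous_penalised] by blast
  \<comment> \<open>Full blocks contribute \<open>c\<close> each; the incomplete block of
    \<open>n mod m\<close> steps is absorbed by \<open>K ^ m\<close>, which uses
    \<open>1 \<le> K\<close>.\<close>
  have pen: "(fibre_op (penalised k) ^^ n) (\<lambda>_. 1) x \<le> K ^ m * c ^ (n div m)" for n x
  proof -
    have "(fibre_op (penalised k) ^^ n) (\<lambda>_. 1) x =
        (fibre_op (penalised k) ^^ ((n div m) * m)) ((fibre_op (penalised k) ^^ (n mod m)) (\<lambda>_. 1)) x"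
      using funpow_add[of "(n div m) * m" "n mod m" "fibre_op (penalised k)"] by simp
    also have "\<dots> \<le> (fibre_op (penalised k) ^^ ((n div m) * m)) (\<lambda>_. K ^ m * 1) x"
    proof (intro fibre_op_pow_mono continuous_fibre_op_pow continuous_penalised)
      fix y
      have "K ^ (n mod m) \<le> K ^ m" using K(1) m by (intro power_increasing) auto
      then show "(fibre_op (penalised k) ^^ (n mod m)) (\<lambda>_. 1) y \<le> K ^ m * 1"
        using K(2)[of "n mod m" y] by simp
    qed auto
    also have "\<dots> \<le> K ^ m * c ^ (n div m)"
      unfolding fibre_op_pow_scale
      using K(1) fibre_op_pow_block[OF continuous_penalised k] by (intro mult_left_mono) auto
    finally show ?thesis .
  qed
  have "\<forall>\<^sub>F n in sequentially. \<forall>x. (fibre_op \<psi> ^^ n) (\<lambda>_. 1) x \<le> exp (real n * (real k * \<delta>)) * (K ^ m * c ^ (n div m))"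
    if \<delta>: "0 < \<delta>" for \<delta>
    using orbits_near_essential_set[OF compact_space continuous_map \<delta>]
  proof eventually_elim
    case (elim n)
    show ?case
    proof
      fix x
      let ?g = "\<lambda>y. real k * h y"
      have gc: "continuous_on UNIV ?g" by (intro continuous_intros)
      have bg: "birkhoff_sum \<alpha> ?g n y \<le> real n * (real k * \<delta>)" for y
      proof -
        have "birkhoff_sum \<alpha> ?g n y = real k * birkhoff_sum \<alpha> h n y"
          by (simp add: birkhoff_sum_def sum_distrib_left)
        also have "\<dots> \<le> real k * (real n * \<delta>)" using elim by (intro mult_left_mono) auto
        finally show ?thesis by (simp add: mult_ac)
      qed
      have "(fibre_op \<psi> ^^ n) (\<lambda>_. 1) x =
          (fibre_op (penalised k) ^^ n) (\<lambda>y. exp (birkhoff_sum \<alpha> ?g n y) * 1) x"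
        using fibre_op_pow_weight[where w="penalised k" and g="?g" and n=n and u="\<lambda>_. 1"]
            continuous_penalised gc by simp
      also have "\<dots> \<le> (fibre_op (penalised k) ^^ n) (\<lambda>y. exp (real n * (real k * \<delta>)) * 1) x"
        using bg by (intro fibre_op_pow_mono continuous_penalised continuous_intros
            continuous_on_birkhoff_sum continuous_map gc) auto
      also have "\<dots> \<le> exp (real n * (real k * \<delta>)) * (K ^ m * c ^ (n div m))"
        unfolding fibre_op_pow_scale using pen by (intro mult_left_mono) auto
      finally show "(fibre_op \<psi> ^^ n) (\<lambda>_. 1) x \<le> exp (real n * (real k * \<delta>)) * (K ^ m * c ^ (n div m))" .
    qed
  qed
  then show thesis using K(1) by (intro that[of "K ^ m" k]) auto
qed

end

section \<open>Growth rates and topological pressure\<close>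

text \<open>The common limit is the infimum of \<open>b\<close>: each single \<open>b m\<close>
  bounds the upper limit of \<open>a\<close>, and the infimum bounds both sequences from below. This
  takes the place of Fekete's lemma.\<close>

lemma squeeze_growth_rates:
  fixes a b :: "nat \<Rightarrow> real"
  assumes ba: "\<And>n. 0 < n \<Longrightarrow> b n \<le> a n"
    and ab: "\<And>m t. 0 < m \<Longrightarrow> b m < t \<Longrightarrow> \<forall>\<^sub>F n in sequentially. a n \<le> t"
    and low: "\<And>n. 0 < n \<Longrightarrow> B \<le> b n"
  shows "\<exists>l. a \<longlonglongrightarrow> l \<and> b \<longlonglongrightarrow> l"
proof -
  define l where "l = Inf (b ` {0<..})"
  have bdd: "bdd_below (b ` {0<..})" using low by (intro bdd_belowI2) auto
  have lb: "l \<le> b n" if "0 < n" for n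
    unfolding l_def using bdd that by (intro cInf_lower) auto
  have up: "\<forall>\<^sub>F n in sequentially. a n < t" if t: "l < t" for t
  proof -
    obtain m where m: "0 < m" "b m < (l + t) / 2"
      using cInf_lessD[of "b ` {0<..}" "(l + t) / 2"] t unfolding l_def by auto
    have "(l + t) / 2 < t" using t by simp
    then show ?thesis using ab[OF m] by (auto elim!: eventually_mono)
  qed
  have "a \<longlonglongrightarrow> l"
  proof (rule order_tendstoI)
    fix s assume "s < l"
    then show "\<forall>\<^sub>F n in sequentially. s < a n"
      using lb ba by (intro eventually_sequentiallyI[of 1]) (meson less_le_trans less_one not_less order_trans)
  qed (rule up)
  moreover have "b \<longlonglongrightarrow> l"
  proof (rule order_tendstoI)
    fix s assume "s < l"
    then show "\<forall>\<^sub>F n in sequentially. s < b n"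
      using lb by (intro eventually_sequentiallyI[of 1]) (meson less_le_trans less_one not_less)
  next
    fix t assume "l < t"
    show "\<forall>\<^sub>F n in sequentially. b n < t"
      using up[OF \<open>l < t\<close>] eventually_gt_at_top[of 0]
      by eventually_elim (use ba in \<open>meson le_less_trans\<close>)
  qed
  ultimately show ?thesis by blast
qed

text \<open>Taking logarithms, \<open>n div m\<close> differs from \<open>n / m\<close> by less than
  one, an error of at most \<open>\<bar>ln c\<bar>\<close>. This and \<open>ln C\<close> are
  constants, eventually absorbed by \<open>n\<close> times the gap \<open>s\<close>.\<close>

lemma block_growth:
  fixes c C \<kappa> t :: real
  assumes m: "0 < m" and c: "0 < c" and C: "0 < C" and t: "ln c / real m + \<kappa> < t"
  shows "\<forall>\<^sub>F n in sequentially. exp (real n * \<kappa>) * (C * c ^ (n div m)) \<le> exp (real n * t)"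
proof -
  define s where "s = t - (ln c / real m + \<kappa>)"
  have s: "0 < s" using t by (simp add: s_def)
  have "\<forall>\<^sub>F n in sequentially. (ln C + \<bar>ln c\<bar>) / s < real n"
    by (rule filterlim_real_sequentially[unfolded filterlim_at_top_dense, rule_format])
  then show ?thesis
  proof eventually_elim
    case (elim n)
    have "real n = real (n div m) * real m + real (n mod m)"
      by (metis div_mult_mod_eq of_nat_add of_nat_mult)
    then have "real (n div m) = real n / real m - real (n mod m) / real m"
      using m by (simp add: field_simps)
    then have "real (n div m) * ln c = real n * (ln c / real m) - real (n mod m) / real m * ln c"
      by (simp add: left_diff_distrib)
    moreover have "\<bar>real (n mod m) / real m * ln c\<bar> \<le> 1 * \<bar>ln c\<bar>"
      unfolding abs_mult using m by (intro mult_right_mono) (auto intro: less_imp_le)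
    moreover have "ln C + \<bar>ln c\<bar> \<le> real n * s" using elim s by (simp add: field_simps)
    ultimately have "real n * \<kappa> + (ln C + real (n div m) * ln c) \<le> real n * t"
      unfolding s_def right_diff_distrib distrib_left by linarith
    then have "exp (real n * \<kappa> + (ln C + real (n div m) * ln c)) \<le> exp (real n * t)" by simp
    then show ?case using c C by (simp add: exp_add exp_of_nat_mult)
  qed
qed

text \<open>One representative is kept for each itinerary of labels that occurs.\<close>

lemma itinerary_representatives:
  fixes lab :: "'a \<Rightarrow> 'b" and \<tau> :: "'a \<Rightarrow> 'a" and w :: "'b \<Rightarrow> real"
  assumes L: "finite L" "\<And>z. lab z \<in> L" and w: "\<And>b. 0 \<le> w b"
  shows "\<exists>E. finite E \<and> (\<forall>x. \<exists>y\<in>E. \<forall>j<q. lab ((\<tau> ^^ j) x) = lab ((\<tau> ^^ j) y)) \<and>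
    (\<Sum>y\<in>E. \<Prod>j<q. w (lab ((\<tau> ^^ j) y))) \<le> (\<Sum>b\<in>L. w b) ^ q"
proof (induction q)
  case 0
  \<comment> \<open>With no labels to match any point represents all, but the set must be nonempty;
    its sum is the empty product \<open>1\<close>.\<close>
  show ?case by (rule exI[of _ "{undefined}"]) simp
next
  case (Suc q)
  then obtain E where E: "finite E" "\<And>x. \<exists>y\<in>E. \<forall>j<q. lab ((\<tau> ^^ j) x) = lab ((\<tau> ^^ j) y)"
    and sE: "(\<Sum>y\<in>E. \<Prod>j<q. w (lab ((\<tau> ^^ j) y))) \<le> (\<Sum>b\<in>L. w b) ^ q"
    by blast
  \<comment> \<open>A point realises \<open>(b, y)\<close> if it has label \<open>b\<close> and its
    image follows the itinerary of \<open>y\<close>. \<open>R\<close> collects the pairs that occur,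
    and \<open>g\<close> picks one point for each.\<close>
  define Q where "Q b y x \<longleftrightarrow> lab x = b \<and> (\<forall>j<q. lab ((\<tau> ^^ j) (\<tau> x)) = lab ((\<tau> ^^ j) y))" for b y x
  define R where "R = {(b, y). b \<in> L \<and> y \<in> E \<and> (\<exists>x. Q b y x)}"
  define g where "g = (\<lambda>(b, y). SOME x. Q b y x)"
  have RL: "R \<subseteq> L \<times> E" by (auto simp: R_def)
  then have R: "finite R" using L(1) E(1) by (meson finite_SigmaI finite_subset)
  have g: "Q b y (g (b, y))" if "(b, y) \<in> R" for b y
    using that unfolding R_def g_def by (auto intro: someI_ex)
  have shift: "(\<tau> ^^ Suc j) x = (\<tau> ^^ j) (\<tau> x)" for j x by (simp add: funpow_swap1)
  have cover: "\<exists>y\<in>g ` R. \<forall>j<Suc q. lab ((\<tau> ^^ j) x) = lab ((\<tau> ^^ j) y)" for x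
  proof -
    obtain y where y: "y \<in> E" "\<forall>j<q. lab ((\<tau> ^^ j) (\<tau> x)) = lab ((\<tau> ^^ j) y)" using E(2) by blast
    have "Q (lab x) y x" using y by (simp add: Q_def)
    then have r: "(lab x, y) \<in> R" using y L(2) by (auto simp: R_def)
    have "lab ((\<tau> ^^ j) x) = lab ((\<tau> ^^ j) (g (lab x, y)))" if "j < Suc q" for j
    proof (cases j)
      case 0
      then show ?thesis using g[OF r] by (simp add: Q_def)
    next
      case (Suc i)
      then show ?thesis using g[OF r] y that unfolding Q_def shift Suc by simp
    qed
    then show ?thesis using r by blast
  qed
  \<comment> \<open>An inequality is enough and is what holds in general, since \<open>g\<close> may
    identify pairs.\<close>
  have "(\<Sum>y\<in>g ` R. \<Prod>j<Suc q. w (lab ((\<tau> ^^ j) y))) \<le> (\<Sum>p\<in>R. \<Prod>j<Suc q. w (lab ((\<tau> ^^ j) (g p))))"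
    using sum_image_le[OF R, of "\<lambda>y. \<Prod>j<Suc q. w (lab ((\<tau> ^^ j) y))" g] w by (simp add: prod_nonneg comp_def)
  also have "\<dots> = (\<Sum>(b, y)\<in>R. w b * (\<Prod>j<q. w (lab ((\<tau> ^^ j) y))))"
  proof (rule sum.cong[OF refl], clarify)
    fix b y assume "(b, y) \<in> R"
    then have "Q b y (g (b, y))" by (rule g)
    then show "(\<Prod>j<Suc q. w (lab ((\<tau> ^^ j) (g (b, y))))) = w b * (\<Prod>j<q. w (lab ((\<tau> ^^ j) y)))"
      unfolding prod.lessThan_Suc_shift shift by (simp add: Q_def)
  qed
  also have "\<dots> \<le> (\<Sum>(b, y)\<in>L \<times> E. w b * (\<Prod>j<q. w (lab ((\<tau> ^^ j) y))))"
    using RL L(1) E(1) w by (intro sum_mono2) (auto intro!: mult_nonneg_nonneg prod_nonneg)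
  also have "\<dots> = (\<Sum>b\<in>L. w b) * (\<Sum>y\<in>E. \<Prod>j<q. w (lab ((\<tau> ^^ j) y)))"
    by (simp add: sum_product sum.cartesian_product)
  also have "\<dots> \<le> (\<Sum>b\<in>L. w b) ^ Suc q"
    using sE w by (simp add: mult_left_mono sum_nonneg)
  finally show ?case using R cover by (intro exI[of _ "g ` R"]) simp
qed

lemma dist_orbit_less_iff: "0 < n \<Longrightarrow> dist_orbit \<alpha> n x y < \<epsilon> \<longleftrightarrow> x \<in> bowen_ball \<alpha> n \<epsilon> y"
  unfolding dist_orbit_def bowen_ball_def by (subst Max_less_iff) auto

lemma spanning_iff: "0 < n \<Longrightarrow> spanning \<alpha> n \<epsilon> E \<longleftrightarrow> UNIV = (\<Union>y\<in>E. bowen_ball \<alpha> n \<epsilon> y)"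
  unfolding spanning_def by (auto simp: dist_orbit_less_iff)

section \<open>Growth rate of the operator norms\<close>

context cocycle_system
begin

text \<open>The norm of the \<open>n\<close>-th iterate of the weighted operator; the identification
  is made in the final proof.\<close>

definition op_sup :: "nat \<Rightarrow> real" where
  "op_sup n = (SUP x. (fibre_op \<psi> ^^ n) (\<lambda>_. 1) x)"

lemma op_sup_upper: "(fibre_op \<psi> ^^ n) (\<lambda>_. 1) x \<le> op_sup n"
proof -
  obtain K where "\<And>x. (fibre_op \<psi> ^^ n) (\<lambda>_. 1) x \<le> K ^ n"
    using fibre_op_pow_bound[OF continuous_\<psi>] by blast
  then show ?thesis unfolding op_sup_def by (intro cSUP_upper bdd_aboveI2[where M="K ^ n"]) auto
qed

lemma op_sup_least: "(\<And>x. (fibre_op \<psi> ^^ n) (\<lambda>_. 1) x \<le> C) \<Longrightarrow> op_sup n \<le> C"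
  unfolding op_sup_def by (rule cSUP_least) auto

lemma max_fibre_sum_le_op_sup: "0 < n \<Longrightarrow> max_fibre_sum n \<le> op_sup n"
  by (intro max_fibre_sum_le order_trans[OF fibre_sum_le op_sup_upper])

lemma op_sup_pos: "0 < n \<Longrightarrow> 0 < op_sup n"
  using max_fibre_sum_pos max_fibre_sum_le_op_sup by (rule less_le_trans)

theorem growth_rate:
  obtains l where "(\<lambda>n. ln (op_sup n) / real n) \<longlonglongrightarrow> l" "(\<lambda>n. ln (max_fibre_sum n) / real n) \<longlonglongrightarrow> l"
proof -
  obtain B where B: "\<And>n. 0 < n \<Longrightarrow> exp (- (real n * B)) \<le> max_fibre_sum n"
    using max_fibre_sum_lower by blast
  have "\<exists>l. (\<lambda>n. ln (op_sup n) / real n) \<longlonglongrightarrow> l \<and> (\<lambda>n. ln (max_fibre_sum n) / real n) \<longlonglongrightarrow> l"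
  proof (rule squeeze_growth_rates)
    fix n :: nat assume n: "0 < n"
    show "ln (max_fibre_sum n) / real n \<le> ln (op_sup n) / real n"
      using max_fibre_sum_le_op_sup[OF n] max_fibre_sum_pos[OF n] by (intro divide_right_mono) auto
    have "- (real n * B) \<le> ln (max_fibre_sum n)"
      using B[OF n] max_fibre_sum_pos[OF n] by (simp add: ln_ge_iff)
    then show "- B \<le> ln (max_fibre_sum n) / real n" using n by (simp add: field_simps)
  next
    fix m :: nat and t assume m: "0 < m" and t: "ln (max_fibre_sum m) / real m < t"
    \<comment> \<open>Four equal parts of the gap: one enlarges the maximal fibre sum to
      \<open>c\<close>, one pays for \<open>k * \<delta>\<close>, and the rest is strict
      slack.\<close>
    define e where "e = (t - ln (max_fibre_sum m) / real m) / 4"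
    have e: "0 < e" using t by (simp add: e_def)
    define c where "c = max_fibre_sum m * exp (real m * e)"
    have c: "max_fibre_sum m < c" "0 < c"
      using max_fibre_sum_pos[OF m] e m by (auto simp: c_def)
    have lnc: "ln c / real m = ln (max_fibre_sum m) / real m + e"
      using max_fibre_sum_pos[OF m] m by (simp add: c_def ln_mult field_simps)
    obtain k :: nat and C where C: "0 < C" and ev: "\<And>\<delta>. 0 < \<delta> \<Longrightarrow>
      \<forall>\<^sub>F n in sequentially. \<forall>x. (fibre_op \<psi> ^^ n) (\<lambda>_. 1) x \<le> exp (real n * (real k * \<delta>)) * (C * c ^ (n div m))"
      by (rule fibre_op_pow_upper[OF m c(1)]) (rule that)
    define \<delta> where "\<delta> = e / (real k + 1)"
    have \<delta>: "0 < \<delta>" using e by (simp add: \<delta>_def add_nonneg_pos)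
    have "(real k + 1) * \<delta> = e" by (simp add: \<delta>_def add_nonneg_pos)
    then have \<delta>k: "real k * \<delta> \<le> e" using \<delta> by (simp add: distrib_right)
    have "t = ln (max_fibre_sum m) / real m + 4 * e" by (simp add: e_def field_simps)
    then have "ln c / real m + real k * \<delta> < t" using lnc \<delta>k e by linarith
    from block_growth[OF m c(2) C this] ev[OF \<delta>] eventually_gt_at_top[of 0]
    show "\<forall>\<^sub>F n in sequentially. ln (op_sup n) / real n \<le> t"
    proof eventually_elim
      case (elim n)
      have "op_sup n \<le> exp (real n * t)"
        by (rule op_sup_least) (rule order_trans[OF elim(2)[rule_format] elim(1)])
      then have "ln (op_sup n) \<le> real n * t"
        using ln_le_cancel_iff[OF op_sup_pos, of n "exp (real n * t)"] elim by simp
      then show ?case using elim by (simp add: field_simps)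
    qed
  qed
  then show thesis using that by blast
qed

section \<open>Inverse branches and spanning sets\<close>

lemma modulus:
  assumes "0 < \<eta>"
  obtains \<epsilon> where "0 < \<epsilon>" "\<And>n x y. x \<in> bowen_ball \<alpha> n \<epsilon> y \<Longrightarrow> \<bar>S n x - S n y\<bar> \<le> real n * \<eta>"
proof -
  have "uniformly_continuous_on UNIV \<phi>"
    by (rule compact_uniformly_continuous[OF continuous_\<phi> compact_space])
  then obtain \<epsilon> where \<epsilon>: "0 < \<epsilon>" "\<And>x y. dist x y < \<epsilon> \<Longrightarrow> dist (\<phi> x) (\<phi> y) < \<eta>"
    using assms unfolding uniformly_continuous_on_def by (metis UNIV_I)
  have "\<bar>S n x - S n y\<bar> \<le> real n * \<eta>" if "x \<in> bowen_ball \<alpha> n \<epsilon> y" for n x y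
  proof -
    have "\<bar>S n x - S n y\<bar> \<le> (\<Sum>i<n. \<bar>\<phi> ((\<alpha> ^^ i) x) - \<phi> ((\<alpha> ^^ i) y)\<bar>)"
      unfolding birkhoff_sum_def sum_subtractf[symmetric] by (rule sum_abs)
    also have "\<dots> \<le> (\<Sum>i<n. \<eta>)"
      using that \<epsilon>(2) by (intro sum_mono) (auto simp: bowen_ball_def dist_real_def intro: less_imp_le)
    finally show ?thesis by simp
  qed
  with \<epsilon>(1) show thesis by (rule that)
qed

text \<open>The local homeomorphism gives preimages within \<open>r\<close> of the given point;
  non-contraction then improves \<open>r\<close> to the distance of the images. Compactness of
  \<open>Y\<close> makes \<delta> uniform.\<close>

lemma inverse_branches:
  assumes lh: "local_homeomorphism_on Y \<alpha>"
  obtains \<delta> where "0 < \<delta>" "\<And>y x. y \<in> Y \<Longrightarrow> x \<in> Y \<Longrightarrow> dist x (\<alpha> y) < \<delta> \<Longrightarrow>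
    \<exists>y'\<in>Y. \<alpha> y' = x \<and> dist y' y \<le> dist x (\<alpha> y)"
proof -
  obtain r where r: "0 < r" "\<And>y z. y \<in> Y \<Longrightarrow> z \<in> Y \<Longrightarrow> dist y z \<le> r \<Longrightarrow> dist y z \<le> dist (\<alpha> y) (\<alpha> z)"
    using non_contracting unfolding non_contracting_on_def by blast
  \<comment> \<open>Around each \<open>y\<close> the image of a small piece of \<open>Y\<close>
    contains a relative ball about \<open>\<alpha> y\<close>; by continuity, half of its radius
    serves all \<open>z\<close> near \<open>y\<close>.\<close>
  have "\<exists>\<eta> s. 0 < \<eta> \<and> 0 < s \<and> (\<forall>z\<in>Y. \<forall>x\<in>Y. dist y z < s \<and> dist x (\<alpha> z) < \<eta> \<longrightarrow>
      (\<exists>y'\<in>Y. \<alpha> y' = x \<and> dist y' z \<le> r))" if y: "y \<in> Y" for y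
  proof -
    obtain U V g where U: "openin (top_of_set Y) U" "y \<in> U" and V: "openin (top_of_set Y) V"
      and hom: "homeomorphism U V \<alpha> g"
      using lh y unfolding local_homeomorphism_on_def by blast
    have UY: "U \<subseteq> Y" using U(1) by (simp add: openin_contains_ball)
    have "openin (top_of_set U) (U \<inter> ball y (r / 2))" by (simp add: openin_open_Int)
    then have "openin (top_of_set V) (\<alpha> ` (U \<inter> ball y (r / 2)))"
      by (rule homeomorphism_imp_open_map[OF hom])
    then have "openin (top_of_set Y) (\<alpha> ` (U \<inter> ball y (r / 2)))"
      using V by (rule openin_trans)
    moreover have "\<alpha> y \<in> \<alpha> ` (U \<inter> ball y (r / 2))" using U(2) r(1) by simp
    ultimately obtain \<eta> where \<eta>: "0 < \<eta>" "ball (\<alpha> y) \<eta> \<inter> Y \<subseteq> \<alpha> ` (U \<inter> ball y (r / 2))"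
      unfolding openin_contains_ball by blast
    have "isCont \<alpha> y" using continuous_map by (simp add: continuous_on_eq_continuous_at)
    then obtain s where s: "0 < s" "\<And>z. dist z y < s \<Longrightarrow> dist (\<alpha> z) (\<alpha> y) < \<eta> / 2"
      using \<eta>(1) unfolding continuous_at_eps_delta by (meson half_gt_zero)
    have "\<exists>y'\<in>Y. \<alpha> y' = x \<and> dist y' z \<le> r"
      if z: "z \<in> Y" "dist y z < min s (r / 2)" and x: "x \<in> Y" "dist x (\<alpha> z) < \<eta> / 2" for z x
    proof -
      have "dist (\<alpha> z) (\<alpha> y) < \<eta> / 2" using s(2)[of z] z(2) by (simp add: dist_commute)
      then have "x \<in> ball (\<alpha> y) \<eta> \<inter> Y"
        using x dist_triangle[of x "\<alpha> y" "\<alpha> z"] by (simp add: dist_commute)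
      then obtain y' where y': "y' \<in> U" "dist y y' < r / 2" "\<alpha> y' = x" using \<eta>(2) by auto
      then have "dist y' z \<le> r" using z(2) dist_triangle3[of y' z y] by simp
      then show ?thesis using y' UY by blast
    qed
    then show ?thesis
      using \<eta>(1) s(1) r(1) by (intro exI[of _ "\<eta> / 2"] exI[of _ "min s (r / 2)"]) auto
  qed
  then obtain \<eta> s where \<eta>s: "\<And>y. y \<in> Y \<Longrightarrow> 0 < \<eta> y" "\<And>y. y \<in> Y \<Longrightarrow> 0 < s y"
    and br: "\<And>y z x. y \<in> Y \<Longrightarrow> z \<in> Y \<Longrightarrow> x \<in> Y \<Longrightarrow> dist y z < s y \<Longrightarrow> dist x (\<alpha> z) < \<eta> y \<Longrightarrow>
      \<exists>y'\<in>Y. \<alpha> y' = x \<and> dist y' z \<le> r"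
    by metis
  have cY: "compact Y" using compact_space closed_essential_set by (metis compact_Int_closed inf_top_left)
  obtain D where D: "D \<subseteq> Y" "finite D" "Y \<subseteq> (\<Union>y\<in>D. ball y (s y))"
    by (rule compactE_image[OF cY, of Y "\<lambda>y. ball y (s y)"]) (use \<eta>s(2) in auto)
  define \<delta> where "\<delta> = Min (insert 1 (\<eta> ` D))"
  have \<delta>: "0 < \<delta>" "\<And>y. y \<in> D \<Longrightarrow> \<delta> \<le> \<eta> y" using D \<eta>s(1) by (auto simp: \<delta>_def)
  have "\<exists>y'\<in>Y. \<alpha> y' = x \<and> dist y' z \<le> dist x (\<alpha> z)" if z: "z \<in> Y" and x: "x \<in> Y" "dist x (\<alpha> z) < \<delta>" for z x
  proof -
    obtain y where y: "y \<in> D" "dist y z < s y" using D(3) z by auto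
    have "dist x (\<alpha> z) < \<eta> y" using x(2) \<delta>(2)[OF y(1)] by linarith
    then obtain y' where "y' \<in> Y" "\<alpha> y' = x" "dist y' z \<le> r"
      using br[of y z x] y D(1) z x(1) by blast
    then show ?thesis using r(2)[of y' z] z by blast
  qed
  with \<delta>(1) show thesis by (rule that)
qed

text \<open>Pulling back does not increase the distance, so the same \<delta> remains valid at every
  step and for every \<open>n\<close>.\<close>

lemma inverse_branches_pow:
  assumes lh: "local_homeomorphism_on Y \<alpha>"
  obtains \<delta> where "0 < \<delta>" "\<And>n y x. y \<in> Y \<Longrightarrow> x \<in> Y \<Longrightarrow> dist x ((\<alpha> ^^ n) y) < \<delta> \<Longrightarrow>
    \<exists>y'\<in>fibre n x. \<forall>i\<le>n. dist ((\<alpha> ^^ i) y') ((\<alpha> ^^ i) y) \<le> dist x ((\<alpha> ^^ n) y)"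
proof -
  obtain \<delta> where \<delta>: "0 < \<delta>" and br: "\<And>y x. y \<in> Y \<Longrightarrow> x \<in> Y \<Longrightarrow> dist x (\<alpha> y) < \<delta> \<Longrightarrow>
    \<exists>y'\<in>Y. \<alpha> y' = x \<and> dist y' y \<le> dist x (\<alpha> y)"
    using inverse_branches[OF lh] by blast
  have "\<exists>y'\<in>fibre n x. \<forall>i\<le>n. dist ((\<alpha> ^^ i) y') ((\<alpha> ^^ i) y) \<le> dist x ((\<alpha> ^^ n) y)"
    if "y \<in> Y" "x \<in> Y" "dist x ((\<alpha> ^^ n) y) < \<delta>" for n y x
    using that(1,3)
  proof (induction n arbitrary: y)
    case 0
    then show ?case using that(2) by (intro bexI[of _ x]) (auto simp: fibre_def)
  next
    case (Suc n)
    let ?d = "dist x ((\<alpha> ^^ Suc n) y)"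
    have sh: "(\<alpha> ^^ Suc i) z = (\<alpha> ^^ i) (\<alpha> z)" for i z by (simp add: funpow_swap1)
    have ay: "\<alpha> y \<in> Y" using funpow_Y[OF Suc.prems(1), of 1] by simp
    obtain z where z: "z \<in> fibre n x" "\<forall>i\<le>n. dist ((\<alpha> ^^ i) z) ((\<alpha> ^^ i) (\<alpha> y)) \<le> ?d"
      using Suc.IH[OF ay] Suc.prems(2) unfolding sh by blast
    have "dist z (\<alpha> y) \<le> ?d" using z(2)[rule_format, of 0] by simp
    then have "dist z (\<alpha> y) < \<delta>" using Suc.prems(2) by linarith
    then obtain y' where y': "y' \<in> Y" "\<alpha> y' = z" "dist y' y \<le> dist z (\<alpha> y)"
      using br[of y z] Suc.prems(1) z(1) by (auto simp: fibre_def)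
    have "dist ((\<alpha> ^^ i) y') ((\<alpha> ^^ i) y) \<le> ?d" if "i \<le> Suc n" for i
    proof (cases i)
      case 0
      then show ?thesis using y'(3) \<open>dist z (\<alpha> y) \<le> ?d\<close> by simp
    next
      case (Suc j)
      then show ?thesis using z(2)[rule_format, of j] that unfolding Suc sh y'(2) by simp
    qed
    moreover have "y' \<in> fibre (Suc n) x" using z(1) y' unfolding fibre_def sh by simp
    ultimately show ?case by blast
  qed
  with \<delta> show thesis by (rule that)
qed

text \<open>The net \<open>N\<close> is placed at the final time \<open>m\<close>: an orbit ending
  near \<open>x \<in> N\<close> is shadowed by the pulled-back orbit ending at \<open>x\<close>. So
  \<open>M\<close> depends on \<epsilon> alone, not on \<open>m\<close>.\<close>

lemma essential_spanning:
  assumes lh: "local_homeomorphism_on Y \<alpha>" and \<epsilon>: "0 < \<epsilon>"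
  obtains M where "1 \<le> M" "\<And>m. 0 < m \<Longrightarrow> \<exists>E. finite E \<and> Y \<subseteq> (\<Union>y\<in>E. bowen_ball \<alpha> m \<epsilon> y) \<and>
    (\<Sum>y\<in>E. exp (S m y)) \<le> M * max_fibre_sum m"
proof -
  obtain \<delta> where \<delta>: "0 < \<delta>" and br: "\<And>n y x. y \<in> Y \<Longrightarrow> x \<in> Y \<Longrightarrow> dist x ((\<alpha> ^^ n) y) < \<delta> \<Longrightarrow>
    \<exists>y'\<in>fibre n x. \<forall>i\<le>n. dist ((\<alpha> ^^ i) y') ((\<alpha> ^^ i) y) \<le> dist x ((\<alpha> ^^ n) y)"
    using inverse_branches_pow[OF lh] by blast
  define e where "e = min \<epsilon> \<delta>"
  have e: "0 < e" "e \<le> \<epsilon>" "e \<le> \<delta>" using \<epsilon> \<delta> by (auto simp: e_def)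
  have cY: "compact Y" using compact_space closed_essential_set by (metis compact_Int_closed inf_top_left)
  obtain N where N: "N \<subseteq> Y" "finite N" "Y \<subseteq> (\<Union>x\<in>N. ball x e)"
    by (rule compactE_image[OF cY, of Y "\<lambda>y. ball y e"]) (use e in auto)
  have "\<exists>E. finite E \<and> Y \<subseteq> (\<Union>y\<in>E. bowen_ball \<alpha> m \<epsilon> y) \<and>
    (\<Sum>y\<in>E. exp (S m y)) \<le> real (max 1 (card N)) * max_fibre_sum m" if m: "0 < m" for m
  proof (intro exI conjI)
    let ?E = "\<Union>x\<in>N. fibre m x"
    show "finite ?E" using N(2) by simp
    show "Y \<subseteq> (\<Union>y\<in>?E. bowen_ball \<alpha> m \<epsilon> y)"
    proof
      fix y assume y: "y \<in> Y"
      then obtain x where x: "x \<in> N" "dist x ((\<alpha> ^^ m) y) < e" using N(3) funpow_Y[OF y, of m] by auto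
      then obtain y' where y': "y' \<in> fibre m x" "\<forall>i\<le>m. dist ((\<alpha> ^^ i) y') ((\<alpha> ^^ i) y) \<le> dist x ((\<alpha> ^^ m) y)"
        using br[of y x m] y N(1) e(3) by fastforce
      have "y \<in> bowen_ball \<alpha> m \<epsilon> y'"
        unfolding bowen_ball_def
      proof (intro CollectI allI impI)
        fix i assume "i < m"
        then have "dist ((\<alpha> ^^ i) y') ((\<alpha> ^^ i) y) \<le> dist x ((\<alpha> ^^ m) y)" using y'(2) by simp
        then show "dist ((\<alpha> ^^ i) y) ((\<alpha> ^^ i) y') < \<epsilon>" using x(2) e(2) by (simp add: dist_commute)
      qed
      then show "y \<in> (\<Union>y\<in>?E. bowen_ball \<alpha> m \<epsilon> y)" using x(1) y'(1) by blast
    qed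
    have "(\<Sum>y\<in>?E. exp (S m y)) = (\<Sum>x\<in>N. fibre_sum m x)"
      unfolding fibre_sum_def by (rule sum.UNION_disjoint) (simp_all add: N(2), auto simp: fibre_def)
    also have "\<dots> \<le> real (card N) * max_fibre_sum m"
      using fibre_sum_le_max[OF m] by (rule sum_bounded_above)
    also have "\<dots> \<le> real (max 1 (card N)) * max_fibre_sum m"
      using max_fibre_sum_pos[OF m] by (intro mult_right_mono) auto
    finally show "(\<Sum>y\<in>?E. exp (S m y)) \<le> real (max 1 (card N)) * max_fibre_sum m" .
  qed
  then show thesis by (intro that[of "real (max 1 (card N))"]) auto
qed

text \<open>A label is a Bowen ball of length \<open>m\<close> containing the current point,
  weighted by a bound for the penalised block sum. All labels together weigh at most
  \<open>c\<close>, so representatives of the itineraries of \<open>q\<close> blocks weigh at most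
  \<open>c ^ q\<close>; they span because equal labels keep orbits close.\<close>

theorem pressure_upper:
  assumes lh: "local_homeomorphism_on Y \<alpha>"
    and l: "(\<lambda>n. ln (max_fibre_sum n) / real n) \<longlonglongrightarrow> l" and t: "l < t" and \<epsilon>: "0 < \<epsilon>"
  shows "\<forall>\<^sub>F n in sequentially. \<exists>E. finite E \<and> spanning \<alpha> n \<epsilon> E \<and> (\<Sum>y\<in>E. exp (S n y)) \<le> exp (real n * t)"
proof -
  \<comment> \<open>Five of the eight parts are spent: distortion in \<open>s\<close>, room for the
    far labels in \<open>c\<close>, \<open>ln M / m\<close>, the deviation of the rate at
    \<open>m\<close>, and \<open>k * \<delta>\<close>.\<close>
  define \<eta> where "\<eta> = (t - l) / 8"
  have \<eta>: "0 < \<eta>" "t = l + 8 * \<eta>" using t by (auto simp: \<eta>_def field_simps)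
  obtain \<epsilon>0 where \<epsilon>0: "0 < \<epsilon>0" and mod0: "\<And>n x y. x \<in> bowen_ball \<alpha> n \<epsilon>0 y \<Longrightarrow> \<bar>S n x - S n y\<bar> \<le> real n * \<eta>"
    by (rule modulus[OF \<eta>(1)]) (rule that)
  \<comment> \<open>Two orbits with a common label are compared through the centre of its ball,
    which doubles the radius.\<close>
  define \<epsilon>1 where "\<epsilon>1 = min \<epsilon>0 (\<epsilon> / 2)"
  have \<epsilon>1: "0 < \<epsilon>1" "2 * \<epsilon>1 \<le> \<epsilon>" using \<epsilon> \<epsilon>0 by (auto simp: \<epsilon>1_def)
  have mod1: "\<bar>S n x - S n y\<bar> \<le> real n * \<eta>" if "x \<in> bowen_ball \<alpha> n \<epsilon>1 y" for n x y
    using that by (intro mod0) (auto simp: bowen_ball_def \<epsilon>1_def)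
  obtain M where M: "1 \<le> M" and ess: "\<And>m. 0 < m \<Longrightarrow> \<exists>E. finite E \<and> Y \<subseteq> (\<Union>y\<in>E. bowen_ball \<alpha> m \<epsilon>1 y) \<and>
    (\<Sum>y\<in>E. exp (S m y)) \<le> M * max_fibre_sum m"
    by (rule essential_spanning[OF lh \<epsilon>1(1)]) (rule that)
  have "(\<lambda>n. ln M * (1 / real n)) \<longlonglongrightarrow> ln M * 0" by (intro tendsto_intros lim_1_over_n)
  then have "\<forall>\<^sub>F n in sequentially. ln M * (1 / real n) < \<eta>" using \<eta>(1) by (intro order_tendstoD) auto
  then have "\<forall>\<^sub>F n in sequentially. ln (max_fibre_sum n) / real n < l + \<eta> \<and> ln M / real n < \<eta> \<and> 0 < n"
    using order_tendstoD(2)[OF l, of "l + \<eta>"] \<eta>(1) eventually_gt_at_top[of 0] by (auto simp: eventually_conj_iff)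
  then obtain m where m: "0 < m" and bm: "ln (max_fibre_sum m) / real m < l + \<eta>" and Mm: "ln M / real m < \<eta>"
    unfolding eventually_sequentially by blast
  define s where "s = exp (real m * \<eta>) * (M * max_fibre_sum m)"
  define c where "c = exp (real m * \<eta>) * s"
  have Zp: "0 < max_fibre_sum m" by (rule max_fibre_sum_pos[OF m])
  have s0: "0 < s" using Zp M by (simp add: s_def)
  have sc: "s < c" using s0 m \<eta>(1) by (simp add: c_def)
  have c0: "0 < c" using s0 sc by simp
  have "ln c = real m * \<eta> + (real m * \<eta> + (ln M + ln (max_fibre_sum m)))"
    using Zp M s0 by (simp add: c_def s_def ln_mult)
  then have lnc: "ln c / real m = \<eta> + (\<eta> + (ln M / real m + ln (max_fibre_sum m) / real m))"
    using m by (simp add: field_simps)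
  obtain EY where EY: "finite EY" "Y \<subseteq> (\<Union>y\<in>EY. bowen_ball \<alpha> m \<epsilon>1 y)"
    "(\<Sum>y\<in>EY. exp (S m y)) \<le> M * max_fibre_sum m"
    using ess[OF m] by blast
  obtain G where G: "finite G" "UNIV = (\<Union>y\<in>G. bowen_ball \<alpha> m \<epsilon>1 y)"
    using finite_bowen_net[OF compact_space continuous_map \<epsilon>1(1)] by blast
  define O' where "O' = (\<Union>y\<in>EY. bowen_ball \<alpha> m \<epsilon>1 y)"
  \<comment> \<open>\<open>O'\<close> is an open neighbourhood of \<open>Y\<close>, so
    \<open>h\<close> has a positive minimum \<kappa> on its compact complement, unless that is
    empty.\<close>
  have "compact (- O')"
    unfolding O'_def using compact_space open_bowen_ball[OF continuous_map]
    by (metis closed_Compl compact_Int_closed inf_top_left open_UN)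
  obtain \<kappa> where \<kappa>: "0 < \<kappa>" "\<And>z. z \<notin> O' \<Longrightarrow> \<kappa> \<le> h z"
  proof (cases "O' = UNIV")
    case False
    then obtain z0 where z0: "z0 \<in> - O'" "\<And>z. z \<in> - O' \<Longrightarrow> h z0 \<le> h z"
      using continuous_attains_inf[OF \<open>compact (- O')\<close>, of h] continuous_on_subset[OF continuous_h] by blast
    have "z0 \<notin> Y" using z0(1) EY(2) by (auto simp: O'_def)
    then have "0 < h z0" using h_zero_iff[of z0] infdist_nonneg[of z0 Y] by linarith
    then show thesis using z0(2) by (intro that[of "h z0"]) auto
  qed (auto intro: that[of 1])
  obtain B where B: "0 \<le> B" "\<And>x. \<bar>\<phi> x\<bar> \<le> B" using bounded_fun[OF continuous_\<phi>] by blast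
  \<comment> \<open>Blocks starting outside \<open>O'\<close> pay at least
    \<open>k * \<kappa>\<close>. A large \<open>k\<close> pushes the total weight of their labels
    below \<open>c - s\<close>.\<close>
  have "(\<lambda>k. real (card G) * (exp (real m * B) * exp (- \<kappa>) ^ k)) \<longlonglongrightarrow> real (card G) * (exp (real m * B) * 0)"
    using \<kappa>(1) by (intro tendsto_intros LIMSEQ_power_zero) simp
  then have "\<forall>\<^sub>F k in sequentially. real (card G) * (exp (real m * B) * exp (- \<kappa>) ^ k) < c - s"
    using sc by (intro order_tendstoD(2)) auto
  then obtain k where k: "real (card G) * (exp (real m * B) * exp (- \<kappa>) ^ k) < c - s"
    unfolding eventually_sequentially by blast
  define \<phi>k where "\<phi>k y = \<phi> y - real k * h y" for y
  have \<phi>kc: "continuous_on UNIV \<phi>k" unfolding \<phi>k_def by (intro continuous_intros continuous_\<phi>)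
  have Sk: "birkhoff_sum \<alpha> \<phi>k n y = S n y - real k * birkhoff_sum \<alpha> h n y" for n y
    by (simp add: birkhoff_sum_def \<phi>k_def sum_subtractf sum.distrib sum_distrib_left)
  \<comment> \<open>The sum type keeps the two kinds of labels apart even when \<open>EY\<close> and
    \<open>G\<close> share points, as their weights differ.\<close>
  define L where "L = Inl ` EY \<union> Inr ` G"
  define w where "w = case_sum (\<lambda>y. exp (real m * \<eta>) * exp (S m y)) (\<lambda>_::'a. exp (real m * B) * exp (- \<kappa>) ^ k)"
  have "\<exists>b\<in>L. z \<in> bowen_ball \<alpha> m \<epsilon>1 (case_sum id id b) \<and> exp (birkhoff_sum \<alpha> \<phi>k m z) \<le> w b" for z
  proof (cases "z \<in> O'")
    case True
    then obtain y where y: "y \<in> EY" "z \<in> bowen_ball \<alpha> m \<epsilon>1 y" by (auto simp: O'_def)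
    have "0 \<le> birkhoff_sum \<alpha> h m z" by (simp add: birkhoff_sum_def sum_nonneg infdist_nonneg)
    then have "birkhoff_sum \<alpha> \<phi>k m z \<le> S m z" by (simp add: Sk)
    also have "\<dots> \<le> real m * \<eta> + S m y" using mod1[OF y(2)] by linarith
    finally have "exp (birkhoff_sum \<alpha> \<phi>k m z) \<le> w (Inl y)" by (simp add: w_def flip: exp_add)
    then show ?thesis using y by (intro bexI[of _ "Inl y"]) (auto simp: L_def)
  next
    case False
    obtain y where y: "y \<in> G" "z \<in> bowen_ball \<alpha> m \<epsilon>1 y" using G(2) by blast
    have "\<kappa> \<le> h z" by (rule \<kappa>(2)[OF False])
    also have "h z = (\<Sum>i\<in>{0}. h ((\<alpha> ^^ i) z))" by simp
    also have "\<dots> \<le> birkhoff_sum \<alpha> h m z"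
      unfolding birkhoff_sum_def using m by (intro sum_mono2) (auto simp: infdist_nonneg)
    finally have "real k * \<kappa> \<le> real k * birkhoff_sum \<alpha> h m z" by (rule mult_left_mono) simp
    moreover have "S m z \<le> real m * B" using abs_birkhoff_sum_le[of \<phi> B \<alpha> m z] B(2) by (simp add: abs_le_iff)
    ultimately have "birkhoff_sum \<alpha> \<phi>k m z \<le> real m * B + real k * - \<kappa>" by (simp add: Sk)
    then have "exp (birkhoff_sum \<alpha> \<phi>k m z) \<le> exp (real m * B + real k * - \<kappa>)" by simp
    then have "exp (birkhoff_sum \<alpha> \<phi>k m z) \<le> w (Inr y)" unfolding w_def exp_add exp_of_nat_mult by simp
    then show ?thesis using y by (intro bexI[of _ "Inr y"]) (auto simp: L_def)
  qed
  then obtain lab where labL: "\<And>z. lab z \<in> L" and labb: "\<And>z. z \<in> bowen_ball \<alpha> m \<epsilon>1 (case_sum id id (lab z))"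
    and labw: "\<And>z. exp (birkhoff_sum \<alpha> \<phi>k m z) \<le> w (lab z)"
    by metis
  have w0: "0 \<le> w b" for b by (cases b) (auto simp: w_def)
  have Lfin: "finite L" using EY(1) G(1) by (simp add: L_def)
  have "(\<Sum>b\<in>L. w b) = (\<Sum>b\<in>Inl ` EY. w b) + (\<Sum>b\<in>Inr ` G. w b)"
    unfolding L_def using EY(1) G(1) by (intro sum.union_disjoint) auto
  also have "\<dots> = exp (real m * \<eta>) * (\<Sum>y\<in>EY. exp (S m y)) + real (card G) * (exp (real m * B) * exp (- \<kappa>) ^ k)"
    by (simp add: sum.reindex w_def sum_distrib_left)
  also have "\<dots> \<le> s + (c - s)"
    unfolding s_def[symmetric] using EY(3) k by (intro add_mono) (simp_all add: s_def)
  finally have wc: "(\<Sum>b\<in>L. w b) \<le> c" by simp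
  obtain B' where B': "0 \<le> B'" "\<And>x. \<bar>\<phi>k x\<bar> \<le> B'" using bounded_fun[OF \<phi>kc] by blast
  define \<delta> where "\<delta> = \<eta> / (real k + 1)"
  have \<delta>: "0 < \<delta>" using \<eta> by (simp add: \<delta>_def add_nonneg_pos)
  have "(real k + 1) * \<delta> = \<eta>" by (simp add: \<delta>_def add_nonneg_pos)
  then have \<delta>k: "real k * \<delta> \<le> \<eta>" using \<delta> by (simp add: distrib_right)
  have "ln c / real m + real k * \<delta> < t" using lnc \<delta>k bm Mm \<eta> by linarith
  from block_growth[OF m c0 _ this, of "exp (real m * B') * c"] c0
  have "\<forall>\<^sub>F n in sequentially. exp (real n * (real k * \<delta>)) * (exp (real m * B') * c * c ^ (n div m)) \<le> exp (real n * t)"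
    by simp
  from this orbits_near_essential_set[OF compact_space continuous_map \<delta>] eventually_gt_at_top[of 0]
  show ?thesis
  proof eventually_elim
    case (elim n)
    \<comment> \<open>One block beyond \<open>n div m\<close> ensures that all times below
      \<open>n\<close> are covered. The overshoot of at most \<open>m\<close> steps costs
      \<open>exp (m * B')\<close>, and the extra block costs one factor \<open>c\<close>.\<close>
    define q where "q = Suc (n div m)"
    have nq: "n \<le> q * m"
      using dividend_less_div_times[OF m, of n] by (simp add: q_def less_imp_le)
    from itinerary_representatives[where L=L and lab=lab and w=w and \<tau>="\<alpha> ^^ m" and q=q, OF Lfin labL w0]
    obtain E where E: "finite E" "\<forall>x. \<exists>y\<in>E. \<forall>j<q. lab (((\<alpha> ^^ m) ^^ j) x) = lab (((\<alpha> ^^ m) ^^ j) y)"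
      and sE: "(\<Sum>y\<in>E. \<Prod>j<q. w (lab (((\<alpha> ^^ m) ^^ j) y))) \<le> (\<Sum>b\<in>L. w b) ^ q"
      by (elim exE conjE)
    have block: "((\<alpha> ^^ m) ^^ j) x = (\<alpha> ^^ (j * m)) x" for j x
      by (simp add: funpow_mult mult.commute)
    have span: "UNIV = (\<Union>y\<in>E. bowen_ball \<alpha> n \<epsilon> y)"
    proof -
      have "x \<in> (\<Union>y\<in>E. bowen_ball \<alpha> n \<epsilon> y)" for x
      proof -
        obtain y where y: "y \<in> E" "\<forall>j<q. lab ((\<alpha> ^^ (j * m)) x) = lab ((\<alpha> ^^ (j * m)) y)"
          using E(2)[THEN spec, of x] unfolding block by blast
        have "dist ((\<alpha> ^^ i) x) ((\<alpha> ^^ i) y) < \<epsilon>" if i: "i < n" for i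
        proof -
          define j where "j = i div m"
          have "j < q" using i by (simp add: j_def q_def div_le_mono less_Suc_eq_le)
          then have "lab ((\<alpha> ^^ (j * m)) x) = lab ((\<alpha> ^^ (j * m)) y)" using y(2) by blast
          then obtain p where "(\<alpha> ^^ (j * m)) x \<in> bowen_ball \<alpha> m \<epsilon>1 p" "(\<alpha> ^^ (j * m)) y \<in> bowen_ball \<alpha> m \<epsilon>1 p"
            using labb by metis
          then have "dist ((\<alpha> ^^ (i mod m)) ((\<alpha> ^^ (j * m)) x)) ((\<alpha> ^^ (i mod m)) p) < \<epsilon>1"
            "dist ((\<alpha> ^^ (i mod m)) ((\<alpha> ^^ (j * m)) y)) ((\<alpha> ^^ (i mod m)) p) < \<epsilon>1"
            using m by (auto simp: bowen_ball_def)
          then have "dist ((\<alpha> ^^ (i mod m)) ((\<alpha> ^^ (j * m)) x)) ((\<alpha> ^^ (i mod m)) ((\<alpha> ^^ (j * m)) y)) < \<epsilon>"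
            using \<epsilon>1(2) dist_triangle2[of "(\<alpha> ^^ (i mod m)) ((\<alpha> ^^ (j * m)) x)"
              "(\<alpha> ^^ (i mod m)) ((\<alpha> ^^ (j * m)) y)" "(\<alpha> ^^ (i mod m)) p"] by linarith
          moreover have "(\<alpha> ^^ (i mod m)) ((\<alpha> ^^ (j * m)) z) = (\<alpha> ^^ i) z" for z
            using funpow_add[of "i mod m" "j * m" \<alpha>] by (simp add: j_def fun_eq_iff)
          ultimately show ?thesis by simp
        qed
        then show ?thesis using y(1) by (auto simp: bowen_ball_def)
      qed
      then show ?thesis by blast
    qed
    have prod: "exp (birkhoff_sum \<alpha> \<phi>k (j * m) y) = (\<Prod>i<j. exp (birkhoff_sum \<alpha> \<phi>k m (((\<alpha> ^^ m) ^^ i) y)))" for j y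
    proof (induction j)
      case (Suc j)
      then show ?case
        using birkhoff_sum_add[of \<alpha> \<phi>k "j * m" m y] by (simp add: block exp_add add.commute)
    qed (simp add: birkhoff_sum_def)
    have each: "exp (S n y) \<le> exp (real n * (real k * \<delta>)) * exp (real m * B') * (\<Prod>j<q. w (lab (((\<alpha> ^^ m) ^^ j) y)))" for y
    proof -
      have "real k * birkhoff_sum \<alpha> h n y \<le> real k * (real n * \<delta>)"
        using elim(2) by (intro mult_left_mono) auto
      then have 1: "S n y \<le> real n * (real k * \<delta>) + birkhoff_sum \<alpha> \<phi>k n y"
        by (simp add: Sk mult_ac)
      have "birkhoff_sum \<alpha> \<phi>k (q * m) y = birkhoff_sum \<alpha> \<phi>k n y + birkhoff_sum \<alpha> \<phi>k (q * m - n) ((\<alpha> ^^ n) y)"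
        using birkhoff_sum_add[of \<alpha> \<phi>k n "q * m - n" y] nq by simp
      moreover have "\<bar>birkhoff_sum \<alpha> \<phi>k (q * m - n) ((\<alpha> ^^ n) y)\<bar> \<le> real (q * m - n) * B'"
        by (rule abs_birkhoff_sum_le) (rule B'(2))
      moreover have "q * m - n \<le> m"
        by (simp add: q_def le_diff_conv)
      then have "real (q * m - n) * B' \<le> real m * B'" using B'(1) by (intro mult_right_mono) auto
      ultimately have "S n y \<le> real n * (real k * \<delta>) + real m * B' + birkhoff_sum \<alpha> \<phi>k (q * m) y"
        using 1 by linarith
      then have "exp (S n y) \<le> exp (real n * (real k * \<delta>)) * exp (real m * B') * exp (birkhoff_sum \<alpha> \<phi>k (q * m) y)"
        by (simp flip: exp_add)
      also have "\<dots> \<le> exp (real n * (real k * \<delta>)) * exp (real m * B') * (\<Prod>j<q. w (lab (((\<alpha> ^^ m) ^^ j) y)))"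
        unfolding prod using labw by (intro mult_left_mono prod_mono) auto
      finally show ?thesis .
    qed
    have "(\<Sum>y\<in>E. exp (S n y)) \<le> (\<Sum>y\<in>E. exp (real n * (real k * \<delta>)) * exp (real m * B') * (\<Prod>j<q. w (lab (((\<alpha> ^^ m) ^^ j) y))))"
      by (intro sum_mono each)
    also have "\<dots> = exp (real n * (real k * \<delta>)) * exp (real m * B') * (\<Sum>y\<in>E. \<Prod>j<q. w (lab (((\<alpha> ^^ m) ^^ j) y)))"
      by (simp add: sum_distrib_left)
    also have "\<dots> \<le> exp (real n * (real k * \<delta>)) * exp (real m * B') * c ^ q"
      using order_trans[OF sE power_mono[OF wc sum_nonneg[OF w0]]] by (intro mult_left_mono) auto
    also have "\<dots> = exp (real n * (real k * \<delta>)) * (exp (real m * B') * c * c ^ (n div m))"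
      by (simp add: q_def mult_ac)
    also have "\<dots> \<le> exp (real n * t)" by (rule elim(1))
    finally show ?case using E(1) span elim(3) by (intro exI[of _ E]) (auto simp: spanning_iff)
  qed
qed

text \<open>By \<open>fibre_separated\<close> every fibre injects into every spanning set of small
  radius, and passing from a point to its centre changes the Birkhoff sum by at most
  \<open>n * \<eta>\<close>.\<close>

theorem pressure_lower:
  assumes l: "(\<lambda>n. ln (max_fibre_sum n) / real n) \<longlonglongrightarrow> l" and t: "t < l"
  obtains \<epsilon>0 where "0 < \<epsilon>0" "\<And>\<epsilon>. \<epsilon> \<le> \<epsilon>0 \<Longrightarrow> \<forall>\<^sub>F n in sequentially.
    \<forall>E. finite E \<and> spanning \<alpha> n \<epsilon> E \<longrightarrow> exp (real n * t) \<le> (\<Sum>y\<in>E. exp (S n y))"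
proof -
  define \<eta> where "\<eta> = (l - t) / 2"
  have \<eta>: "0 < \<eta>" "t = l - \<eta> - \<eta>" using t by (auto simp: \<eta>_def field_simps)
  obtain r where r: "0 < r" and sep: "\<And>n x \<epsilon> E. 2 * \<epsilon> \<le> r \<Longrightarrow> UNIV = (\<Union>y\<in>E. bowen_ball \<alpha> n \<epsilon> y) \<Longrightarrow>
    \<exists>e. inj_on e (fibre n x) \<and> (\<forall>y\<in>fibre n x. e y \<in> E \<and> y \<in> bowen_ball \<alpha> n \<epsilon> (e y))"
    by (rule fibre_separated) (rule that)
  obtain \<epsilon>1 where \<epsilon>1: "0 < \<epsilon>1" and mod1: "\<And>n x y. x \<in> bowen_ball \<alpha> n \<epsilon>1 y \<Longrightarrow> \<bar>S n x - S n y\<bar> \<le> real n * \<eta>"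
    by (rule modulus[OF \<eta>(1)]) (rule that)
  have "\<forall>\<^sub>F n in sequentially. \<forall>E. finite E \<and> spanning \<alpha> n \<epsilon> E \<longrightarrow> exp (real n * t) \<le> (\<Sum>y\<in>E. exp (S n y))"
    if \<epsilon>: "\<epsilon> \<le> min \<epsilon>1 (r / 2)" for \<epsilon>
  proof -
    have "\<forall>\<^sub>F n in sequentially. l - \<eta> < ln (max_fibre_sum n) / real n"
      using \<eta>(1) by (intro order_tendstoD(1)[OF l]) simp
    then show ?thesis using eventually_gt_at_top[of 0]
    proof eventually_elim
      case (elim n)
      show ?case
      proof (intro allI impI)
        fix E assume E: "finite E \<and> spanning \<alpha> n \<epsilon> E"
        then have span: "UNIV = (\<Union>y\<in>E. bowen_ball \<alpha> n \<epsilon> y)" using elim(2) by (simp add: spanning_iff)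
        have "fibre_sum n x \<le> exp (real n * \<eta>) * (\<Sum>y\<in>E. exp (S n y))" for x
        proof -
          obtain e where e: "inj_on e (fibre n x)" "\<And>y. y \<in> fibre n x \<Longrightarrow> e y \<in> E"
            "\<And>y. y \<in> fibre n x \<Longrightarrow> y \<in> bowen_ball \<alpha> n \<epsilon> (e y)"
            using sep[OF _ span, of x] \<epsilon> by auto
          have "fibre_sum n x \<le> (\<Sum>y\<in>fibre n x. exp (real n * \<eta>) * exp (S n (e y)))"
            unfolding fibre_sum_def
          proof (rule sum_mono)
            fix y assume "y \<in> fibre n x"
            then have "y \<in> bowen_ball \<alpha> n \<epsilon>1 (e y)" using e(3)[of y] \<epsilon> by (auto simp: bowen_ball_def)
            then have "S n y \<le> real n * \<eta> + S n (e y)" using mod1[of y n "e y"] by linarith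
            then show "exp (S n y) \<le> exp (real n * \<eta>) * exp (S n (e y))" by (simp flip: exp_add)
          qed
          also have "\<dots> = exp (real n * \<eta>) * (\<Sum>y\<in>e ` fibre n x. exp (S n y))"
            by (simp add: sum.reindex[OF e(1)] sum_distrib_left)
          also have "\<dots> \<le> exp (real n * \<eta>) * (\<Sum>y\<in>E. exp (S n y))"
            using E e(2) by (intro mult_left_mono sum_mono2) auto
          finally show ?thesis .
        qed
        then have "max_fibre_sum n \<le> exp (real n * \<eta>) * (\<Sum>y\<in>E. exp (S n y))" by (rule max_fibre_sum_le)
        moreover have "exp (real n * (l - \<eta>)) \<le> max_fibre_sum n"
        proof -
          have "real n * (l - \<eta>) \<le> ln (max_fibre_sum n)" using elim by (simp add: field_simps)
          then show ?thesis using max_fibre_sum_pos[OF elim(2)] by (simp add: ln_ge_iff)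
        qed
        moreover have "exp (real n * (l - \<eta>)) = exp (real n * \<eta>) * exp (real n * t)"
          unfolding \<eta>(2) by (simp add: algebra_simps flip: exp_add)
        ultimately have "exp (real n * \<eta>) * exp (real n * t) \<le> exp (real n * \<eta>) * (\<Sum>y\<in>E. exp (S n y))"
          by linarith
        then show "exp (real n * t) \<le> (\<Sum>y\<in>E. exp (S n y))" by simp
      qed
    qed
  qed
  then show thesis using \<epsilon>1 r by (intro that[of "min \<epsilon>1 (r / 2)"]) auto
qed

text \<open>As \<open>Lim\<close> is a definite description, convergence has to be proved:
  \<open>exp l\<close> bounds \<open>R\<close> from above at every positive \<epsilon>, and each
  \<open>exp t\<close> with \<open>t < l\<close> bounds it from below at all small
  \<epsilon>.\<close>

theorem pressure_eq:
  assumes lh: "local_homeomorphism_on Y \<alpha>"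
    and l: "(\<lambda>n. ln (max_fibre_sum n) / real n) \<longlonglongrightarrow> l"
  shows "pressure \<alpha> \<phi> = ereal l"
proof -
  define R where "R \<epsilon> = limsup (\<lambda>n. INF E\<in>{E. finite E \<and> spanning \<alpha> n \<epsilon> E}.
    ereal (root n (\<Sum>y\<in>E. \<Prod>i<n. exp (\<phi> ((\<alpha> ^^ i) y)))))" for \<epsilon>
  have ps: "(\<Sum>y\<in>E. \<Prod>i<n. exp (\<phi> ((\<alpha> ^^ i) y))) = (\<Sum>y\<in>E. exp (S n y))" for n E
    by (simp add: birkhoff_sum_def exp_sum del: exp_add)
  have root_exp: "root n (exp (real n * t)) = exp t" if "0 < n" for n t
    using that by (simp add: exp_of_nat_mult real_root_power_cancel)
  have upper: "R \<epsilon> \<le> ereal (exp t)" if "0 < \<epsilon>" "l < t" for \<epsilon> t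
    unfolding R_def
  proof (rule Limsup_bounded)
    show "\<forall>\<^sub>F n in sequentially. (INF E\<in>{E. finite E \<and> spanning \<alpha> n \<epsilon> E}.
        ereal (root n (\<Sum>y\<in>E. \<Prod>i<n. exp (\<phi> ((\<alpha> ^^ i) y))))) \<le> ereal (exp t)"
      using pressure_upper[OF lh l that(2,1)] eventually_gt_at_top[of 0]
    proof eventually_elim
      case (elim n)
      then obtain E where E: "finite E" "spanning \<alpha> n \<epsilon> E" "(\<Sum>y\<in>E. exp (S n y)) \<le> exp (real n * t)" by blast
      then have "root n (\<Sum>y\<in>E. exp (S n y)) \<le> root n (exp (real n * t))"
        using elim by (simp add: real_root_le_iff)
      then show ?case
        using E elim unfolding ps by (intro INF_lower2[of E]) (auto simp: root_exp)
    qed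
  qed
  have R_le: "R \<epsilon> \<le> ereal (exp l)" if "0 < \<epsilon>" for \<epsilon>
  proof (rule tendsto_lowerbound)
    show "((\<lambda>t. ereal (exp t)) \<longlongrightarrow> ereal (exp l)) (at_right l)"
      by (intro tendsto_intros)
    show "\<forall>\<^sub>F t in at_right l. R \<epsilon> \<le> ereal (exp t)"
      using upper[OF that] by (auto simp: eventually_at_filter)
  qed simp
  have lower: "\<exists>\<epsilon>0>0. \<forall>\<epsilon>\<le>\<epsilon>0. ereal (exp t) \<le> R \<epsilon>" if t: "t < l" for t
  proof -
    obtain \<epsilon>0 where \<epsilon>0: "0 < \<epsilon>0" "\<And>\<epsilon>. \<epsilon> \<le> \<epsilon>0 \<Longrightarrow> \<forall>\<^sub>F n in sequentially.
        \<forall>E. finite E \<and> spanning \<alpha> n \<epsilon> E \<longrightarrow> exp (real n * t) \<le> (\<Sum>y\<in>E. exp (S n y))"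
      by (rule pressure_lower[OF l t]) (rule that)
    have "ereal (exp t) \<le> R \<epsilon>" if "\<epsilon> \<le> \<epsilon>0" for \<epsilon>
      unfolding R_def
    proof (rule le_Limsup)
      show "\<forall>\<^sub>F n in sequentially. ereal (exp t) \<le> (INF E\<in>{E. finite E \<and> spanning \<alpha> n \<epsilon> E}.
          ereal (root n (\<Sum>y\<in>E. \<Prod>i<n. exp (\<phi> ((\<alpha> ^^ i) y)))))"
        using \<epsilon>0(2)[OF that] eventually_gt_at_top[of 0]
      proof eventually_elim
        case (elim n)
        show ?case
          unfolding ps
        proof (rule INF_greatest, clarify)
          fix E assume "finite E" "spanning \<alpha> n \<epsilon> E"
          then have "root n (exp (real n * t)) \<le> root n (\<Sum>y\<in>E. exp (S n y))"
            using elim by (simp add: real_root_le_iff)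
          then show "ereal (exp t) \<le> ereal (root n (\<Sum>y\<in>E. exp (S n y)))"
            using elim by (simp add: root_exp)
        qed
      qed
    qed simp
    then show ?thesis using \<epsilon>0(1) by blast
  qed
  have "(R \<longlongrightarrow> ereal (exp l)) (at_right 0)"
  proof (rule order_tendstoI)
    fix a assume a: "a < ereal (exp l)"
    have "((\<lambda>t. ereal (exp t)) \<longlongrightarrow> ereal (exp l)) (at_left l)"
      by (intro tendsto_intros)
    then have "\<forall>\<^sub>F t in at_left l. a < ereal (exp t)" using a by (rule order_tendstoD)
    moreover have "\<forall>\<^sub>F t in at_left l. t < l" by (auto simp: eventually_at_filter)
    ultimately have "\<forall>\<^sub>F t in at_left l. a < ereal (exp t) \<and> t < l" by (rule eventually_conj)
    then obtain t where t: "a < ereal (exp t)" "t < l"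
      using eventually_happens' trivial_limit_at_left_real by blast
    obtain \<epsilon>0 where \<epsilon>0: "0 < \<epsilon>0" "\<And>\<epsilon>. \<epsilon> \<le> \<epsilon>0 \<Longrightarrow> ereal (exp t) \<le> R \<epsilon>" using lower[OF t(2)] by blast
    show "\<forall>\<^sub>F \<epsilon> in at_right 0. a < R \<epsilon>"
      using \<epsilon>0 t(1) by (intro eventually_at_rightI[of 0 \<epsilon>0]) (auto intro: less_le_trans less_imp_le)
  next
    fix a assume a: "ereal (exp l) < a"
    show "\<forall>\<^sub>F \<epsilon> in at_right 0. R \<epsilon> < a"
      using R_le a by (intro eventually_at_rightI[of 0 1]) (auto intro: le_less_trans)
  qed
  then have "Lim (at_right 0) R = ereal (exp l)" by (intro tendsto_Lim) simp_all
  then have "pressure \<alpha> \<phi> = ereal_ln (ereal (exp l))" unfolding pressure_def R_def[abs_def] by simp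
  then show ?thesis by (simp add: ereal_ln_def not_le)
qed

end

theorem theorem23:
  fixes \<alpha> :: "'a::metric_space \<Rightarrow> 'a"
    and A :: "('a \<Rightarrow>\<^sub>C complex) \<Rightarrow> ('a \<Rightarrow>\<^sub>C complex)"
    and \<rho> :: "'a \<Rightarrow> real"
    and \<psi> :: "'a \<Rightarrow>\<^sub>C real"
  assumes "compact (UNIV :: 'a set)"
    and "continuous_on UNIV \<alpha>"
    and "non_contracting_on (essential_set \<alpha>) \<alpha>"
    and "local_homeomorphism_on (essential_set \<alpha>) \<alpha>"
    and "transfer_operator \<alpha> A"
    and "compatible (essential_set \<alpha>) A"
    and "\<forall>y\<in>essential_set \<alpha>. cocycle \<alpha> A y > 0"
    and "continuous_on UNIV \<rho>"
    and "\<forall>x. \<rho> x > 0"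
    and "\<forall>y\<in>essential_set \<alpha>. \<rho> y = cocycle \<alpha> A y"
  shows "spectral_exponent A \<psi> = pressure \<alpha> (\<lambda>x. \<psi> x + ln (\<rho> x))"
proof -
  interpret cocycle_system \<alpha> A \<rho> "apply_bcontfun \<psi>"
    using assms by unfold_locales auto
  obtain l where l: "(\<lambda>n. ln (op_sup n) / real n) \<longlonglongrightarrow> l" "(\<lambda>n. ln (max_fibre_sum n) / real n) \<longlonglongrightarrow> l"
    by (rule growth_rate)
  have on: "onorm (weighted_operator A \<psi> ^^ n) = op_sup n" for n
    using onorm_weighted_operator_le[OF op_sup_upper] op_sup_least[OF onorm_weighted_operator_ge]
    by (rule antisym)
  have "(\<lambda>n. ereal (ln (op_sup n) / real n)) \<longlonglongrightarrow> ereal l" using l(1) by simp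
  \<comment> \<open>For \<open>n > 0\<close> the norm is positive, so the extended logarithm is the
    real one.\<close>
  moreover have "\<forall>\<^sub>F n in sequentially. ereal (ln (op_sup n) / real n) =
      ereal (1 / real n) * ereal_ln (ereal (onorm (weighted_operator A \<psi> ^^ n)))"
    using eventually_gt_at_top[of 0]
    by eventually_elim (simp add: on ereal_ln_def not_le op_sup_pos)
  ultimately have "(\<lambda>n. ereal (1 / real n) * ereal_ln (ereal (onorm (weighted_operator A \<psi> ^^ n)))) \<longlonglongrightarrow> ereal l"
    by (rule Lim_transform_eventually)
  then show ?thesis
    unfolding spectral_exponent_def pressure_eq[OF assms(4) l(2)] by (rule limI)
qed

end
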